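(* Let $M^n$ be a compact Kähler manifold with $Ric^{\perp}>0$. Then there exists no surjective holomorphic map from $M^n$ onto a complex curve, and there exists no birational morphism $f:M\to Z$ onto a normal variety $Z$ under which a smooth hypersurface in $M$ is mapped to a (smooth or singular) point of $Z$.
   Context: Orthogonal Ricci curvature: on a Kähler manifold with curvature tensor $R$ and Ricci curvature $Ric$, for a nonzero type $(1,0)$ tangent vector $X$, $Ric^{\perp}_{X\overline X}=Ric(X,\overline X)-R(X,\overline X,X,\overline X)/|X|^2$; "$Ric^\perp>0$" means $Ric^\perp_{X\overline X}>0$ for every nonzero $(1,0)$ vector $X$ at every point (this forces $n\ge2$). Curvature is normalized so that $Ric(X,\overline X)=\sum_j R(X,\overline X,e_j,\overline{e_j})$ for a unitary frame $\{e_j\}$. Manifolds are connected. A compact Kähler manifold with $Ric^\perp>0$ is known to be projective. *)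

theory Defs
  imports "HOL-Analysis.Analysis"
begin

section \<open>Complex manifolds\<close>

definition holomorphic_fun_on :: "(complex^'n \<Rightarrow> complex) \<Rightarrow> (complex^'n) set \<Rightarrow> bool" where
  "holomorphic_fun_on f S \<longleftrightarrow>
     (\<forall>z\<in>S. \<exists>L. (f has_derivative L) (at z) \<and> (\<forall>c v. L (c *s v) = c * L v))"

definition holomorphic_vec_on :: "(complex^'n \<Rightarrow> complex^'m) \<Rightarrow> (complex^'n) set \<Rightarrow> bool" where
  "holomorphic_vec_on f S \<longleftrightarrow> (\<forall>i. holomorphic_fun_on (\<lambda>z. f z $ i) S)"

text \<open>
  The underlying space of a manifold is a whole type \<open>'a\<close> with its topology. A chart is a pair
  \<open>(U, \<phi>)\<close>; the values of \<open>\<phi>\<close> outside \<open>U\<close> are irrelevant. The complex dimension is \<open>CARD('n)\<close>.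
  The atlas need not be maximal.
\<close>

definition complex_manifold ::
  "('a::{t2_space,second_countable_topology} set \<times> ('a \<Rightarrow> complex^'n)) set \<Rightarrow> bool" where
  "complex_manifold A \<longleftrightarrow>
     (\<Union>(U,\<phi>)\<in>A. U) = UNIV \<and>
     (\<forall>(U,\<phi>)\<in>A. open U \<and> open (\<phi> ` U) \<and> homeomorphism U (\<phi> ` U) \<phi> (inv_into U \<phi>)) \<and>
     (\<forall>(U,\<phi>)\<in>A. \<forall>(V,\<psi>)\<in>A. holomorphic_vec_on (\<psi> \<circ> inv_into U \<phi>) (\<phi> ` (U \<inter> V)))"

definition holomorphic_map ::
  "('a::topological_space set \<times> ('a \<Rightarrow> complex^'n)) set \<Rightarrow>
   ('b::topological_space set \<times> ('b \<Rightarrow> complex^'m)) set \<Rightarrow> ('a \<Rightarrow> 'b) \<Rightarrow> bool" where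
  "holomorphic_map A B f \<longleftrightarrow>
     continuous_on UNIV f \<and>
     (\<forall>(U,\<phi>)\<in>A. \<forall>(V,\<psi>)\<in>B.
        holomorphic_vec_on (\<psi> \<circ> f \<circ> inv_into U \<phi>) (\<phi> ` (U \<inter> f -` V)))"

text \<open>A closed complex submanifold of codimension one, through local defining equations.
  Connectedness is not required.\<close>

definition smooth_hypersurface ::
  "('a::topological_space set \<times> ('a \<Rightarrow> complex^'n)) set \<Rightarrow> 'a set \<Rightarrow> bool" where
  "smooth_hypersurface A D \<longleftrightarrow>
     closed D \<and> D \<noteq> {} \<and>
     (\<forall>x\<in>D. \<exists>(U,\<phi>)\<in>A. \<exists>W h. open W \<and> x \<in> W \<and> W \<subseteq> U \<and>
        holomorphic_fun_on h (\<phi> ` W) \<and>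
        (\<forall>y\<in>W. y \<in> D \<longleftrightarrow> h (\<phi> y) = 0) \<and>
        (\<exists>v. frechet_derivative h (at (\<phi> x)) v \<noteq> 0))"


section \<open>Kaehler metrics and curvature\<close>

fun ck_on :: "nat \<Rightarrow> (complex^'n \<Rightarrow> complex) \<Rightarrow> (complex^'n) set \<Rightarrow> bool" where
  "ck_on 0 f S = continuous_on S f"
| "ck_on (Suc k) f S =
     ((\<forall>z\<in>S. f differentiable at z) \<and> (\<forall>v. ck_on k (\<lambda>z. frechet_derivative f (at z) v) S))"

text \<open>The Wirtinger derivatives \<open>\<partial>/\<partial>z\<^sub>k\<close> and \<open>\<partial>/\<partial>\<bar>z\<^sub>k\<close>.\<close>

definition wirt :: "'n \<Rightarrow> (complex^'n \<Rightarrow> complex) \<Rightarrow> complex^'n \<Rightarrow> complex" where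
  "wirt k f z = (frechet_derivative f (at z) (axis k 1)
                 - \<i> * frechet_derivative f (at z) (axis k \<i>)) / 2"

definition wirt_bar :: "'n \<Rightarrow> (complex^'n \<Rightarrow> complex) \<Rightarrow> complex^'n \<Rightarrow> complex" where
  "wirt_bar k f z = (frechet_derivative f (at z) (axis k 1)
                 + \<i> * frechet_derivative f (at z) (axis k \<i>)) / 2"

text \<open>\<open>G $ i $ j\<close> is the component \<open>g(\<partial>\<^sub>i, \<partial>\<^sub>j-bar)\<close>; type (1,0) vectors at a point are identified,
  in a chart, with their component vectors in \<open>complex^'n\<close>.\<close>

definition herm :: "complex^'n^'n \<Rightarrow> complex^'n \<Rightarrow> complex^'n \<Rightarrow> complex" where
  "herm G v w = (\<Sum>i\<in>UNIV. \<Sum>j\<in>UNIV. G $ i $ j * v $ i * cnj (w $ j))"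

text \<open>A metric is a family \<open>g\<close> assigning to every chart \<open>c\<close> of the atlas its matrix-valued
  component function. The last clause is the symmetry of the first derivatives expressing
  that the fundamental form is closed.\<close>

definition kaehler_metric ::
  "('a::topological_space set \<times> ('a \<Rightarrow> complex^'n)) set \<Rightarrow>
   ('a set \<times> ('a \<Rightarrow> complex^'n) \<Rightarrow> complex^'n \<Rightarrow> complex^'n^'n) \<Rightarrow> bool" where
  "kaehler_metric A g \<longleftrightarrow>
     (\<forall>(U,\<phi>)\<in>A. \<forall>(V,\<psi>)\<in>A. \<forall>z\<in>\<phi> ` (U \<inter> V). \<forall>v w.
        herm (g (U,\<phi>) z) v w =
        herm (g (V,\<psi>) (\<psi> (inv_into U \<phi> z)))
          (frechet_derivative (\<psi> \<circ> inv_into U \<phi>) (at z) v)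
          (frechet_derivative (\<psi> \<circ> inv_into U \<phi>) (at z) w)) \<and>
     (\<forall>(U,\<phi>)\<in>A.
        (\<forall>i j k. ck_on k (\<lambda>z. g (U,\<phi>) z $ i $ j) (\<phi> ` U)) \<and>
        (\<forall>z\<in>\<phi> ` U.
          (\<forall>i j. g (U,\<phi>) z $ j $ i = cnj (g (U,\<phi>) z $ i $ j)) \<and>
          (\<forall>v. v \<noteq> 0 \<longrightarrow> 0 < Re (herm (g (U,\<phi>) z) v v)) \<and>
          (\<forall>i j k. wirt k (\<lambda>w. g (U,\<phi>) w $ i $ j) z = wirt i (\<lambda>w. g (U,\<phi>) w $ k $ j) z)))"

text \<open>\<open>metric_inv M k l\<close> is \<open>g\<^sup>k\<^sup>l\<close> (the second index barred), normalized by
  \<open>\<Sum>\<^sub>l M\<^sub>m\<^sub>l g\<^sup>k\<^sup>l = \<delta>\<^sub>k\<^sub>m\<close>; hence the transposition.\<close>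

definition metric_inv :: "complex^'n^'n \<Rightarrow> 'n \<Rightarrow> 'n \<Rightarrow> complex" where
  "metric_inv M k l = matrix_inv M $ l $ k"

text \<open>The Chern connection, which for a Kaehler metric is the Levi-Civita connection:
  \<open>\<nabla>\<^sub>k \<partial>\<^sub>i = \<Sum>\<^sub>p \<Gamma>\<^sup>p\<^sub>k\<^sub>i \<partial>\<^sub>p\<close>.\<close>

definition christoffel ::
  "(complex^'n \<Rightarrow> complex^'n^'n) \<Rightarrow> 'n \<Rightarrow> 'n \<Rightarrow> 'n \<Rightarrow> complex^'n \<Rightarrow> complex" where
  "christoffel G p k i z =
     (\<Sum>q\<in>UNIV. metric_inv (G z) p q * wirt k (\<lambda>w. G w $ i $ q) z)"

text \<open>\<open>curv G i j k l z\<close> is \<open>R(\<partial>\<^sub>i, \<partial>\<^sub>j-bar, \<partial>\<^sub>k, \<partial>\<^sub>l-bar)\<close>, with the sign for which the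
  Fubini-Study metric has positive curvature. Expanding the derivative gives the usual
  \<open>- \<partial>\<^sub>k \<partial>\<^sub>l-bar g\<^sub>i\<^sub>j + \<Sum>\<^sub>p\<^sub>q g\<^sup>p\<^sup>q (\<partial>\<^sub>k g\<^sub>i\<^sub>q) (\<partial>\<^sub>l-bar g\<^sub>p\<^sub>j)\<close>.\<close>

definition curv ::
  "(complex^'n \<Rightarrow> complex^'n^'n) \<Rightarrow> 'n \<Rightarrow> 'n \<Rightarrow> 'n \<Rightarrow> 'n \<Rightarrow> complex^'n \<Rightarrow> complex" where
  "curv G i j k l z = - (\<Sum>p\<in>UNIV. G z $ p $ j * wirt_bar l (christoffel G p k i) z)"

text \<open>\<open>curv_form G z X Y V W\<close> is \<open>R(X, Y-bar, V, W-bar)\<close>.\<close>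

definition curv_form ::
  "(complex^'n \<Rightarrow> complex^'n^'n) \<Rightarrow> complex^'n \<Rightarrow>
   complex^'n \<Rightarrow> complex^'n \<Rightarrow> complex^'n \<Rightarrow> complex^'n \<Rightarrow> complex" where
  "curv_form G z X Y V W =
     (\<Sum>i\<in>UNIV. \<Sum>j\<in>UNIV. \<Sum>k\<in>UNIV. \<Sum>l\<in>UNIV.
        curv G i j k l z * X $ i * cnj (Y $ j) * V $ k * cnj (W $ l))"

definition ricci_form ::
  "(complex^'n \<Rightarrow> complex^'n^'n) \<Rightarrow> complex^'n \<Rightarrow> complex^'n \<Rightarrow> complex^'n \<Rightarrow> complex" where
  "ricci_form G z X Y =
     (\<Sum>k\<in>UNIV. \<Sum>l\<in>UNIV. metric_inv (G z) k l * curv_form G z X Y (axis k 1) (axis l 1))"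

definition ricci_perp ::
  "(complex^'n \<Rightarrow> complex^'n^'n) \<Rightarrow> complex^'n \<Rightarrow> complex^'n \<Rightarrow> complex" where
  "ricci_perp G z X = ricci_form G z X X - curv_form G z X X X X / herm (G z) X X"

definition ricci_perp_positive ::
  "('a::topological_space set \<times> ('a \<Rightarrow> complex^'n)) set \<Rightarrow>
   ('a set \<times> ('a \<Rightarrow> complex^'n) \<Rightarrow> complex^'n \<Rightarrow> complex^'n^'n) \<Rightarrow> bool" where
  "ricci_perp_positive A g \<longleftrightarrow>
     (\<forall>(U,\<phi>)\<in>A. \<forall>z\<in>\<phi> ` U. \<forall>X. X \<noteq> 0 \<longrightarrow> 0 < Re (ricci_perp (g (U,\<phi>)) z X))"

lemma metric_inv_unitary_frame:
  fixes M :: "complex^'n^'n" and e :: "'n \<Rightarrow> complex^'n"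
  assumes "\<And>a b. herm M (e a) (e b) = (if a = b then 1 else 0)"
  shows "metric_inv M k l = (\<Sum>a\<in>UNIV. e a $ k * cnj (e a $ l))"
proof -
  define E :: "complex^'n^'n" where "E = (\<chi> a i. e a $ i)"
  define F :: "complex^'n^'n" where "F = (\<chi> j b. cnj (e b $ j))"
  have "(E ** (M ** F)) $ a $ b = herm M (e a) (e b)" for a b
    by (simp add: matrix_matrix_mult_def E_def F_def herm_def sum_distrib_left mult_ac)
  then have 1: "E ** (M ** F) = mat 1"
    by (simp add: vec_eq_iff mat_def assms)
  then have "(M ** F) ** E = mat 1"
    by (simp add: matrix_left_right_inverse)
  then have 2: "M ** (F ** E) = mat 1"
    by (simp add: matrix_mul_assoc)
  then have 3: "(F ** E) ** M = mat 1"
    by (simp add: matrix_left_right_inverse)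
  have "matrix_inv M = F ** E"
  proof -
    have "M ** matrix_inv M = mat 1 \<and> matrix_inv M ** M = mat 1"
      unfolding matrix_inv_def by (rule someI[of _ "F ** E"]) (use 2 3 in blast)
    then have "(F ** E) ** (M ** matrix_inv M) = F ** E"
      by simp
    then show ?thesis
      by (metis 3 matrix_mul_assoc matrix_mul_lid)
  qed
  then show ?thesis
    by (simp add: metric_inv_def matrix_matrix_mult_def E_def F_def mult_ac)
qed

lemma curv_form_alt:
  "curv_form G z X Y V W =
     (\<Sum>k\<in>UNIV. \<Sum>l\<in>UNIV. V $ k * cnj (W $ l) * curv_form G z X Y (axis k 1) (axis l 1))"
proof -
  define T where "T k l = (\<Sum>i\<in>UNIV. \<Sum>j\<in>UNIV. curv G i j k l z * X $ i * cnj (Y $ j))" for k l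
  have *: "curv_form G z X Y V W = (\<Sum>k\<in>UNIV. \<Sum>l\<in>UNIV. V $ k * cnj (W $ l) * T k l)" for V W
  proof -
    have "curv_form G z X Y V W = (\<Sum>i\<in>UNIV. \<Sum>k\<in>UNIV. \<Sum>j\<in>UNIV. \<Sum>l\<in>UNIV.
        curv G i j k l z * X $ i * cnj (Y $ j) * V $ k * cnj (W $ l))"
      unfolding curv_form_def by (intro sum.cong refl sum.swap)
    also have "\<dots> = (\<Sum>k\<in>UNIV. \<Sum>i\<in>UNIV. \<Sum>j\<in>UNIV. \<Sum>l\<in>UNIV.
        curv G i j k l z * X $ i * cnj (Y $ j) * V $ k * cnj (W $ l))"
      by (rule sum.swap)
    also have "\<dots> = (\<Sum>k\<in>UNIV. \<Sum>i\<in>UNIV. \<Sum>l\<in>UNIV. \<Sum>j\<in>UNIV.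
        curv G i j k l z * X $ i * cnj (Y $ j) * V $ k * cnj (W $ l))"
      by (intro sum.cong refl sum.swap)
    also have "\<dots> = (\<Sum>k\<in>UNIV. \<Sum>l\<in>UNIV. \<Sum>i\<in>UNIV. \<Sum>j\<in>UNIV.
        curv G i j k l z * X $ i * cnj (Y $ j) * V $ k * cnj (W $ l))"
      by (intro sum.cong refl sum.swap)
    finally show ?thesis
      by (simp add: T_def sum_distrib_left mult_ac)
  qed
  have "curv_form G z X Y (axis k 1) (axis l 1) = T k l" for k l
  proof -
    have "axis k 1 $ k' * cnj (axis l 1 $ l') * T k' l' =
        (if k' = k then if l' = l then T k l else 0 else 0)" for k' l'
      by (simp add: axis_def)
    then have "curv_form G z X Y (axis k 1) (axis l 1) =
        (\<Sum>k'\<in>UNIV. \<Sum>l'\<in>UNIV. if k' = k then if l' = l then T k l else 0 else 0)"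
      by (simp add: *)
    also have "\<dots> = (\<Sum>k'\<in>UNIV. if k' = k then T k l else 0)"
      by (intro sum.cong refl) simp
    finally show ?thesis by simp
  qed
  then show ?thesis
    by (simp add: *)
qed

lemma ricci_form_unitary_frame:
  fixes e :: "'n \<Rightarrow> complex^'n"
  assumes "\<And>a b. herm (G z) (e a) (e b) = (if a = b then 1 else 0)"
  shows "ricci_form G z X Y = (\<Sum>a\<in>UNIV. curv_form G z X Y (e a) (e a))"
proof -
  let ?T = "\<lambda>k l. curv_form G z X Y (axis k 1) (axis l 1)"
  have "ricci_form G z X Y =
      (\<Sum>k\<in>UNIV. \<Sum>l\<in>UNIV. \<Sum>a\<in>UNIV. e a $ k * cnj (e a $ l) * ?T k l)"
    by (simp add: ricci_form_def metric_inv_unitary_frame[OF assms] sum_distrib_right)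
  also have "\<dots> = (\<Sum>k\<in>UNIV. \<Sum>a\<in>UNIV. \<Sum>l\<in>UNIV. e a $ k * cnj (e a $ l) * ?T k l)"
    by (intro sum.cong refl sum.swap)
  also have "\<dots> = (\<Sum>a\<in>UNIV. \<Sum>k\<in>UNIV. \<Sum>l\<in>UNIV. e a $ k * cnj (e a $ l) * ?T k l)"
    by (rule sum.swap)
  also have "\<dots> = (\<Sum>a\<in>UNIV. curv_form G z X Y (e a) (e a))"
    by (intro sum.cong refl curv_form_alt[symmetric])
  finally show ?thesis .
qed


section \<open>Affine algebraic sets over the complex numbers\<close>

text \<open>Affine \<open>N\<close>-space is modelled by the sequences vanishing from index \<open>N\<close> on, so that \<open>N\<close> can vary
  with the chart.\<close>

definition affine_space :: "nat \<Rightarrow> (nat \<Rightarrow> complex) set" where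
  "affine_space N = {v. \<forall>i\<ge>N. v i = 0}"

inductive_set poly_funs :: "nat \<Rightarrow> ((nat \<Rightarrow> complex) \<Rightarrow> complex) set" for N :: nat where
  const: "(\<lambda>v. c) \<in> poly_funs N"
| var: "i < N \<Longrightarrow> (\<lambda>v. v i) \<in> poly_funs N"
| add: "P \<in> poly_funs N \<Longrightarrow> Q \<in> poly_funs N \<Longrightarrow> (\<lambda>v. P v + Q v) \<in> poly_funs N"
| mult: "P \<in> poly_funs N \<Longrightarrow> Q \<in> poly_funs N \<Longrightarrow> (\<lambda>v. P v * Q v) \<in> poly_funs N"

definition algebraic_set :: "nat \<Rightarrow> (nat \<Rightarrow> complex) set \<Rightarrow> bool" where
  "algebraic_set N V \<longleftrightarrow>
     (\<exists>S\<subseteq>poly_funs N. V = {v\<in>affine_space N. \<forall>P\<in>S. P v = 0})"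

definition zariski_open_in :: "nat \<Rightarrow> (nat \<Rightarrow> complex) set \<Rightarrow> (nat \<Rightarrow> complex) set \<Rightarrow> bool" where
  "zariski_open_in N V W \<longleftrightarrow> (\<exists>C. algebraic_set N C \<and> W = V - C)"

definition affine_regular_on ::
  "nat \<Rightarrow> (nat \<Rightarrow> complex) set \<Rightarrow> (nat \<Rightarrow> complex) set \<Rightarrow> ((nat \<Rightarrow> complex) \<Rightarrow> complex) \<Rightarrow> bool" where
  "affine_regular_on N V W h \<longleftrightarrow>
     (\<forall>x\<in>W. \<exists>W'. \<exists>P\<in>poly_funs N. \<exists>Q\<in>poly_funs N.
        zariski_open_in N V W' \<and> x \<in> W' \<and> W' \<subseteq> W \<and> (\<forall>y\<in>W'. Q y \<noteq> 0 \<and> h y = P y / Q y))"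

text \<open>For \<open>V\<close> irreducible: the local ring at \<open>x\<close> is integrally closed in the function field.
  The fraction is \<open>P / Q\<close>, an integral equation over the local ring has coefficients \<open>a k / b\<close>
  with \<open>b x \<noteq> 0\<close> and is written with denominators cleared, and membership
  in the local ring means \<open>P / Q = R / S\<close> with \<open>S x \<noteq> 0\<close>.\<close>

definition affine_normal_at :: "nat \<Rightarrow> (nat \<Rightarrow> complex) set \<Rightarrow> (nat \<Rightarrow> complex) \<Rightarrow> bool" where
  "affine_normal_at N V x \<longleftrightarrow>
     (\<forall>P\<in>poly_funs N. \<forall>Q\<in>poly_funs N.
        (\<exists>v\<in>V. Q v \<noteq> 0) \<and>
        (\<exists>m a. \<exists>b\<in>poly_funs N. (\<forall>k<m. a k \<in> poly_funs N) \<and> b x \<noteq> 0 \<and>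
           (\<forall>v\<in>V. b v * P v ^ m + (\<Sum>k<m. a k v * P v ^ k * Q v ^ (m - k)) = 0)) \<longrightarrow>
        (\<exists>R\<in>poly_funs N. \<exists>S\<in>poly_funs N. S x \<noteq> 0 \<and> (\<forall>v\<in>V. P v * S v = R v * Q v)))"


section \<open>Algebraic varieties\<close>

text \<open>A variety is given, in the style of Weil and Serre, by a finite atlas of affine charts \<open>(U, N, \<phi>)\<close>
  where \<open>\<phi>\<close> identifies \<open>U\<close> with an algebraic subset of affine \<open>N\<close>-space.\<close>

definition carrier_of :: "('z set \<times> nat \<times> ('z \<Rightarrow> nat \<Rightarrow> complex)) set \<Rightarrow> 'z set" where
  "carrier_of Z = (\<Union>(U,N,\<phi>)\<in>Z. U)"

definition zariski_open :: "('z set \<times> nat \<times> ('z \<Rightarrow> nat \<Rightarrow> complex)) set \<Rightarrow> 'z set \<Rightarrow> bool" where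
  "zariski_open Z W \<longleftrightarrow>
     W \<subseteq> carrier_of Z \<and> (\<forall>(U,N,\<phi>)\<in>Z. zariski_open_in N (\<phi> ` U) (\<phi> ` (W \<inter> U)))"

definition regular_on ::
  "('z set \<times> nat \<times> ('z \<Rightarrow> nat \<Rightarrow> complex)) set \<Rightarrow> 'z set \<Rightarrow> ('z \<Rightarrow> complex) \<Rightarrow> bool" where
  "regular_on Z W h \<longleftrightarrow>
     (\<forall>(U,N,\<phi>)\<in>Z. affine_regular_on N (\<phi> ` U) (\<phi> ` (W \<inter> U)) (h \<circ> inv_into U \<phi>))"

text \<open>The point of affine \<open>(N + K)\<close>-space corresponding to a pair.\<close>

definition join :: "nat \<Rightarrow> (nat \<Rightarrow> complex) \<Rightarrow> (nat \<Rightarrow> complex) \<Rightarrow> nat \<Rightarrow> complex" where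
  "join N v w i = (if i < N then v i else w (i - N))"

text \<open>The last two clauses of the following definition are separatedness (the diagonal is closed)
  and irreducibility.\<close>

definition variety :: "('z set \<times> nat \<times> ('z \<Rightarrow> nat \<Rightarrow> complex)) set \<Rightarrow> bool" where
  "variety Z \<longleftrightarrow>
     finite Z \<and> carrier_of Z \<noteq> {} \<and>
     (\<forall>(U,N,\<phi>)\<in>Z. inj_on \<phi> U \<and> algebraic_set N (\<phi> ` U)) \<and>
     (\<forall>(U,N,\<phi>)\<in>Z. \<forall>(V,K,\<psi>)\<in>Z.
        zariski_open_in N (\<phi> ` U) (\<phi> ` (U \<inter> V)) \<and>
        (\<forall>i<K. affine_regular_on N (\<phi> ` U) (\<phi> ` (U \<inter> V)) (\<lambda>v. \<psi> (inv_into U \<phi> v) i))) \<and>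
     (\<forall>(U,N,\<phi>)\<in>Z. \<forall>(V,K,\<psi>)\<in>Z.
        algebraic_set (N + K) ((\<lambda>x. join N (\<phi> x) (\<psi> x)) ` (U \<inter> V))) \<and>
     (\<forall>W W'. zariski_open Z W \<and> zariski_open Z W' \<and> W \<noteq> {} \<and> W' \<noteq> {} \<longrightarrow> W \<inter> W' \<noteq> {})"

definition normal_variety :: "('z set \<times> nat \<times> ('z \<Rightarrow> nat \<Rightarrow> complex)) set \<Rightarrow> bool" where
  "normal_variety Z \<longleftrightarrow>
     variety Z \<and> (\<forall>(U,N,\<phi>)\<in>Z. \<forall>x\<in>U. affine_normal_at N (\<phi> ` U) (\<phi> x))"

text \<open>Morphisms from the open subvariety \<open>W\<close> of \<open>X\<close> to \<open>Z\<close>.\<close>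

definition morphism_on ::
  "('x set \<times> nat \<times> ('x \<Rightarrow> nat \<Rightarrow> complex)) set \<Rightarrow> 'x set \<Rightarrow>
   ('z set \<times> nat \<times> ('z \<Rightarrow> nat \<Rightarrow> complex)) set \<Rightarrow> ('x \<Rightarrow> 'z) \<Rightarrow> bool" where
  "morphism_on X W Z f \<longleftrightarrow>
     zariski_open X W \<and> f ` W \<subseteq> carrier_of Z \<and>
     (\<forall>V. zariski_open Z V \<longrightarrow> zariski_open X {x\<in>W. f x \<in> V}) \<and>
     (\<forall>V h. zariski_open Z V \<and> regular_on Z V h \<longrightarrow> regular_on X {x\<in>W. f x \<in> V} (h \<circ> f))"

text \<open>A morphism with a rational inverse, the latter being a morphism on a nonempty open subset.\<close>

definition birational_morphism ::
  "('x set \<times> nat \<times> ('x \<Rightarrow> nat \<Rightarrow> complex)) set \<Rightarrow>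
   ('z set \<times> nat \<times> ('z \<Rightarrow> nat \<Rightarrow> complex)) set \<Rightarrow> ('x \<Rightarrow> 'z) \<Rightarrow> bool" where
  "birational_morphism X Z f \<longleftrightarrow>
     morphism_on X (carrier_of X) Z f \<and>
     (\<exists>W h. zariski_open Z W \<and> W \<noteq> {} \<and> morphism_on Z W X h \<and>
        (\<forall>z\<in>W. f (h z) = z) \<and> (\<forall>x\<in>carrier_of X. f x \<in> W \<longrightarrow> h (f x) = x))"

text \<open>\<open>X\<close> is an algebraic variety on the points of the complex manifold given by \<open>A\<close>, whose
  analytification is that manifold: every affine chart of \<open>X\<close> is defined on an open set
  and is a holomorphic embedding of it (a homeomorphism onto its image and an immersion).
  For a compact projective manifold such a structure exists and is unique up to the choice
  of affine charts (Chow, Serre).\<close>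

definition algebraic_structure_on ::
  "('a::topological_space set \<times> ('a \<Rightarrow> complex^'n)) set \<Rightarrow>
   ('a set \<times> nat \<times> ('a \<Rightarrow> nat \<Rightarrow> complex)) set \<Rightarrow> bool" where
  "algebraic_structure_on A X \<longleftrightarrow>
     variety X \<and> carrier_of X = UNIV \<and>
     (\<forall>(U,N,\<phi>)\<in>X.
        open U \<and> homeomorphism U (\<phi> ` U) \<phi> (inv_into U \<phi>) \<and>
        (\<forall>(V,\<kappa>)\<in>A.
          (\<forall>i<N. holomorphic_fun_on (\<lambda>z. \<phi> (inv_into V \<kappa> z) i) (\<kappa> ` (V \<inter> U))) \<and>
          (\<forall>z\<in>\<kappa> ` (V \<inter> U). \<forall>v. v \<noteq> 0 \<longrightarrow>
             (\<exists>i<N. frechet_derivative (\<lambda>w. \<phi> (inv_into V \<kappa> w) i) (at z) v \<noteq> 0))))"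

end

(* If a function comparing a holomorphic object with the metric is maximal at a point z in the
   direction X, then R(X,X,e,e) <= 0 for every e orthogonal to X: extend X along a holomorphic
   curve tangent to e so that its covariant derivative vanishes at z; then |X|^2 lies above the
   squared modulus of a holomorphic function, with equality at z, while its complex Hessian at z
   is -R(X,X,e,e). Summing over a unitary frame of the orthogonal complement of X gives
   Ric^perp(X) <= 0.

   For a map onto a curve with local coordinate h, one maximizes (r - |h|) |dh(X)|^2 / |X|^2 over
   the preimage of a closed disc of radius r; a direction orthogonal to the maximizing X lies in
   ker dh, and the factor r - |h| is constant along the fibre.

   For a hypersurface D contracted to p, let u be the pullback of a coordinate function vanishing
   at p. If u does not vanish identically near D and k is its least order of vanishing along D, then
   its k-th Taylor polynomial restricts to a form P on the normal bundle of D, and one maximizes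
   |P(X)|^2 / |X|^(2k) over D. Hence all such u vanish near some point of D, so the morphism is
   constant on an open set, which contradicts birationality. *)

theory Submission
  imports Defs "HOL-Complex_Analysis.Conformal_Mappings"
begin

text \<open>Both cases are instances of one situation: a Taylor form of degree k, a function \<eta>
  whose level set through the maximum stays inside the set over which one maximizes, and a weight
  constant on that level set. A maximum gives second-order information only along curves in the
  level set, whereas Ric^perp(X) involves every e orthogonal to X. The two fit because the form sees
  X only modulo ker d\<eta>: at the maximum X is the shortest vector of its class, so ker d\<eta> is
  orthogonal to X, and both are hyperplanes. Such a curve needs a correction
  \<open>\<sigma> t *s X\<close> of second order; since \<sigma> is holomorphic, the correction
  drops out of the Laplacian. Degree k is reduced to degree 1 by a holomorphic k-th root of the form
  along the curve. Taylor forms are taken as one-variable coefficients along complex lines, because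
  Cauchy's integral then yields continuity and holomorphic dependence on point and
  direction.\<close>

abbreviation fderiv :: "('a::real_normed_vector \<Rightarrow> 'b::real_normed_vector) \<Rightarrow> 'a \<Rightarrow> 'a \<Rightarrow> 'b" where
  "fderiv f z \<equiv> frechet_derivative f (at z)"


section \<open>Hermitian forms and unitary frames\<close>


definition pos_hermitian :: "complex^'n^'n \<Rightarrow> bool" where
  "pos_hermitian G \<longleftrightarrow>
     (\<forall>i j. G $ j $ i = cnj (G $ i $ j)) \<and> (\<forall>v. v \<noteq> 0 \<longrightarrow> 0 < Re (herm G v v))"

lemma herm_add_left: "herm G (u + v) w = herm G u w + herm G v w"
  by (simp add: herm_def algebra_simps sum.distrib)

lemma herm_add_right: "herm G w (u + v) = herm G w u + herm G w v"
  by (simp add: herm_def algebra_simps sum.distrib)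

lemma herm_scale_left: "herm G (c *s v) w = c * herm G v w"
  by (simp add: herm_def sum_distrib_left mult_ac)

lemma herm_scale_right: "herm G w (c *s v) = cnj c * herm G w v"
  by (simp add: herm_def sum_distrib_left mult_ac)

lemma herm_zero_left [simp]: "herm G 0 w = 0"
  by (simp add: herm_def)

lemma herm_sum_left: "herm G (\<Sum>a\<in>A. f a) w = (\<Sum>a\<in>A. herm G (f a) w)"
  by (induction A rule: infinite_finite_induct) (auto simp: herm_add_left)

lemma pos_hermitian_entry: "pos_hermitian G \<Longrightarrow> cnj (G $ i $ j) = G $ j $ i"
  unfolding pos_hermitian_def by metis

lemma herm_commute:
  assumes "pos_hermitian G"
  shows "herm G w v = cnj (herm G v w)"
proof -
  have "cnj (herm G v w) = (\<Sum>i\<in>UNIV. \<Sum>j\<in>UNIV. G $ j $ i * cnj (v $ i) * w $ j)"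
    by (simp add: herm_def pos_hermitian_entry[OF assms])
  also have "\<dots> = herm G w v"
    unfolding herm_def by (subst sum.swap) (simp add: mult_ac)
  finally show ?thesis by simp
qed

lemma herm_self_real:
  assumes "pos_hermitian G"
  shows "herm G v v = of_real (Re (herm G v v))"
  using herm_commute[OF assms, of v v] by (simp add: complex_eq_iff)

lemma herm_self_pos:
  "pos_hermitian G \<Longrightarrow> v \<noteq> 0 \<Longrightarrow> 0 < Re (herm G v v)"
  unfolding pos_hermitian_def by blast

lemma inverse_sqrt_squared:
  assumes "0 < r"
  shows "complex_of_real (1 / sqrt r) * complex_of_real (1 / sqrt r) = 1 / complex_of_real r"
proof -
  have "1 / sqrt r * (1 / sqrt r) = 1 / r" using assms by simp
  then show ?thesis by (metis of_real_1 of_real_divide of_real_mult)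
qed

lemma unit_multiple:
  assumes G: "pos_hermitian G" and v: "v \<noteq> 0"
  defines "c \<equiv> complex_of_real (1 / sqrt (Re (herm G v v)))"
  shows "herm G (c *s v) (c *s v) = 1"
proof -
  define r where "r = Re (herm G v v)"
  have r: "0 < r" "herm G v v = of_real r"
    using herm_self_pos[OF G v] herm_self_real[OF G, of v] by (auto simp: r_def)
  have "herm G (c *s v) (c *s v) = c * cnj c * of_real r"
    by (simp add: herm_scale_left herm_scale_right r)
  also have "c * cnj c = 1 / of_real r"
    using inverse_sqrt_squared[OF r(1)] by (simp add: c_def flip: r_def)
  finally show ?thesis using r(1) by simp
qed

text \<open>Gram-Schmidt, by induction on the set of indices already treated, with \<open>a0\<close>
  adjoined throughout so that the prescribed vector is never altered. Fewer than
  \<open>CARD('n)\<close> vectors cannot span, which supplies each new direction.\<close>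

lemma unitary_frame_extend:
  fixes G :: "complex^'n^'n"
  assumes G: "pos_hermitian G" and x: "herm G x x = 1"
  shows "\<exists>e :: 'n \<Rightarrow> complex^'n. e a0 = x \<and>
           (\<forall>a b. herm G (e a) (e b) = (if a = b then 1 else 0))"
proof -
  have "\<exists>e :: 'n \<Rightarrow> complex^'n. e a0 = x \<and>
           (\<forall>a\<in>insert a0 A. \<forall>b\<in>insert a0 A. herm G (e a) (e b) = (if a = b then 1 else 0))"
    if "finite A" for A
    using that
  proof (induction A rule: finite_induct)
    case empty
    show ?case by (rule exI[of _ "\<lambda>_. x"]) (simp add: x)
  next
    case (insert d A)
    then obtain e where e: "e a0 = x"
      "\<forall>a\<in>insert a0 A. \<forall>b\<in>insert a0 A. herm G (e a) (e b) = (if a = b then 1 else 0)"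
      by blast
    show ?case
    proof (cases "d = a0")
      case True
      then show ?thesis using e by (intro exI[of _ e]) (simp add: insert_absorb2)
    next
      case False
      define B where "B = insert a0 A"
      have dB: "d \<notin> B" using False insert.hyps by (auto simp: B_def)
      have "card (e ` B) \<le> card B" by (rule card_image_le) (simp add: B_def)
      also have "card B < CARD('n)"
        using dB by (intro psubset_card_mono) auto
      finally have "vec.span (e ` B) \<noteq> UNIV"
        using vec.dim_le_card[of UNIV "e ` B"] vec_dim_card[where 'n='n and 'a=complex]
        by (auto simp: B_def)
      then obtain v where v: "v \<notin> vec.span (e ` B)" by blast
      define w where "w = v - (\<Sum>a\<in>B. herm G v (e a) *s e a)"
      have wn: "w \<noteq> 0"
      proof
        assume "w = 0"
        then have "v = (\<Sum>a\<in>B. herm G v (e a) *s e a)" by (simp add: w_def)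
        also have "\<dots> \<in> vec.span (e ` B)"
          by (intro vec.span_sum vec.span_scale vec.span_base imageI)
        finally show False using v by simp
      qed
      have we: "herm G w (e b) = 0" if "b \<in> B" for b
      proof -
        have "v = w + (\<Sum>a\<in>B. herm G v (e a) *s e a)" by (simp add: w_def)
        then have "herm G v (e b) = herm G w (e b) + herm G (\<Sum>a\<in>B. herm G v (e a) *s e a) (e b)"
          by (metis herm_add_left)
        also have "herm G (\<Sum>a\<in>B. herm G v (e a) *s e a) (e b) =
            (\<Sum>a\<in>B. if a = b then herm G v (e a) else 0)"
          unfolding herm_sum_left
        proof (intro sum.cong refl)
          fix a assume "a \<in> B"
          then have "herm G (e a) (e b) = (if a = b then 1 else 0)"
            using that e(2) unfolding B_def by blast
          then show "herm G (herm G v (e a) *s e a) (e b) = (if a = b then herm G v (e a) else 0)"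
            by (simp add: herm_scale_left)
        qed
        also have "\<dots> = herm G v (e b)" using that by (simp add: B_def)
        finally show ?thesis by simp
      qed
      define u where "u = complex_of_real (1 / sqrt (Re (herm G w w))) *s w"
      have uu: "herm G u u = 1" unfolding u_def by (rule unit_multiple[OF G wn])
      have ue: "herm G u (e b) = 0" "herm G (e b) u = 0" if "b \<in> B" for b
      proof -
        show *: "herm G u (e b) = 0" using we[OF that] by (simp add: u_def herm_scale_left)
        show "herm G (e b) u = 0" using * herm_commute[OF G, of "e b" u] by simp
      qed
      have "herm G ((e(d := u)) a) ((e(d := u)) b) = (if a = b then 1 else 0)"
        if "a \<in> insert d B" "b \<in> insert d B" for a b
      proof (cases "a = d"; cases "b = d")
        assume "a \<noteq> d" "b \<noteq> d"
        then show ?thesis using that bspec[OF bspec[OF e(2)], of a b] unfolding B_def by simp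
      qed (use that uu ue in auto)
      then show ?thesis
        using e(1) False by (intro exI[of _ "e(d := u)"]) (simp add: B_def insert_commute)
    qed
  qed
  from this[of UNIV] show ?thesis by simp
qed

lemma curv_form_scale_last:
  "curv_form G z X Y (c *s V) (c *s W) = c * cnj c * curv_form G z X Y V W"
  by (simp add: curv_form_def sum_distrib_left mult_ac)

text \<open>Completing \<open>X/|X|\<close> to a unitary frame exhibits \<open>Ric\<^sup>\<perp>(X)\<close> as a sum of bisectional
  curvatures over the other frame vectors.\<close>

lemma ricci_perp_nonpos:
  fixes G :: "complex^'n \<Rightarrow> complex^'n^'n"
  assumes G: "pos_hermitian (G z)" and X: "X \<noteq> 0"
    and R: "\<And>e. herm (G z) e X = 0 \<Longrightarrow> Re (curv_form G z X X e e) \<le> 0"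
  shows "Re (ricci_perp G z X) \<le> 0"
proof -
  define r where "r = Re (herm (G z) X X)"
  have r: "0 < r" "herm (G z) X X = of_real r"
    using herm_self_pos[OF G X] herm_self_real[OF G, of X] by (auto simp: r_def)
  define c where "c = complex_of_real (1 / sqrt r)"
  have cc: "c * cnj c = 1 / of_real r"
    using inverse_sqrt_squared[OF r(1)] by (simp add: c_def)
  obtain a0 :: 'n where True by blast
  obtain e where e: "e a0 = c *s X" "\<And>a b. herm (G z) (e a) (e b) = (if a = b then 1 else 0)"
    using unitary_frame_extend[OF G unit_multiple[OF G X], of a0] unfolding c_def r_def by blast
  have "ricci_form G z X X = (\<Sum>a\<in>UNIV. curv_form G z X X (e a) (e a))"
    by (rule ricci_form_unitary_frame) (rule e(2))
  also have "\<dots> = curv_form G z X X (e a0) (e a0) + (\<Sum>a\<in>UNIV - {a0}. curv_form G z X X (e a) (e a))"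
    by (rule sum.remove) auto
  also have "curv_form G z X X (e a0) (e a0) = curv_form G z X X X X / herm (G z) X X"
    by (simp add: e(1) curv_form_scale_last cc r)
  finally have "Re (ricci_perp G z X) = (\<Sum>a\<in>UNIV - {a0}. Re (curv_form G z X X (e a) (e a)))"
    by (simp add: ricci_perp_def)
  also have "\<dots> \<le> 0"
  proof (rule sum_nonpos, rule R)
    fix a assume "a \<in> UNIV - {a0}"
    then have "herm (G z) (e a) (e a0) = 0" by (simp add: e(2))
    then have "cnj c * herm (G z) (e a) X = 0" by (simp add: e(1) herm_scale_right)
    then show "herm (G z) (e a) X = 0" using r(1) by (auto simp: c_def)
  qed
  finally show ?thesis .
qed


section \<open>Taylor coefficients of holomorphic functions\<close>


definition taylor_coeff :: "nat \<Rightarrow> (complex \<Rightarrow> complex) \<Rightarrow> complex" where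
  "taylor_coeff k \<phi> = (deriv ^^ k) \<phi> 0 / fact k"

text \<open>The homogeneous part of degree k of the Taylor expansion of u at z, evaluated at v: an
  encoding without multi-indices or iterated partial derivatives.\<close>

abbreviation line_coeff :: "nat \<Rightarrow> (complex^'n \<Rightarrow> complex) \<Rightarrow> complex^'n \<Rightarrow> complex^'n \<Rightarrow> complex" where
  "line_coeff k u z v \<equiv> taylor_coeff k (\<lambda>s. u (z + s *s v))"

lemma taylor_coeff_0 [simp]: "taylor_coeff 0 \<phi> = \<phi> 0"
  by (simp add: taylor_coeff_def)

lemma taylor_coeff_1: "taylor_coeff (Suc 0) \<phi> = deriv \<phi> 0"
  by (simp add: taylor_coeff_def)

text \<open>Parametrizing the circle by [0,1] turns Cauchy's formula into an integral over a fixed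
  interval, so that continuity and differentiation in further parameters reduce to standard facts on
  parameter integrals.\<close>

lemma taylor_coeff_eq_integral:
  assumes "continuous_on (cball 0 r) \<phi>" "\<phi> holomorphic_on ball 0 r" "0 < r"
  shows "taylor_coeff k \<phi> =
    integral (cbox 0 1) (\<lambda>\<theta>. \<phi> (of_real r * exp (2 * of_real pi * \<i> * of_real \<theta>)) /
                            (of_real r * exp (2 * of_real pi * \<i> * of_real \<theta>)) ^ k)"
proof -
  let ?\<gamma> = "\<lambda>\<theta>::real. of_real r * exp (2 * of_real pi * \<i> * of_real \<theta>)"
  have "((\<lambda>u. \<phi> u / (u - 0) ^ Suc k) has_contour_integral
           ((2 * pi * \<i>) / (fact k) * (deriv ^^ k) \<phi> 0)) (circlepath 0 r)"
    by (rule Cauchy_has_contour_integral_higher_derivative_circlepath) (use assms in auto)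
  then have "((\<lambda>\<theta>. \<phi> (circlepath 0 r \<theta>) / (circlepath 0 r \<theta>) ^ Suc k *
               vector_derivative (circlepath 0 r) (at \<theta> within {0..1}))
             has_integral (2 * pi * \<i>) * taylor_coeff k \<phi>) {0..1}"
    by (simp add: has_contour_integral_def taylor_coeff_def)
  then have "((\<lambda>\<theta>. (2 * pi * \<i>) * (\<phi> (?\<gamma> \<theta>) / (?\<gamma> \<theta>) ^ k))
             has_integral (2 * pi * \<i>) * taylor_coeff k \<phi>) {0..1}"
  proof (rule has_integral_eq[rotated])
    \<comment> \<open>The velocity of the circle is 2 pi i times the position, so one of the
      \<open>Suc k\<close> powers cancels.\<close>
    fix \<theta> :: real assume "\<theta> \<in> {0..1}"
    then show "\<phi> (circlepath 0 r \<theta>) / (circlepath 0 r \<theta>) ^ Suc k *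
               vector_derivative (circlepath 0 r) (at \<theta> within {0..1})
             = (2 * pi * \<i>) * (\<phi> (?\<gamma> \<theta>) / (?\<gamma> \<theta>) ^ k)"
      using assms(3) by (subst vector_derivative_circlepath01) (simp_all add: circlepath)
  qed
  then have "((\<lambda>\<theta>. \<phi> (?\<gamma> \<theta>) / (?\<gamma> \<theta>) ^ k) has_integral taylor_coeff k \<phi>) {0..1}"
    by (auto dest: has_integral_mult_right[of _ _ _ "1 / (2 * pi * \<i>)"])
  then show ?thesis by (simp add: integral_unique)
qed

lemma continuous_on_slice:
  assumes "continuous_on (T \<times> K) (\<lambda>(x, s). F x s)" "x \<in> T"
  shows "continuous_on K (F x)"
proof -
  have "continuous_on K (\<lambda>s. (\<lambda>(x, s). F x s) (x, s))"
    by (rule continuous_on_compose2[OF assms(1)]) (use assms(2) in \<open>auto intro!: continuous_intros\<close>)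
  then show ?thesis by simp
qed

text \<open>The parameter space is an arbitrary topological space because it will be a set of pairs
  of point and direction, and also a product of a disc with the interval of integration.\<close>

lemma continuous_on_taylor_coeff:
  fixes F :: "'x::topological_space \<Rightarrow> complex \<Rightarrow> complex"
  assumes F: "continuous_on (T \<times> cball 0 r) (\<lambda>(x, s). F x s)"
    and hol: "\<And>x. x \<in> T \<Longrightarrow> F x holomorphic_on ball 0 r" and r: "0 < r"
  shows "continuous_on T (\<lambda>x. taylor_coeff k (F x))"
proof -
  let ?\<gamma> = "\<lambda>\<theta>::real. of_real r * exp (2 * of_real pi * \<i> * of_real \<theta>)"
  have "continuous_on T (\<lambda>x. integral (cbox 0 1) (\<lambda>\<theta>. F x (?\<gamma> \<theta>) / (?\<gamma> \<theta>) ^ k))"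
  proof (rule integral_continuous_on_param)
    have "continuous_on (T \<times> cbox 0 1) (\<lambda>p. (\<lambda>(x, s). F x s) (fst p, ?\<gamma> (snd p)))"
      by (rule continuous_on_compose2[OF F])
         (use r in \<open>auto intro!: continuous_intros simp: norm_mult\<close>)
    then show "continuous_on (T \<times> cbox 0 1) (\<lambda>(x, \<theta>). F x (?\<gamma> \<theta>) / (?\<gamma> \<theta>) ^ k)"
      unfolding split_beta
      by (intro continuous_intros) (use r in \<open>auto simp: split_beta\<close>)
  qed
  moreover have "taylor_coeff k (F x) = integral (cbox 0 1) (\<lambda>\<theta>. F x (?\<gamma> \<theta>) / (?\<gamma> \<theta>) ^ k)"
    if "x \<in> T" for x
    by (rule taylor_coeff_eq_integral[OF continuous_on_slice[OF F that] hol[OF that] r])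
  ultimately show ?thesis by (simp cong: continuous_on_cong)
qed

text \<open>Differentiation under the integral sign in Cauchy's formula. It requires joint
  continuity of the t-derivative of the integrand, which is the only delicate point.\<close>

lemma holomorphic_taylor_coeff:
  fixes F :: "complex \<Rightarrow> complex \<Rightarrow> complex"
  assumes F: "continuous_on (T \<times> cball 0 r) (\<lambda>(t, s). F t s)"
    and T: "open T"
    and hol: "\<And>t. t \<in> T \<Longrightarrow> F t holomorphic_on ball 0 r"
    and hol': "\<And>s. s \<in> cball 0 r \<Longrightarrow> (\<lambda>t. F t s) holomorphic_on T" and r: "0 < r"
  shows "(\<lambda>t. taylor_coeff k (F t)) holomorphic_on T"
proof -
  let ?\<gamma> = "\<lambda>\<theta>::real. of_real r * exp (2 * of_real pi * \<i> * of_real \<theta>)"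
  have \<gamma>: "?\<gamma> \<theta> \<in> cball 0 r" "?\<gamma> \<theta> \<noteq> 0" for \<theta>
    using r by (auto simp: norm_mult)
  have "\<exists>U. open U \<and> t0 \<in> U \<and> (\<lambda>t. taylor_coeff k (F t)) holomorphic_on U" if t0: "t0 \<in> T" for t0
  proof -
    obtain \<rho> where \<rho>: "0 < \<rho>" "cball t0 \<rho> \<subseteq> T"
      using T t0 open_contains_cball by blast
    \<comment> \<open>Half the radius leaves room for shifting: a point of \<open>U\<close> moved by
      at most \<open>d\<close> is still in \<open>T\<close>.\<close>
    define d where "d = \<rho> / 2"
    define U where "U = ball t0 d"
    have d: "0 < d" using \<rho> by (simp add: d_def)
    have UT: "t + s \<in> T" if "t \<in> U" "s \<in> cball 0 d" for t s
    proof -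
      have "dist t0 (t + s) \<le> dist t0 t + norm s"
        using norm_triangle_ineq[of "t0 - t" "- s"] by (simp add: dist_norm algebra_simps)
      then have "t + s \<in> cball t0 \<rho>" using that by (simp add: U_def d_def)
      then show ?thesis using \<rho>(2) by blast
    qed
    have U: "U \<subseteq> T" using UT[of _ 0] d by auto
    have "(\<lambda>t. integral (cbox 0 1) (\<lambda>\<theta>. F t (?\<gamma> \<theta>) / (?\<gamma> \<theta>) ^ k)) holomorphic_on U"
    proof (rule leibniz_rule_holomorphic)
      fix t and \<theta> :: real assume t: "t \<in> U" "\<theta> \<in> cbox 0 1"
      have "((\<lambda>t. F t (?\<gamma> \<theta>)) has_field_derivative deriv (\<lambda>t. F t (?\<gamma> \<theta>)) t) (at t within U)"
        using holomorphic_derivI[OF hol'[OF \<gamma>(1)] T] t(1) U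
        by (meson subset_iff has_field_derivative_at_within)
      then show "((\<lambda>t. F t (?\<gamma> \<theta>) / (?\<gamma> \<theta>) ^ k) has_field_derivative
                   deriv (\<lambda>t. F t (?\<gamma> \<theta>)) t / (?\<gamma> \<theta>) ^ k) (at t within U)"
        by (rule DERIV_cdivide)
    next
      fix t assume t: "t \<in> U"
      have "continuous_on (cbox 0 1) (\<lambda>\<theta>. (\<lambda>(x, s). F x s) (t, ?\<gamma> \<theta>))"
        by (rule continuous_on_compose2[OF F])
           (use r t U in \<open>auto intro!: continuous_intros simp: norm_mult\<close>)
      then show "(\<lambda>\<theta>. F t (?\<gamma> \<theta>) / (?\<gamma> \<theta>) ^ k) integrable_on cbox 0 1"
        by (intro integrable_continuous continuous_intros) (use \<gamma>(2) in auto)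
    next
      \<comment> \<open>The t-derivative of F is itself a first Taylor coefficient, that of the
        shifted function s \<mapsto> F (t + s), so the preceding continuity lemma applies to
        it.\<close>
      define H where "H = (\<lambda>p s. F (fst p + s) (?\<gamma> (snd p)))"
      have "continuous_on (U \<times> cbox 0 1) (\<lambda>p. taylor_coeff (Suc 0) (H p))"
      proof (rule continuous_on_taylor_coeff)
        have "continuous_on ((U \<times> cbox 0 1) \<times> cball 0 d)
               (\<lambda>q. (\<lambda>(x, s). F x s) (fst (fst q) + snd q, ?\<gamma> (snd (fst q))))"
          by (rule continuous_on_compose2[OF F])
             (use r UT in \<open>auto intro!: continuous_intros simp: norm_mult\<close>)
        then show "continuous_on ((U \<times> cbox 0 1) \<times> cball 0 d) (\<lambda>(p, s). H p s)"
          by (simp add: H_def split_beta)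
        fix p assume p: "p \<in> U \<times> cbox (0::real) 1"
        show "H p holomorphic_on ball 0 d"
          unfolding H_def
        proof (rule holomorphic_on_compose_gen[OF _ hol'[OF \<gamma>(1)], unfolded o_def])
          show "(\<lambda>s. fst p + s) holomorphic_on ball 0 d" by (intro holomorphic_intros)
          show "(\<lambda>s. fst p + s) ` ball 0 d \<subseteq> T"
            by (rule image_subsetI, rule UT) (use p in auto)
        qed
      qed (rule d)
      moreover have "taylor_coeff (Suc 0) (H p) = deriv (\<lambda>t. F t (?\<gamma> (snd p))) (fst p)"
        if "p \<in> U \<times> cbox (0::real) 1" for p
      proof -
        have "((\<lambda>t. F t (?\<gamma> (snd p))) has_field_derivative deriv (\<lambda>t. F t (?\<gamma> (snd p))) (fst p)) (at (0 + fst p))"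
          using holomorphic_derivI[OF hol'[OF \<gamma>(1)] T] that U by auto
        then have "((\<lambda>s. F (s + fst p) (?\<gamma> (snd p))) has_field_derivative deriv (\<lambda>t. F t (?\<gamma> (snd p))) (fst p)) (at 0)"
          by (rule DERIV_shift[THEN iffD1])
        then show ?thesis by (simp add: taylor_coeff_1 H_def DERIV_imp_deriv add.commute)
      qed
      ultimately have "continuous_on (U \<times> cbox 0 1) (\<lambda>p. deriv (\<lambda>t. F t (?\<gamma> (snd p))) (fst p))"
        by (simp cong: continuous_on_cong)
      then show "continuous_on (U \<times> cbox 0 1) (\<lambda>(t, \<theta>). deriv (\<lambda>t. F t (?\<gamma> \<theta>)) t / (?\<gamma> \<theta>) ^ k)"
        unfolding split_beta by (intro continuous_intros) (use \<gamma>(2) in auto)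
    next
      show "convex U" by (simp add: U_def)
    qed
    moreover have "taylor_coeff k (F t) = integral (cbox 0 1) (\<lambda>\<theta>. F t (?\<gamma> \<theta>) / (?\<gamma> \<theta>) ^ k)"
      if "t \<in> U" for t
      by (rule taylor_coeff_eq_integral[OF continuous_on_slice[OF F] hol r]) (use that U in auto)
    ultimately have "(\<lambda>t. taylor_coeff k (F t)) holomorphic_on U"
      by (simp cong: holomorphic_cong)
    then show ?thesis using d by (intro exI[of _ U]) (auto simp: U_def)
  qed
  then show ?thesis
    using T by (metis holomorphic_on_def holomorphic_on_imp_differentiable_at at_within_open)
qed

lemma taylor_coeff_sums:
  assumes "\<phi> holomorphic_on ball 0 r" "norm s < r"
  shows "(\<lambda>n. taylor_coeff n \<phi> * s ^ n) sums \<phi> s"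
  using holomorphic_power_series[OF assms(1), of s] assms(2) by (simp add: taylor_coeff_def)

text \<open>Cauchy's estimates dominate the tail by a geometric series of ratio at most 1/2; its sum
  gives the factor 2. The function enters the bound only through \<open>B\<close> and
  \<open>r\<close>, so the bound is uniform in families.\<close>

lemma taylor_remainder_bound:
  assumes c: "continuous_on (cball 0 r) \<phi>" and h: "\<phi> holomorphic_on ball 0 r" and r: "0 < r"
    and B: "\<And>s. norm s \<le> r \<Longrightarrow> norm (\<phi> s) \<le> B"
    and z: "\<And>j. j < k \<Longrightarrow> taylor_coeff j \<phi> = 0" and s: "norm s \<le> r / 2"
  shows "norm (\<phi> s - taylor_coeff k \<phi> * s ^ k) \<le> 2 * B * (norm s / r) ^ Suc k"
proof -
  define q where "q = norm s / r"
  have q: "0 \<le> q" "q \<le> 1/2" using s r by (auto simp: q_def field_simps)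
  have B0: "0 \<le> B" using order_trans[OF norm_ge_zero B[of 0]] r by simp
  have "norm s < r" using s r by simp
  from sums_split_initial_segment[OF taylor_coeff_sums[OF h this], of "Suc k"]
  have S: "(\<lambda>n. taylor_coeff (n + Suc k) \<phi> * s ^ (n + Suc k)) sums (\<phi> s - taylor_coeff k \<phi> * s ^ k)"
    using z by simp
  have "norm (taylor_coeff n \<phi> * s ^ n) \<le> B * q ^ n" for n
  proof -
    have "norm ((deriv ^^ n) \<phi> 0) \<le> fact n * B / r ^ n"
      by (rule Cauchy_inequality[OF h c r]) (use B in auto)
    then have "norm (taylor_coeff n \<phi>) \<le> B / r ^ n"
      by (simp add: taylor_coeff_def norm_divide field_simps)
    then have "norm (taylor_coeff n \<phi>) * norm s ^ n \<le> B / r ^ n * norm s ^ n"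
      by (rule mult_right_mono) simp
    then show ?thesis by (simp add: q_def norm_mult norm_power power_divide)
  qed
  then have T: "norm (taylor_coeff (n + Suc k) \<phi> * s ^ (n + Suc k)) \<le> B * q ^ Suc k * q ^ n" for n
    by (metis add.commute mult.assoc power_add)
  have "(\<lambda>n. B * q ^ Suc k * q ^ n) sums (B * q ^ Suc k * (1 / (1 - q)))"
    using q by (intro sums_mult geometric_sums) auto
  from norm_sums_le[OF S this T]
  have "norm (\<phi> s - taylor_coeff k \<phi> * s ^ k) \<le> B * q ^ Suc k * (1 / (1 - q))" .
  also have "\<dots> \<le> B * q ^ Suc k * 2"
    using q B0 by (intro mult_left_mono) (auto simp: field_simps)
  finally show ?thesis by (simp add: q_def mult_ac)
qed


section \<open>Holomorphic functions of several variables along lines and curves\<close>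

lemma norm_vector_scalar_mult: "norm (c *s v) = norm c * norm (v :: complex^'n)"
proof -
  have "norm (c *s v) = sqrt (\<Sum>i\<in>UNIV. (norm c)\<^sup>2 * (norm (v $ i))\<^sup>2)"
    by (simp add: norm_vec_def L2_set_def norm_mult power_mult_distrib)
  also have "\<dots> = norm c * norm v"
    by (simp add: norm_vec_def L2_set_def real_sqrt_mult flip: sum_distrib_left)
  finally show ?thesis .
qed

lemma bounded_bilinear_vector_scalar_mult:
  "bounded_bilinear (\<lambda>c (v :: complex^'n). c *s v)"
proof
  fix a a' :: complex and b b' :: "complex^'n" and r :: real
  show "(a + a') *s b = a *s b + a' *s b" by (simp add: vec_eq_iff algebra_simps)
  show "a *s (b + b') = a *s b + a *s b'" by (simp add: vec_eq_iff algebra_simps)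
  show "(r *\<^sub>R a) *s b = r *\<^sub>R (a *s b)" by (simp add: vec_eq_iff)
  show "a *s (r *\<^sub>R b) = r *\<^sub>R (a *s b)" by (simp add: vec_eq_iff)
  show "\<exists>K. \<forall>a (b :: complex^'n). norm (a *s b) \<le> norm a * norm b * K"
    by (intro exI[of _ 1]) (simp add: norm_vector_scalar_mult)
qed

lemmas continuous_on_vector_scalar_mult [continuous_intros] =
  bounded_bilinear.continuous_on[OF bounded_bilinear_vector_scalar_mult]

lemmas tendsto_vector_scalar_mult [tendsto_intros] =
  bounded_bilinear.tendsto[OF bounded_bilinear_vector_scalar_mult]

lemma has_derivative_vector_scalar_mult:
  assumes "(f has_field_derivative f') (at t)"
  shows "((\<lambda>t. f t *s (v :: complex^'n)) has_derivative (\<lambda>h. h *s (f' *s v))) (at t)"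
  by (rule has_derivative_eq_rhs[OF bounded_bilinear.FDERIV[OF bounded_bilinear_vector_scalar_mult
      assms[unfolded has_field_derivative_def] has_derivative_const[of v]]])
     (simp add: fun_eq_iff vec_eq_iff mult_ac)

lemma holomorphic_fun_on_subset:
  "holomorphic_fun_on u S \<Longrightarrow> T \<subseteq> S \<Longrightarrow> holomorphic_fun_on u T"
  unfolding holomorphic_fun_on_def by blast

lemma holomorphic_fun_on_derivative:
  assumes "holomorphic_fun_on u S" "z \<in> S"
  shows "(u has_derivative fderiv u z) (at z)"
    and "fderiv u z (c *s v) = c * fderiv u z v"
proof -
  obtain L where L: "(u has_derivative L) (at z)" "\<And>c v. L (c *s v) = c * L v"
    using assms unfolding holomorphic_fun_on_def by blast
  show "(u has_derivative fderiv u z) (at z)"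
    using L(1) by (meson differentiableI frechet_derivative_works)
  show "fderiv u z (c *s v) = c * fderiv u z v"
    using L frechet_derivative_at[OF L(1)] by metis
qed

lemma holomorphic_fun_onI:
  assumes "\<And>z. z \<in> S \<Longrightarrow> (u has_derivative L z) (at z)"
    and "\<And>z c v. z \<in> S \<Longrightarrow> L z (c *s v) = c * L z v"
  shows "holomorphic_fun_on u S"
  using assms unfolding holomorphic_fun_on_def by blast

lemma holomorphic_fun_on_const: "holomorphic_fun_on (\<lambda>z. c) S"
  unfolding holomorphic_fun_on_def by (intro ballI exI[of _ "\<lambda>_. 0"]) auto

lemma holomorphic_fun_on_add:
  assumes "holomorphic_fun_on u S" "holomorphic_fun_on v S"
  shows "holomorphic_fun_on (\<lambda>z. u z + v z) S"
  by (rule holomorphic_fun_onI, rule has_derivative_add[OF holomorphic_fun_on_derivative(1)[OF assms(1)]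
        holomorphic_fun_on_derivative(1)[OF assms(2)]])
     (simp_all add: assms[THEN holomorphic_fun_on_derivative(2)] algebra_simps)

lemma holomorphic_fun_on_mult:
  assumes "holomorphic_fun_on u S" "holomorphic_fun_on v S"
  shows "holomorphic_fun_on (\<lambda>z. u z * v z) S"
  by (rule holomorphic_fun_onI, rule has_derivative_mult[OF holomorphic_fun_on_derivative(1)[OF assms(1)]
        holomorphic_fun_on_derivative(1)[OF assms(2)]])
     (simp_all add: assms[THEN holomorphic_fun_on_derivative(2)] algebra_simps)

lemma holomorphic_fun_on_divide:
  assumes "holomorphic_fun_on u S" "holomorphic_fun_on v S" "\<And>z. z \<in> S \<Longrightarrow> v z \<noteq> 0"
  shows "holomorphic_fun_on (\<lambda>z. u z / v z) S"
  by (rule holomorphic_fun_onI, rule has_derivative_divide'[OF holomorphic_fun_on_derivative(1)[OF assms(1)]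
        holomorphic_fun_on_derivative(1)[OF assms(2)] assms(3)])
     (simp_all add: assms(1,2)[THEN holomorphic_fun_on_derivative(2)] algebra_simps)

lemma holomorphic_fun_on_cong:
  assumes "open S" "holomorphic_fun_on u S" "\<And>z. z \<in> S \<Longrightarrow> u z = v z"
  shows "holomorphic_fun_on v S"
  by (rule holomorphic_fun_onI, rule has_derivative_transform_within_open[OF
        holomorphic_fun_on_derivative(1)[OF assms(2)] assms(1) _ assms(3)])
     (simp_all add: holomorphic_fun_on_derivative(2)[OF assms(2)])

lemma holomorphic_fun_on_add_derivative:
  assumes "holomorphic_fun_on u S" "z \<in> S"
  shows "fderiv u z (v + w) = fderiv u z v + fderiv u z w"
  using has_derivative_linear[OF holomorphic_fun_on_derivative(1)[OF assms]] by (rule linear_add)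

lemma holomorphic_fun_on_continuous:
  "holomorphic_fun_on u S \<Longrightarrow> continuous_on S u"
  by (meson holomorphic_fun_on_derivative(1) has_derivative_continuous
      continuous_at_imp_continuous_on)

lemma holomorphic_fun_on_curve:
  assumes u: "holomorphic_fun_on u S" and c: "(c has_derivative (\<lambda>h. h *s c')) (at t)" and S: "c t \<in> S"
  shows "((\<lambda>t. u (c t)) has_field_derivative fderiv u (c t) c') (at t)"
proof -
  have "((\<lambda>t. u (c t)) has_derivative (\<lambda>h. fderiv u (c t) (h *s c'))) (at t)"
    using has_derivative_compose[OF c holomorphic_fun_on_derivative(1)[OF u S]] by simp
  then show ?thesis
    unfolding has_field_derivative_def
    by (rule has_derivative_eq_rhs) (simp add: fun_eq_iff holomorphic_fun_on_derivative(2)[OF u S] mult.commute)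
qed

lemma has_derivative_line:
  "((\<lambda>s. z + s *s (v :: complex^'n)) has_derivative (\<lambda>h. h *s v)) (at t)"
  using has_derivative_add[OF has_derivative_const[of z]
      has_derivative_vector_scalar_mult[OF DERIV_ident, of v t]] by simp

lemma holomorphic_on_line:
  assumes u: "holomorphic_fun_on u S" and "open T" and "\<And>s. s \<in> T \<Longrightarrow> z + s *s v \<in> S"
  shows "(\<lambda>s. u (z + s *s v)) holomorphic_on T"
  using holomorphic_fun_on_curve[OF u has_derivative_line] assms(2,3)
  by (subst holomorphic_on_open) blast+

text \<open>Provides one radius and one compact set for all lines close to a given one, so that
  Cauchy's formula and the remainder bound can be used with the same circle and the same constant
  for all of them.\<close>

lemma line_neighbourhood:
  fixes z0 v0 :: "complex^'n"
  assumes S: "open S" "z0 \<in> S"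
  obtains N r K where "open N" "(z0, v0) \<in> N" "0 < r" "compact K" "K \<subseteq> S"
    "\<And>p s. p \<in> N \<Longrightarrow> s \<in> cball 0 r \<Longrightarrow> fst p + s *s snd p \<in> K"
proof -
  obtain d where d: "0 < d" "cball z0 d \<subseteq> S" using S open_contains_cball by blast
  let ?m = "\<lambda>q :: ((complex^'n) \<times> (complex^'n)) \<times> complex. fst (fst q) + snd q *s snd (fst q)"
  have "open (?m -` ball z0 d)" by (rule open_vimage) (auto intro!: continuous_intros)
  moreover have "((z0, v0), 0) \<in> ?m -` ball z0 d" using d(1) by simp
  ultimately obtain N R where N: "open N" "open R" "((z0, v0), 0) \<in> N \<times> R" "N \<times> R \<subseteq> ?m -` ball z0 d"
    by (rule open_prod_elim)
  moreover obtain r where "0 < r" "cball 0 r \<subseteq> R" using N(2,3) open_contains_cball by blast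
  ultimately show ?thesis using d(2) by (intro that[of N r "cball z0 d"]) fastforce+
qed

lemma continuous_at_taylor_coeff_line:
  fixes u :: "complex^'n \<Rightarrow> complex"
  assumes u: "holomorphic_fun_on u S" and S: "open S" and z0: "z0 \<in> S"
  shows "continuous (at (z0, v0)) (\<lambda>p. line_coeff k u (fst p) (snd p))"
proof -
  obtain N r K where N: "open N" "(z0, v0) \<in> N" "0 < r" "K \<subseteq> S"
    "\<And>p s. p \<in> N \<Longrightarrow> s \<in> cball 0 r \<Longrightarrow> fst p + s *s snd p \<in> K"
    using line_neighbourhood[OF S z0, of v0] by metis
  have "continuous_on N (\<lambda>p. line_coeff k u (fst p) (snd p))"
  proof (rule continuous_on_taylor_coeff[OF _ _ N(3)])
    have "continuous_on (N \<times> cball 0 r) (\<lambda>q. u (fst (fst q) + snd q *s snd (fst q)))"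
      by (rule continuous_on_compose2[OF holomorphic_fun_on_continuous[OF u]])
         (use N(4,5) in \<open>force intro!: continuous_intros\<close>)+
    then show "continuous_on (N \<times> cball 0 r) (\<lambda>(p, s). u (fst p + s *s snd p))"
      by (simp add: split_beta)
    fix p assume "p \<in> N"
    then show "(\<lambda>s. u (fst p + s *s snd p)) holomorphic_on ball 0 r"
      using N(4,5) by (intro holomorphic_on_line[OF u]) force+
  qed
  then show ?thesis using N(1,2) by (simp add: continuous_on_eq_continuous_at)
qed

text \<open>Since the remainder bound is uniform over nearby lines, the leading coefficient can be
  read off while base point and direction both move. This flexibility is what handles nonlinear
  coordinate changes and motion inside a hypersurface.\<close>

lemma taylor_coeff_line_limit:
  fixes u :: "complex^'n \<Rightarrow> complex"
  assumes u: "holomorphic_fun_on u S" and S: "open S" and z: "z \<in> S"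
    and zn: "zn \<longlonglongrightarrow> z" and wn: "wn \<longlonglongrightarrow> w" and sn: "sn \<longlonglongrightarrow> 0" "\<And>n. sn n \<noteq> 0"
    and v: "\<And>n j. j < k \<Longrightarrow> line_coeff j u (zn n) (wn n) = 0"
  shows "(\<lambda>n. u (zn n + sn n *s wn n) / sn n ^ k) \<longlonglongrightarrow> line_coeff k u z w"
proof -
  obtain N r K where N: "open N" "(z, w) \<in> N" and r: "0 < r" and K: "compact K" "K \<subseteq> S"
    and line: "\<And>p s. p \<in> N \<Longrightarrow> s \<in> cball 0 r \<Longrightarrow> fst p + s *s snd p \<in> K"
    using line_neighbourhood[OF S z, of w] by metis
  have "compact (u ` K)"
    by (intro compact_continuous_image K(1) continuous_on_subset[OF holomorphic_fun_on_continuous[OF u] K(2)])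
  then obtain B where B: "\<And>x. x \<in> K \<Longrightarrow> norm (u x) \<le> B"
    by (meson bounded_iff compact_imp_bounded imageI)
  define a where "a n = line_coeff k u (zn n) (wn n)" for n
  have a: "a \<longlonglongrightarrow> line_coeff k u z w"
    using isCont_tendsto_compose[OF continuous_at_taylor_coeff_line[OF u S z, of w k]
        tendsto_Pair[OF zn wn]] by (simp add: a_def[abs_def])
  have ev: "\<forall>\<^sub>F n in sequentially.
      norm (u (zn n + sn n *s wn n) / sn n ^ k - a n) \<le> 2 * B / r ^ Suc k * norm (sn n)"
    using topological_tendstoD[OF tendsto_Pair[OF zn wn] N] tendstoD[OF sn(1) half_gt_zero[OF r]]
  proof (eventually_elim)
    case (elim n)
    have in_K: "zn n + s *s wn n \<in> K" if "norm s \<le> r" for s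
      using line[OF elim(1), of s] that by simp
    have "norm (u (zn n + sn n *s wn n) - a n * sn n ^ k) \<le> 2 * B * (norm (sn n) / r) ^ Suc k"
      unfolding a_def
    proof (rule taylor_remainder_bound[OF _ _ r _ v])
      show "continuous_on (cball 0 r) (\<lambda>s. u (zn n + s *s wn n))"
        by (rule continuous_on_compose2[OF holomorphic_fun_on_continuous[OF u]])
           (use in_K K(2) in \<open>auto intro!: continuous_intros\<close>)
      show "(\<lambda>s. u (zn n + s *s wn n)) holomorphic_on ball 0 r"
        by (intro holomorphic_on_line[OF u]) (use in_K K(2) in auto)
    qed (use B in_K elim r in auto)
    then have "norm (u (zn n + sn n *s wn n) - a n * sn n ^ k) / norm (sn n ^ k)
        \<le> 2 * B * (norm (sn n) / r) ^ Suc k / norm (sn n ^ k)"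
      by (rule divide_right_mono) simp
    also have "2 * B * (norm (sn n) / r) ^ Suc k / norm (sn n ^ k) = 2 * B / r ^ Suc k * norm (sn n)"
      using sn(2)[of n] by (simp add: norm_power power_divide)
    also have "norm (u (zn n + sn n *s wn n) - a n * sn n ^ k) / norm (sn n ^ k)
        = norm (u (zn n + sn n *s wn n) / sn n ^ k - a n)"
      using sn(2)[of n] by (simp add: diff_divide_distrib flip: norm_divide)
    finally show ?case .
  qed
  have "(\<lambda>n. 2 * B / r ^ Suc k * norm (sn n)) \<longlonglongrightarrow> 2 * B / r ^ Suc k * norm (0::complex)"
    by (intro tendsto_intros sn(1))
  then have "(\<lambda>n. u (zn n + sn n *s wn n) / sn n ^ k - a n) \<longlonglongrightarrow> 0"
    by (intro Lim_null_comparison[OF ev]) simp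
  from tendsto_add[OF this a] show ?thesis by simp
qed

text \<open>The form evaluated on a holomorphically moving vector becomes a holomorphic function of
  t, whose squared modulus is subharmonic.\<close>

lemma holomorphic_taylor_coeff_curve:
  fixes u :: "complex^'n \<Rightarrow> complex"
  assumes u: "holomorphic_fun_on u S" and S: "open S" and R: "0 < R"
    and c: "\<And>t. t \<in> ball 0 R \<Longrightarrow> (c has_derivative (\<lambda>h. h *s c' t)) (at t)"
    and V: "\<And>t. t \<in> ball 0 R \<Longrightarrow> (V has_derivative (\<lambda>h. h *s V' t)) (at t)"
    and c0: "c 0 \<in> S"
  shows "\<exists>\<delta>>0. (\<lambda>t. line_coeff k u (c t) (V t)) holomorphic_on ball 0 \<delta>"
proof -
  obtain N r K where N: "open N" "(c 0, V 0) \<in> N" "0 < r" "K \<subseteq> S"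
    "\<And>p s. p \<in> N \<Longrightarrow> s \<in> cball 0 r \<Longrightarrow> fst p + s *s snd p \<in> K"
    using line_neighbourhood[OF S c0, of "V 0"] by metis
  have cont: "continuous_on (ball 0 R) c" "continuous_on (ball 0 R) V"
    using c V by (meson has_derivative_continuous continuous_at_imp_continuous_on)+
  have "open (ball 0 R \<inter> (\<lambda>t. (c t, V t)) -` N)"
    by (intro continuous_open_preimage continuous_on_Pair cont open_ball N(1))
  moreover have "0 \<in> ball 0 R \<inter> (\<lambda>t. (c t, V t)) -` N" using N(2) R by simp
  ultimately obtain \<delta> where \<delta>: "0 < \<delta>" and sub': "ball 0 \<delta> \<subseteq> ball 0 R \<inter> (\<lambda>t. (c t, V t)) -` N"
    using open_contains_ball by blast
  have in_S: "c t + s *s V t \<in> S" if "t \<in> ball 0 \<delta>" "s \<in> cball 0 r" for t s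
  proof -
    have "(c t, V t) \<in> N" using that(1) sub' by blast
    from N(5)[OF this that(2)] show ?thesis using N(4) by auto
  qed
  have sub: "ball 0 \<delta> \<subseteq> ball (0::complex) R" using sub' by blast
  have "(\<lambda>t. line_coeff k u (c t) (V t)) holomorphic_on ball 0 \<delta>"
  proof (rule holomorphic_taylor_coeff[OF _ _ _ _ N(3)])
    have cont': "continuous_on (ball 0 \<delta> \<times> cball 0 r) (\<lambda>q. c (fst q))"
      "continuous_on (ball 0 \<delta> \<times> cball 0 r) (\<lambda>q. V (fst q))"
      by (rule continuous_on_compose2[OF cont(1)] continuous_on_compose2[OF cont(2)];
          use sub in \<open>force intro!: continuous_intros\<close>)+
    have "continuous_on (ball 0 \<delta> \<times> cball 0 r) (\<lambda>q. u (c (fst q) + snd q *s V (fst q)))"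
      by (rule continuous_on_compose2[OF holomorphic_fun_on_continuous[OF u]])
         (use in_S in \<open>auto intro!: continuous_intros cont'\<close>)
    then show "continuous_on (ball 0 \<delta> \<times> cball 0 r) (\<lambda>(t, s). u (c t + s *s V t))"
      by (simp add: split_beta)
    fix t assume "t \<in> ball (0::complex) \<delta>"
    then show "(\<lambda>s. u (c t + s *s V t)) holomorphic_on ball 0 r"
      by (intro holomorphic_on_line[OF u]) (use in_S in auto)
  next
    fix s :: complex assume s: "s \<in> cball 0 r"
    have "((\<lambda>t. u (c t + s *s V t)) has_field_derivative
             fderiv u (c t + s *s V t) (c' t + s *s V' t)) (at t)"
      if t: "t \<in> ball 0 \<delta>" for t
    proof (rule holomorphic_fun_on_curve[OF u, where c = "\<lambda>t. c t + s *s V t"])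
      show "c t + s *s V t \<in> S" by (rule in_S[OF t s])
      have "((\<lambda>t. c t + s *s V t) has_derivative (\<lambda>h. h *s c' t + s *s (h *s V' t))) (at t)"
        using t sub by (intro has_derivative_add c
            bounded_linear.has_derivative[OF bounded_bilinear.bounded_linear_right[OF bounded_bilinear_vector_scalar_mult]] V) auto
      then show "((\<lambda>t. c t + s *s V t) has_derivative (\<lambda>h. h *s (c' t + s *s V' t))) (at t)"
        by (rule has_derivative_eq_rhs) (simp add: fun_eq_iff vec_eq_iff algebra_simps)
    qed
    then show "(\<lambda>t. u (c t + s *s V t)) holomorphic_on ball 0 \<delta>"
      by (subst holomorphic_on_open) blast+
  qed simp
  then show ?thesis using \<delta> by blast
qed


section \<open>The second variation of the metric\<close>


text \<open>\<open>a\<close> and \<open>b\<close> are the first and second derivatives at 0. The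
  derivative f' has to exist near 0 but be differentiable only at 0 itself, which suffices for the
  second derivative test.\<close>

definition second_order :: "(real \<Rightarrow> complex) \<Rightarrow> complex \<Rightarrow> complex \<Rightarrow> bool" where
  "second_order f a b \<longleftrightarrow>
     (\<exists>f'. (\<forall>\<^sub>F s in nhds 0. (f has_vector_derivative f' s) (at s)) \<and>
           f' 0 = a \<and> (f' has_vector_derivative b) (at 0))"

lemma second_order_const: "second_order (\<lambda>s. c) 0 0"
  unfolding second_order_def by (intro exI[of _ "\<lambda>_. 0"]) auto

lemma second_order_add:
  assumes "second_order f a b" "second_order g a' b'"
  shows "second_order (\<lambda>s. f s + g s) (a + a') (b + b')"
proof -
  obtain f' g' where *: "\<forall>\<^sub>F s in nhds 0. (f has_vector_derivative f' s) (at s)" "f' 0 = a"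
    "(f' has_vector_derivative b) (at 0)" "\<forall>\<^sub>F s in nhds 0. (g has_vector_derivative g' s) (at s)"
    "g' 0 = a'" "(g' has_vector_derivative b') (at 0)"
    using assms unfolding second_order_def by blast
  have "\<forall>\<^sub>F s in nhds 0. ((\<lambda>s. f s + g s) has_vector_derivative f' s + g' s) (at s)"
    using *(1,4) by eventually_elim (rule has_vector_derivative_add)
  then show ?thesis
    unfolding second_order_def using * by (intro exI[of _ "\<lambda>s. f' s + g' s"]) (auto intro: has_vector_derivative_add)
qed

lemma second_order_sum:
  assumes "\<And>i. i \<in> I \<Longrightarrow> second_order (f i) (a i) (b i)"
  shows "second_order (\<lambda>s. \<Sum>i\<in>I. f i s) (\<Sum>i\<in>I. a i) (\<Sum>i\<in>I. b i)"
  using assms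
  by (induction I rule: infinite_finite_induct) (auto intro: second_order_const second_order_add)

lemma second_order_mult:
  assumes "second_order f a b" "second_order g a' b'"
  shows "second_order (\<lambda>s. f s * g s) (a * g 0 + f 0 * a') (b * g 0 + 2 * a * a' + f 0 * b')"
proof -
  obtain f' g' where *: "\<forall>\<^sub>F s in nhds 0. (f has_vector_derivative f' s) (at s)" "f' 0 = a"
    "(f' has_vector_derivative b) (at 0)" "\<forall>\<^sub>F s in nhds 0. (g has_vector_derivative g' s) (at s)"
    "g' 0 = a'" "(g' has_vector_derivative b') (at 0)"
    using assms unfolding second_order_def by blast
  have "\<forall>\<^sub>F s in nhds 0. ((\<lambda>s. f s * g s) has_vector_derivative f s * g' s + f' s * g s) (at s)"
    using *(1,4) by eventually_elim (rule has_vector_derivative_mult)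
  moreover have "((\<lambda>s. f s * g' s + f' s * g s) has_vector_derivative
       (f 0 * b' + a * g' 0) + (f' 0 * a' + b * g 0)) (at 0)"
    using eventually_nhds_x_imp_x[OF *(1)] eventually_nhds_x_imp_x[OF *(4)] *(2,3,5,6)
    by (intro has_vector_derivative_add has_vector_derivative_mult) auto
  moreover have "(f 0 * b' + a * g' 0) + (f' 0 * a' + b * g 0) = b * g 0 + 2 * a * a' + f 0 * b'"
    using * by (simp add: algebra_simps)
  ultimately show ?thesis
    unfolding second_order_def using *
    by (intro exI[of _ "\<lambda>s. f s * g' s + f' s * g s"]) (auto simp: algebra_simps)
qed

lemma second_order_cnj:
  assumes "second_order f a b"
  shows "second_order (\<lambda>s. cnj (f s)) (cnj a) (cnj b)"
proof -
  obtain f' where *: "\<forall>\<^sub>F s in nhds 0. (f has_vector_derivative f' s) (at s)" "f' 0 = a"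
    "(f' has_vector_derivative b) (at 0)"
    using assms unfolding second_order_def by blast
  have "\<forall>\<^sub>F s in nhds 0. ((\<lambda>s. cnj (f s)) has_vector_derivative cnj (f' s)) (at s)"
    using *(1) by eventually_elim (rule has_vector_derivative_cnj)
  then show ?thesis
    unfolding second_order_def using *
    by (intro exI[of _ "\<lambda>s. cnj (f' s)"]) (auto intro: has_vector_derivative_cnj)
qed

lemma second_order_minus:
  assumes "second_order f a b"
  shows "second_order (\<lambda>s. - f s) (- a) (- b)"
  using second_order_mult[OF second_order_const[of "- 1"] assms] by simp

text \<open>\<omega> is the direction of a real ray through 0. The second derivative carries the
  factor \<omega>^2, so holomorphic contributions cancel when the values for 1 and \<i> are
  added.\<close>

lemma second_order_holomorphic:
  assumes q: "q holomorphic_on ball 0 r" and r: "0 < r"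
  shows "second_order (\<lambda>s. q (of_real s * \<omega>)) (\<omega> * deriv q 0) (\<omega>\<^sup>2 * deriv (deriv q) 0)"
proof -
  have lim: "((\<lambda>s::real. of_real s * \<omega>) \<longlongrightarrow> of_real 0 * \<omega>) (nhds 0)"
    by (intro tendsto_intros filterlim_ident)
  have ev: "\<forall>\<^sub>F s in nhds 0. of_real s * \<omega> \<in> ball 0 r"
    using topological_tendstoD[OF lim, of "ball 0 r"] r by simp
  have chain: "((\<lambda>s. p (of_real s * \<omega>)) has_vector_derivative \<omega> * deriv p (of_real s * \<omega>)) (at s)"
    if "p holomorphic_on ball 0 r" "of_real s * \<omega> \<in> ball 0 r" for p and s :: real
  proof -
    have "((\<lambda>s. of_real s * \<omega>) has_vector_derivative \<omega>) (at s)"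
      by (auto intro!: derivative_eq_intros)
    from field_vector_diff_chain_at[OF this holomorphic_derivI[OF that(1) open_ball that(2)]]
    show ?thesis by (simp add: o_def)
  qed
  have "\<forall>\<^sub>F s in nhds 0. ((\<lambda>s. q (of_real s * \<omega>)) has_vector_derivative \<omega> * deriv q (of_real s * \<omega>)) (at s)"
    using ev by eventually_elim (rule chain[OF q])
  moreover have "((\<lambda>s. \<omega> * deriv q (of_real s * \<omega>)) has_vector_derivative \<omega> * (\<omega> * deriv (deriv q) (of_real 0 * \<omega>))) (at 0)"
    using r by (intro has_vector_derivative_mult_right chain holomorphic_deriv q) auto
  ultimately show ?thesis
    unfolding second_order_def
    by (intro exI[of _ "\<lambda>s. \<omega> * deriv q (of_real s * \<omega>)"]) (simp add: power2_eq_square mult.assoc)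
qed

lemma second_order_local_min:
  assumes f: "second_order f a b"
    and m: "\<forall>\<^sub>F s in nhds 0. Re (f 0) \<le> Re (f s)"
  shows "0 \<le> Re b"
proof (rule ccontr)
  assume "\<not> 0 \<le> Re b"
  obtain f' where f': "\<forall>\<^sub>F s in nhds 0. (f has_vector_derivative f' s) (at s)" "f' 0 = a"
    "(f' has_vector_derivative b) (at 0)"
    using f unfolding second_order_def by blast
  have "\<forall>\<^sub>F s in nhds 0. ((\<lambda>s. Re (f s)) has_real_derivative Re (f' s)) (at s) \<and> Re (f 0) \<le> Re (f s)"
    using f'(1) m
    by eventually_elim
       (auto simp: has_real_derivative_iff_has_vector_derivative
             intro: bounded_linear.has_vector_derivative[OF bounded_linear_Re])
  then obtain d where d: "0 < d" "\<And>s. \<bar>s\<bar> < d \<Longrightarrow> ((\<lambda>s. Re (f s)) has_real_derivative Re (f' s)) (at s)"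
    "\<And>s. \<bar>s\<bar> < d \<Longrightarrow> Re (f 0) \<le> Re (f s)"
    unfolding eventually_nhds_metric by (auto simp: dist_real_def)
  have f0: "Re (f' 0) = 0"
    using DERIV_local_min[OF d(2)[of 0], of d] d(1,3) by auto
  have "((\<lambda>s. Re (f' s)) has_real_derivative Re b) (at 0)"
    using bounded_linear.has_vector_derivative[OF bounded_linear_Re f'(3)] by (simp add: has_real_derivative_iff_has_vector_derivative)
  from DERIV_neg_dec_right[OF this] \<open>\<not> 0 \<le> Re b\<close>
  obtain e where e: "0 < e" "\<And>h. 0 < h \<Longrightarrow> h < e \<Longrightarrow> Re (f' h) < 0"
    using f0 by auto
  define h where "h = min d e / 2"
  have h: "0 < h" "h < d" "h < e" using d(1) e(1) by (auto simp: h_def)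
  obtain x where x: "0 < x" "x < h" "Re (f h) - Re (f 0) = (h - 0) * Re (f' x)"
    using MVT2[of 0 h "\<lambda>s. Re (f s)" "\<lambda>s. Re (f' s)"] d(2) h by auto
  have "(h - 0) * Re (f' x) < 0" using x h e(2)[of x] by (simp add: mult_pos_neg)
  then show False using x(3) d(3)[of h] h by simp
qed

lemma vector_scalar_mult_Re_Im:
  "a *s (v :: complex^'n) = Re a *\<^sub>R v + Im a *\<^sub>R (\<i> *s v)"
  by (simp add: vec_eq_iff complex_eq_iff)

text \<open>A second-order chain rule for a function that is only real differentiable, as the metric
  components are. The bending \<open>\<sigma>\<close> of the curve contributes solely through the
  first derivative of \<open>F\<close>.\<close>

lemma second_order_along_curve:
  fixes F :: "complex^'n \<Rightarrow> complex" and \<sigma> :: "complex \<Rightarrow> complex"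
  assumes \<Omega>: "open \<Omega>" "z0 \<in> \<Omega>"
    and F: "\<And>z. z \<in> \<Omega> \<Longrightarrow> F differentiable at z"
    and F2: "\<And>v. (\<lambda>z. fderiv F z v) differentiable at z0"
    and \<sigma>: "\<sigma> holomorphic_on ball 0 r" "0 < r" "\<sigma> 0 = 0" "deriv \<sigma> 0 = 0"
  shows "second_order (\<lambda>s. F (z0 + (of_real s * \<omega>) *s e + \<sigma> (of_real s * \<omega>) *s x))
     (fderiv F z0 (\<omega> *s e))
     (fderiv (\<lambda>z. fderiv F z (\<omega> *s e)) z0 (\<omega> *s e) +
      fderiv F z0 ((\<omega>\<^sup>2 * deriv (deriv \<sigma>) 0) *s x))"
proof -
  define \<gamma> where "\<gamma> s = z0 + (of_real s * \<omega>) *s e + \<sigma> (of_real s * \<omega>) *s x" for s :: real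
  obtain \<tau> where \<tau>: "\<forall>\<^sub>F s in nhds 0. ((\<lambda>s. \<sigma> (of_real s * \<omega>)) has_vector_derivative \<tau> s) (at s)"
    "\<tau> 0 = 0" "(\<tau> has_vector_derivative \<omega>\<^sup>2 * deriv (deriv \<sigma>) 0) (at 0)"
    using second_order_holomorphic[OF \<sigma>(1,2), of \<omega>] \<sigma>(4) unfolding second_order_def by auto
  have \<gamma>': "(\<gamma> has_vector_derivative (\<omega> *s e + \<tau> s *s x)) (at s)"
    if "((\<lambda>s. \<sigma> (of_real s * \<omega>)) has_vector_derivative \<tau> s) (at s)" for s
  proof -
    have 1: "((\<lambda>s. of_real s * \<omega>) has_vector_derivative \<omega>) (at s)"
      by (auto intro!: derivative_eq_intros)
    have "((\<lambda>s. f s *s v) has_vector_derivative f' *s v) (at s)"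
      if "(f has_vector_derivative f') (at s)" for f f' and v :: "complex^'n"
      using bounded_linear.has_vector_derivative[OF
          bounded_bilinear.bounded_linear_left[OF bounded_bilinear_vector_scalar_mult] that] .
    from has_vector_derivative_add[OF has_vector_derivative_add[OF has_vector_derivative_const[of z0] this[OF 1, of e]] this[OF that, of x]]
    show ?thesis unfolding \<gamma>_def by simp
  qed
  have \<gamma>0: "\<gamma> 0 = z0" using \<sigma>(3) by (simp add: \<gamma>_def)
  have "isCont \<gamma> 0"
    using \<gamma>'[OF eventually_nhds_x_imp_x[OF \<tau>(1)]] by (rule has_vector_derivative_continuous)
  then have "(\<gamma> \<longlongrightarrow> z0) (nhds 0)" using \<gamma>0 by (simp add: continuous_at tendsto_nhds_iff)
  then have ev: "\<forall>\<^sub>F s in nhds 0. \<gamma> s \<in> \<Omega>" using \<Omega> by (rule topological_tendstoD)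
  let ?D = "\<lambda>v z. fderiv F z v"
  have lin: "linear (fderiv F z)" if "z \<in> \<Omega>" for z
    using F[OF that] by (rule linear_frechet_derivative)
  have split: "?D (v + a *s x) z = ?D v z + of_real (Re a) * ?D x z + of_real (Im a) * ?D (\<i> *s x) z"
    if "z \<in> \<Omega>" for v a z
    by (subst vector_scalar_mult_Re_Im)
       (simp add: linear_add[OF lin[OF that]] linear_scale[OF lin[OF that]] flip: scaleR_conv_of_real)
  \<comment> \<open>The velocity of the curve changes with s. Splitting it over the fixed real
    directions \<open>\<omega> *s e\<close>, \<open>x\<close> and \<open>\<i> *s x\<close> reduces
    the second differentiation to directional derivatives with constant direction, which are
    differentiable at \<open>z0\<close>.\<close>
  define f' where "f' s = ?D (\<omega> *s e) (\<gamma> s) + of_real (Re (\<tau> s)) * ?D x (\<gamma> s) + of_real (Im (\<tau> s)) * ?D (\<i> *s x) (\<gamma> s)" for s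
  have "\<forall>\<^sub>F s in nhds 0. ((\<lambda>s. F (\<gamma> s)) has_vector_derivative f' s) (at s)"
    using ev \<tau>(1)
  proof eventually_elim
    case (elim s)
    have "(F has_derivative fderiv F (\<gamma> s)) (at (\<gamma> s))"
      using F[OF elim(1)] by (simp add: frechet_derivative_works)
    then have "(F has_derivative fderiv F (\<gamma> s)) (at (\<gamma> s) within \<gamma> ` UNIV)"
      by (rule has_derivative_at_withinI)
    from vector_derivative_diff_chain_within[OF \<gamma>'[OF elim(2)] this]
    show ?case by (simp add: o_def f'_def split[OF elim(1)])
  qed
  moreover have "f' 0 = ?D (\<omega> *s e) z0" by (simp add: f'_def \<gamma>0 \<tau>(2))
  moreover have "(f' has_vector_derivative
      (fderiv (?D (\<omega> *s e)) z0 (\<omega> *s e) + ?D ((\<omega>\<^sup>2 * deriv (deriv \<sigma>) 0) *s x) z0)) (at 0)"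
  proof -
    let ?b = "\<omega>\<^sup>2 * deriv (deriv \<sigma>) 0"
    have \<gamma>0': "(\<gamma> has_vector_derivative \<omega> *s e) (at 0)"
      using \<gamma>'[OF eventually_nhds_x_imp_x[OF \<tau>(1)]] \<tau>(2) by simp
    have D: "((\<lambda>s. ?D v (\<gamma> s)) has_vector_derivative fderiv (?D v) z0 (\<omega> *s e)) (at 0)" for v
    proof -
      have "(?D v has_derivative fderiv (?D v) z0) (at (\<gamma> 0) within \<gamma> ` UNIV)"
        using F2[of v] by (simp add: frechet_derivative_works \<gamma>0 has_derivative_at_withinI)
      from vector_derivative_diff_chain_within[OF \<gamma>0' this]
      show ?thesis by (simp add: o_def)
    qed
    have R: "((\<lambda>s. of_real (Re (\<tau> s))) has_vector_derivative (of_real (Re ?b) :: complex)) (at 0)"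
            "((\<lambda>s. of_real (Im (\<tau> s))) has_vector_derivative (of_real (Im ?b) :: complex)) (at 0)"
      by (intro has_vector_derivative_of_real bounded_linear.has_vector_derivative[OF bounded_linear_Re] bounded_linear.has_vector_derivative[OF bounded_linear_Im] \<tau>(3) |
          (subst has_real_derivative_iff_has_vector_derivative))+
    have "(f' has_vector_derivative
        (fderiv (?D (\<omega> *s e)) z0 (\<omega> *s e) +
         (of_real (Re (\<tau> 0)) * fderiv (?D x) z0 (\<omega> *s e) + of_real (Re ?b) * ?D x (\<gamma> 0)) +
         (of_real (Im (\<tau> 0)) * fderiv (?D (\<i> *s x)) z0 (\<omega> *s e) + of_real (Im ?b) * ?D (\<i> *s x) (\<gamma> 0)))) (at 0)"
      unfolding f'_def[abs_def] by (intro has_vector_derivative_add has_vector_derivative_mult D R)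
    then show ?thesis
      using split[OF \<Omega>(2), of 0 ?b] by (simp add: \<tau>(2) \<gamma>0 linear_0[OF lin[OF \<Omega>(2)]] add.assoc)
  qed
  ultimately show ?thesis unfolding second_order_def \<gamma>_def by blast
qed


section \<open>Directional Wirtinger derivatives, the Chern connection and its curvature\<close>

definition hermitian_metric_on :: "(complex^'n) set \<Rightarrow> (complex^'n \<Rightarrow> complex^'n^'n) \<Rightarrow> bool" where
  "hermitian_metric_on \<Omega> G \<longleftrightarrow> open \<Omega> \<and>
     (\<forall>z\<in>\<Omega>. pos_hermitian (G z) \<and>
       (\<forall>i j. (\<lambda>w. G w $ i $ j) differentiable at z \<and>
         (\<forall>v. (\<lambda>w. fderiv (\<lambda>w. G w $ i $ j) w v) differentiable at z)))"

text \<open>The derivative along the (1,0) vector e, that is the sum of e_k d/dz_k. It is expressed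
  by real derivatives along e and \<open>\<i> *s e\<close> so that it can be compared with second
  derivatives along real rays.\<close>

definition wirt_dir :: "complex^'n \<Rightarrow> (complex^'n \<Rightarrow> complex) \<Rightarrow> complex^'n \<Rightarrow> complex" where
  "wirt_dir e F z =
     (fderiv F z e - \<i> * fderiv F z (\<i> *s e)) / 2"

definition wirt_bar_dir :: "complex^'n \<Rightarrow> (complex^'n \<Rightarrow> complex) \<Rightarrow> complex^'n \<Rightarrow> complex" where
  "wirt_bar_dir e F z =
     (fderiv F z e + \<i> * fderiv F z (\<i> *s e)) / 2"

lemma frechet_derivative_expand:
  fixes F :: "complex^'n \<Rightarrow> complex"
  assumes "F differentiable at z"
  shows "fderiv F z v =
    (\<Sum>k\<in>UNIV. of_real (Re (v $ k)) * fderiv F z (axis k 1) +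
                of_real (Im (v $ k)) * fderiv F z (axis k \<i>))"
proof -
  have lin: "linear (fderiv F z)" using assms by (rule linear_frechet_derivative)
  have "v = (\<Sum>k\<in>UNIV. Re (v $ k) *\<^sub>R axis k 1 + Im (v $ k) *\<^sub>R axis k \<i>)"
  proof (subst vec_eq_iff, intro allI)
    fix i
    have "(\<Sum>k\<in>UNIV. Re (v $ k) *\<^sub>R axis k 1 + Im (v $ k) *\<^sub>R axis k \<i>) $ i =
        (\<Sum>k\<in>UNIV. if k = i then Re (v $ i) *\<^sub>R 1 + Im (v $ i) *\<^sub>R \<i> else 0)"
      unfolding sum_component by (intro sum.cong) (auto simp: axis_def)
    then show "v $ i = (\<Sum>k\<in>UNIV. Re (v $ k) *\<^sub>R axis k 1 + Im (v $ k) *\<^sub>R axis k \<i>) $ i"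
      by (simp add: complex_eq_iff)
  qed
  then have "fderiv F z v =
     fderiv F z (\<Sum>k\<in>UNIV. Re (v $ k) *\<^sub>R axis k 1 + Im (v $ k) *\<^sub>R axis k \<i>)"
    by simp
  then show ?thesis
    by (simp add: linear_sum[OF lin] linear_add[OF lin] linear_scale[OF lin] flip: scaleR_conv_of_real)
qed

text \<open>One computation serves both Wirtinger derivatives: c = - \<i> gives the holomorphic and
  c = \<i> the antiholomorphic one.\<close>

lemma fderiv_rotated_sum:
  fixes F :: "complex^'n \<Rightarrow> complex"
  assumes F: "F differentiable at z" and c: "c * c = - 1"
  shows "fderiv F z e + c * fderiv F z (\<i> *s e) =
    (\<Sum>k\<in>UNIV. (of_real (Re (e $ k)) - c * of_real (Im (e $ k))) *
      (fderiv F z (axis k 1) + c * fderiv F z (axis k \<i>)))"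
proof -
  have cc: "c * (c * w) = - w" for w using c by (simp flip: mult.assoc)
  show ?thesis
    by (simp add: frechet_derivative_expand[OF F, of e] frechet_derivative_expand[OF F, of "\<i> *s e"]
        sum_distrib_left algebra_simps cc flip: sum.distrib)
qed

lemma wirt_dir_eq_sum:
  assumes "F differentiable at z"
  shows "wirt_dir e F z = (\<Sum>k\<in>UNIV. e $ k * wirt k F z)"
  using fderiv_rotated_sum[OF assms, of "- \<i>" e]
  by (simp add: wirt_dir_def wirt_def sum_divide_distrib flip: complex_eq)

lemma wirt_bar_dir_eq_sum:
  assumes "F differentiable at z"
  shows "wirt_bar_dir e F z = (\<Sum>k\<in>UNIV. cnj (e $ k) * wirt_bar k F z)"
proof -
  have "of_real (Re w) - \<i> * of_real (Im w) = cnj w" for w by (simp add: complex_eq_iff)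
  then show ?thesis
    using fderiv_rotated_sum[OF assms, of \<i> e]
    by (simp add: wirt_bar_dir_def wirt_bar_def sum_divide_distrib)
qed

lemma wirt_bar_dir_mult:
  assumes "F differentiable at z" "H differentiable at z"
  shows "wirt_bar_dir e (\<lambda>w. F w * H w) z = wirt_bar_dir e F z * H z + F z * wirt_bar_dir e H z"
proof -
  have "((\<lambda>w. F w * H w) has_derivative
      (\<lambda>h. F z * fderiv H z h + fderiv F z h * H z)) (at z)"
    using assms by (intro has_derivative_mult) (simp_all add: frechet_derivative_works)
  note * = frechet_derivative_at[OF this, symmetric]
  show ?thesis by (simp add: wirt_bar_dir_def * field_simps)
qed

lemma wirt_bar_dir_sum:
  assumes "finite I" "\<And>i. i \<in> I \<Longrightarrow> F i differentiable at z"
  shows "wirt_bar_dir e (\<lambda>w. \<Sum>i\<in>I. F i w) z = (\<Sum>i\<in>I. wirt_bar_dir e (F i) z)"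
proof -
  have "((\<lambda>w. \<Sum>i\<in>I. F i w) has_derivative (\<lambda>h. \<Sum>i\<in>I. fderiv (F i) z h)) (at z)"
    using assms by (intro has_derivative_sum) (simp_all add: frechet_derivative_works)
  note * = frechet_derivative_at[OF this, symmetric]
  show ?thesis
    by (simp add: wirt_bar_dir_def * sum_distrib_left sum.distrib flip: sum_divide_distrib)
qed

lemma wirt_bar_dir_cmult:
  assumes "F differentiable at z"
  shows "wirt_bar_dir e (\<lambda>w. F w * c) z = wirt_bar_dir e F z * c"
proof -
  have "wirt_bar_dir e (\<lambda>w. c) z = 0" by (simp add: wirt_bar_dir_def)
  then show ?thesis using wirt_bar_dir_mult[OF assms, of "\<lambda>w. c" e] by simp
qed

lemma frechet_derivative_cong_open:
  assumes "open \<Omega>" "z \<in> \<Omega>" "\<And>w. w \<in> \<Omega> \<Longrightarrow> F w = H w"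
  shows "fderiv F z = fderiv H z"
proof -
  have "(F has_derivative L) (at z) \<longleftrightarrow> (H has_derivative L) (at z)" for L
    using has_derivative_transform_within_open[OF _ assms(1,2), of F L UNIV H]
          has_derivative_transform_within_open[OF _ assms(1,2), of H L UNIV F] assms(3) by auto
  then show ?thesis by (simp add: frechet_derivative_def)
qed

lemma wirt_bar_dir_cong:
  assumes "open \<Omega>" "z \<in> \<Omega>" "\<And>w. w \<in> \<Omega> \<Longrightarrow> F w = H w"
  shows "wirt_bar_dir e F z = wirt_bar_dir e H z"
  by (simp add: wirt_bar_dir_def frechet_derivative_cong_open[OF assms])

lemma differentiable_prod:
  fixes f :: "'i \<Rightarrow> 'a::real_normed_vector \<Rightarrow> complex"
  assumes "finite I" "\<And>i. i \<in> I \<Longrightarrow> f i differentiable at z"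
  shows "(\<lambda>w. \<Prod>i\<in>I. f i w) differentiable at z"
  using assms by (induction I rule: finite_induct) auto

lemma differentiable_det:
  fixes M :: "'a::real_normed_vector \<Rightarrow> complex^'n^'n"
  assumes "\<And>i j. (\<lambda>w. M w $ i $ j) differentiable at z"
  shows "(\<lambda>w. det (M w)) differentiable at z"
  unfolding det_def
  by (intro differentiable_sum differentiable_mult ballI differentiable_const
        differentiable_prod[of UNIV "\<lambda>i w. M w $ i $ _ i"] assms) simp_all

lemma pos_hermitian_det:
  assumes "pos_hermitian G"
  shows "det G \<noteq> 0"
proof -
  have "x = 0" if "G *v x = 0" for x
  proof (rule ccontr)
    assume "x \<noteq> 0"
    \<comment> \<open>\<open>herm\<close> conjugates its second argument, so a vector in the kernel
      of G has to be conjugated before it can be inserted.\<close>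
    define y where "y = (\<chi> i. cnj (x $ i))"
    have "y \<noteq> 0" using \<open>x \<noteq> 0\<close> by (simp add: y_def vec_eq_iff)
    have "herm G y y = (\<Sum>i\<in>UNIV. cnj (x $ i) * (G *v x) $ i)"
      by (simp add: herm_def y_def matrix_vector_mult_def sum_distrib_left mult_ac)
    then show False using that herm_self_pos[OF assms \<open>y \<noteq> 0\<close>] by simp
  qed
  then have "invertible G"
    by (metis matrix_left_invertible_ker invertible_left_inverse)
  then show ?thesis by (simp add: invertible_det_nz)
qed

lemma matrix_inv_mult:
  assumes "det (G :: complex^'n^'n) \<noteq> 0"
  shows "matrix_inv G ** G = mat 1" "G ** matrix_inv G = mat 1"
proof -
  have "\<exists>B. G ** B = mat 1 \<and> B ** G = mat 1"
    using assms by (simp add: invertible_det_nz[symmetric] invertible_def)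
  then have "G ** matrix_inv G = mat 1 \<and> matrix_inv G ** G = mat 1"
    unfolding matrix_inv_def by (rule someI_ex)
  then show "matrix_inv G ** G = mat 1" "G ** matrix_inv G = mat 1" by auto
qed

lemma metric_inv_left:
  assumes "det (G :: complex^'n^'n) \<noteq> 0"
  shows "(\<Sum>p\<in>UNIV. G $ p $ j * metric_inv G p q) = (if q = j then 1 else 0)"
proof -
  have "(\<Sum>p\<in>UNIV. G $ p $ j * metric_inv G p q) = (matrix_inv G ** G) $ q $ j"
    by (simp add: matrix_matrix_mult_def metric_inv_def mult.commute)
  then show ?thesis by (simp add: matrix_inv_mult[OF assms] mat_def)
qed

text \<open>Writing the inverse as a quotient of determinants makes its differentiability, and hence
  that of the Christoffel symbols, a matter of polynomials in the components.\<close>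

lemma metric_inv_cramer:
  assumes "det (G :: complex^'n^'n) \<noteq> 0"
  shows "metric_inv G p q = det (\<chi> i j. if j = q then axis p 1 $ i else G $ i $ j) / det G"
proof -
  have "G *v (matrix_inv G *v axis p 1) = axis p 1"
    by (simp add: matrix_vector_mul_assoc matrix_inv_mult[OF assms])
  then have "matrix_inv G *v axis p 1 = (\<chi> k. det (\<chi> i j. if j = k then axis p 1 $ i else G $ i $ j) / det G)"
    using cramer[OF assms] by blast
  then have "(matrix_inv G *v axis p 1) $ q = det (\<chi> i j. if j = q then axis p 1 $ i else G $ i $ j) / det G"
    by simp
  then show ?thesis by (simp add: matrix_vector_mult_def axis_def metric_inv_def if_distrib[of "(*) _"] cong: if_cong)
qed

lemma hermitian_metric_onD:
  assumes "hermitian_metric_on \<Omega> G"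
  shows "open \<Omega>" "z \<in> \<Omega> \<Longrightarrow> pos_hermitian (G z)"
    and "z \<in> \<Omega> \<Longrightarrow> (\<lambda>w. G w $ i $ j) differentiable at z"
    and "z \<in> \<Omega> \<Longrightarrow> (\<lambda>w. fderiv (\<lambda>w. G w $ i $ j) w v) differentiable at z"
  using assms unfolding hermitian_metric_on_def by blast+

lemma differentiable_wirt:
  assumes "hermitian_metric_on \<Omega> G" "z \<in> \<Omega>"
  shows "wirt k (\<lambda>w. G w $ i $ j) differentiable at z"
  unfolding wirt_def[abs_def] divide_inverse
  by (intro differentiable_mult differentiable_diff differentiable_const hermitian_metric_onD(4)[OF assms])

lemma differentiable_metric_inv:
  assumes G: "hermitian_metric_on \<Omega> G" and z: "z \<in> \<Omega>"
  shows "(\<lambda>w. metric_inv (G w) p q) differentiable at z"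
proof -
  have nz: "det (G w) \<noteq> 0" if "w \<in> \<Omega>" for w
    using hermitian_metric_onD(2)[OF G that] by (rule pos_hermitian_det)
  have "(\<lambda>w. det (\<chi> i j. if j = q then axis p 1 $ i else G w $ i $ j) / det (G w)) differentiable at z"
  proof (rule differentiable_divide)
    show "(\<lambda>w. det (\<chi> i j. if j = q then axis p 1 $ i else G w $ i $ j)) differentiable at z"
    proof (rule differentiable_det)
      show "(\<lambda>w. (\<chi> i j. if j = q then axis p 1 $ i else G w $ i $ j) $ i $ j) differentiable at z" for i j
        using hermitian_metric_onD(3)[OF G z] by (cases "j = q") auto
    qed
    show "(\<lambda>w. det (G w)) differentiable at z"
      by (rule differentiable_det) (rule hermitian_metric_onD(3)[OF G z])
  qed (rule nz[OF z])
  then obtain L where L: "((\<lambda>w. det (\<chi> i j. if j = q then axis p 1 $ i else G w $ i $ j) / det (G w)) has_derivative L) (at z)"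
    unfolding differentiable_def by blast
  have "((\<lambda>w. metric_inv (G w) p q) has_derivative L) (at z)"
    by (rule has_derivative_transform_within_open[OF L hermitian_metric_onD(1)[OF G] z])
       (simp add: metric_inv_cramer nz)
  then show ?thesis by (rule differentiableI)
qed

lemma differentiable_christoffel:
  assumes "hermitian_metric_on \<Omega> G" "z \<in> \<Omega>"
  shows "christoffel G p k i differentiable at z"
  unfolding christoffel_def[abs_def]
  by (intro differentiable_sum differentiable_mult ballI differentiable_metric_inv[OF assms] differentiable_wirt[OF assms]) simp

text \<open>The covariant derivative \<open>\<nabla>\<^sub>e X\<close> of the vector field with constant components \<open>X\<close>.\<close>

definition covariant_term ::
  "(complex^'n \<Rightarrow> complex^'n^'n) \<Rightarrow> complex^'n \<Rightarrow> complex^'n \<Rightarrow> complex^'n \<Rightarrow> complex^'n" where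
  "covariant_term G z e X = (\<chi> p. \<Sum>k\<in>UNIV. \<Sum>i\<in>UNIV. christoffel G p k i z * (e $ k * X $ i))"

lemma metric_christoffel:
  fixes G :: "complex^'n \<Rightarrow> complex^'n^'n"
  assumes "det (G z) \<noteq> 0"
  shows "(\<Sum>p\<in>UNIV. G z $ p $ j * christoffel G p k i z) = wirt k (\<lambda>w. G w $ i $ j) z"
proof -
  have "(\<Sum>p\<in>UNIV. G z $ p $ j * christoffel G p k i z) =
      (\<Sum>q\<in>UNIV. (\<Sum>p\<in>UNIV. G z $ p $ j * metric_inv (G z) p q) * wirt k (\<lambda>w. G w $ i $ q) z)"
    unfolding christoffel_def sum_distrib_left sum_distrib_right
    by (subst sum.swap) (simp add: mult.assoc)
  also have "\<dots> = (\<Sum>q\<in>UNIV. if q = j then wirt k (\<lambda>w. G w $ i $ j) z else 0)"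
    by (intro sum.cong) (auto simp: metric_inv_left[OF assms])
  finally show ?thesis by simp
qed

text \<open>Lowering the index cancels the inverse metric inside the Christoffel symbols. The
  identity holds at every point of \<Omega>, so it may be differentiated once more.\<close>

lemma metric_covariant_term:
  fixes G :: "complex^'n \<Rightarrow> complex^'n^'n"
  assumes G: "hermitian_metric_on \<Omega> G" and z: "z \<in> \<Omega>"
  shows "(\<Sum>p\<in>UNIV. G z $ p $ j * covariant_term G z e X $ p) =
         (\<Sum>i\<in>UNIV. wirt_dir e (\<lambda>w. G w $ i $ j) z * X $ i)"
proof -
  have nz: "det (G z) \<noteq> 0"
    using hermitian_metric_onD(2)[OF G z] by (rule pos_hermitian_det)
  have "(\<Sum>p\<in>UNIV. G z $ p $ j * covariant_term G z e X $ p) =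
      (\<Sum>p\<in>UNIV. \<Sum>k\<in>UNIV. \<Sum>i\<in>UNIV. G z $ p $ j * christoffel G p k i z * (e $ k * X $ i))"
    by (simp add: covariant_term_def sum_distrib_left mult.assoc)
  also have "\<dots> = (\<Sum>k\<in>UNIV. \<Sum>p\<in>UNIV. \<Sum>i\<in>UNIV. G z $ p $ j * christoffel G p k i z * (e $ k * X $ i))"
    by (rule sum.swap)
  also have "\<dots> = (\<Sum>k\<in>UNIV. \<Sum>i\<in>UNIV. \<Sum>p\<in>UNIV. G z $ p $ j * christoffel G p k i z * (e $ k * X $ i))"
    by (intro sum.cong refl sum.swap)
  also have "\<dots> = (\<Sum>k\<in>UNIV. \<Sum>i\<in>UNIV. wirt k (\<lambda>w. G w $ i $ j) z * (e $ k * X $ i))"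
    by (simp only: sum_distrib_right[symmetric] metric_christoffel[where G=G, OF nz])
  also have "\<dots> = (\<Sum>i\<in>UNIV. \<Sum>k\<in>UNIV. wirt k (\<lambda>w. G w $ i $ j) z * (e $ k * X $ i))"
    by (rule sum.swap)
  also have "\<dots> = (\<Sum>i\<in>UNIV. wirt_dir e (\<lambda>w. G w $ i $ j) z * X $ i)"
    by (simp add: wirt_dir_eq_sum[OF hermitian_metric_onD(3)[OF G z]] sum_distrib_left mult_ac)
  finally show ?thesis .
qed

lemma differentiable_covariant_term:
  assumes "hermitian_metric_on \<Omega> G" "z \<in> \<Omega>"
  shows "(\<lambda>w. covariant_term G w e X $ p) differentiable at z"
  unfolding covariant_term_def vec_lambda_beta
  by (intro differentiable_sum differentiable_mult ballI differentiable_const differentiable_christoffel[OF assms]) simp_all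

text \<open>Curvature is minus the antiholomorphic derivative of the connection with its upper index
  lowered. As X and e have constant components, the contraction with them passes under the
  derivative; what remains is a reordering of sums.\<close>

lemma curv_form_covariant_term:
  fixes G :: "complex^'n \<Rightarrow> complex^'n^'n"
  assumes G: "hermitian_metric_on \<Omega> G" and z: "z \<in> \<Omega>"
  shows "curv_form G z X X e e =
    - (\<Sum>j\<in>UNIV. cnj (X $ j) * (\<Sum>p\<in>UNIV. G z $ p $ j * wirt_bar_dir e (\<lambda>w. covariant_term G w e X $ p) z))"
proof -
  note d = differentiable_christoffel[OF G z]
  have W: "wirt_bar_dir e (\<lambda>w. covariant_term G w e X $ p) z =
      (\<Sum>k\<in>UNIV. \<Sum>i\<in>UNIV. \<Sum>l\<in>UNIV. cnj (e $ l) * wirt_bar l (christoffel G p k i) z * (e $ k * X $ i))" for p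
    unfolding covariant_term_def vec_lambda_beta
    by (simp add: wirt_bar_dir_sum wirt_bar_dir_cmult d differentiable_sum differentiable_mult
        wirt_bar_dir_eq_sum[OF d] sum_distrib_right)
  define T where "T i j k l p = cnj (X $ j) * (G z $ p $ j * (cnj (e $ l) * wirt_bar l (christoffel G p k i) z * (e $ k * X $ i)))" for i j k l p
  have "(\<Sum>j\<in>UNIV. cnj (X $ j) * (\<Sum>p\<in>UNIV. G z $ p $ j * wirt_bar_dir e (\<lambda>w. covariant_term G w e X $ p) z)) =
      (\<Sum>j\<in>UNIV. \<Sum>p\<in>UNIV. \<Sum>k\<in>UNIV. \<Sum>i\<in>UNIV. \<Sum>l\<in>UNIV. T i j k l p)"
    by (simp add: W T_def sum_distrib_left)
  also have "\<dots> = (\<Sum>j\<in>UNIV. \<Sum>k\<in>UNIV. \<Sum>p\<in>UNIV. \<Sum>i\<in>UNIV. \<Sum>l\<in>UNIV. T i j k l p)"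
    by (intro sum.cong refl sum.swap)
  also have "\<dots> = (\<Sum>j\<in>UNIV. \<Sum>k\<in>UNIV. \<Sum>i\<in>UNIV. \<Sum>p\<in>UNIV. \<Sum>l\<in>UNIV. T i j k l p)"
    by (intro sum.cong refl sum.swap)
  also have "\<dots> = (\<Sum>j\<in>UNIV. \<Sum>i\<in>UNIV. \<Sum>k\<in>UNIV. \<Sum>p\<in>UNIV. \<Sum>l\<in>UNIV. T i j k l p)"
    by (intro sum.cong refl sum.swap)
  also have "\<dots> = (\<Sum>i\<in>UNIV. \<Sum>j\<in>UNIV. \<Sum>k\<in>UNIV. \<Sum>p\<in>UNIV. \<Sum>l\<in>UNIV. T i j k l p)"
    by (rule sum.swap)
  also have "\<dots> = (\<Sum>i\<in>UNIV. \<Sum>j\<in>UNIV. \<Sum>k\<in>UNIV. \<Sum>l\<in>UNIV. \<Sum>p\<in>UNIV. T i j k l p)"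
    by (intro sum.cong refl sum.swap)
  also have "\<dots> = - curv_form G z X X e e"
    by (simp add: curv_form_def curv_def T_def sum_distrib_left sum_negf mult_ac)
  finally show ?thesis by simp
qed


section \<open>The Laplacian of the squared length of a moving vector\<close>

lemma second_order_eqI:
  "second_order f a b \<Longrightarrow> a = a' \<Longrightarrow> b = b' \<Longrightarrow> second_order f a' b'"
  by simp

text \<open>One summand of \<open>herm\<close> for vectors depending affinely on t. Because
  |\<omega>| = 1, the term quadratic in the velocities is the same for every direction of the
  ray.\<close>

lemma second_order_herm_summand:
  assumes f: "second_order f a b" and \<omega>: "\<omega> * cnj \<omega> = 1"
  shows "second_order (\<lambda>s. f s * (x + of_real s * \<omega> * y) * cnj (x' + of_real s * \<omega> * y'))
    (a * x * cnj x' + f 0 * (\<omega> * y * cnj x' + cnj \<omega> * x * cnj y'))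
    (b * x * cnj x' + 2 * a * (\<omega> * y * cnj x' + cnj \<omega> * x * cnj y') + 2 * f 0 * y * cnj y')"
proof -
  have line: "second_order (\<lambda>s. x + of_real s * \<omega> * y) (\<omega> * y) 0" for x y
  proof -
    have "deriv (\<lambda>t. x + t * y) = (\<lambda>_. y)"
      by (intro ext DERIV_imp_deriv) (auto intro!: derivative_eq_intros)
    moreover have "(\<lambda>t. x + t * y) holomorphic_on ball 0 1" by (intro holomorphic_intros)
    ultimately show ?thesis
      using second_order_holomorphic[of "\<lambda>t. x + t * y" 1 \<omega>] by simp
  qed
  have "\<omega> * y * (cnj \<omega> * cnj y') = (\<omega> * cnj \<omega>) * (y * cnj y')" by (simp add: mult_ac)
  then have 1: "\<omega> * (y * (cnj \<omega> * cnj y')) = y * cnj y'" by (simp add: \<omega> mult_ac)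
  show ?thesis
    by (rule second_order_eqI[OF second_order_mult[OF second_order_mult[OF f line[of x y]]
          second_order_cnj[OF line[of x' y']]]])
       (simp_all add: algebra_simps 1 \<omega>)
qed

lemma frechet_derivative_cnj:
  assumes "F differentiable at z"
  shows "fderiv (\<lambda>w. cnj (F w)) z v = cnj (fderiv F z v)"
proof -
  have "((\<lambda>w. cnj (F w)) has_derivative (\<lambda>h. cnj (fderiv F z h))) (at z)"
    using assms by (intro has_derivative_cnj) (simp add: frechet_derivative_works)
  from frechet_derivative_at[OF this] show ?thesis by metis
qed

text \<open>Hermitian symmetry is inherited by real derivatives. Consequently the commutator term of
  \<open>wirt_bar_dir_wirt_dir\<close>, which carries a factor \<i>, is purely imaginary after
  contraction with X and vanishes from real parts.\<close>

lemma second_derivative_metric_real: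
  fixes G :: "complex^'n \<Rightarrow> complex^'n^'n"
  assumes G: "hermitian_metric_on \<Omega> G" and z: "z \<in> \<Omega>"
  shows "Im (\<Sum>i\<in>UNIV. \<Sum>j\<in>UNIV.
      fderiv (\<lambda>w. fderiv (\<lambda>w. G w $ i $ j) w v) z u * X $ i * cnj (X $ j)) = 0"
    (is "Im ?S = 0")
proof -
  let ?D = "\<lambda>i j w. fderiv (\<lambda>w. G w $ i $ j) w v"
  let ?D2 = "\<lambda>i j. fderiv (?D i j) z u"
  have o: "open \<Omega>" by (rule hermitian_metric_onD(1)[OF G])
  have D: "cnj (?D i j w) = ?D j i w" if w: "w \<in> \<Omega>" for i j w
  proof -
    have "cnj (?D i j w) = fderiv (\<lambda>w. cnj (G w $ i $ j)) w v"
      by (rule frechet_derivative_cnj[symmetric]) (rule hermitian_metric_onD(3)[OF G w])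
    also have "fderiv (\<lambda>w. cnj (G w $ i $ j)) w = fderiv (\<lambda>w. G w $ j $ i) w"
      by (rule frechet_derivative_cong_open[OF o w])
         (rule pos_hermitian_entry[OF hermitian_metric_onD(2)[OF G]])
    finally show ?thesis .
  qed
  have D2: "cnj (?D2 i j) = ?D2 j i" for i j
  proof -
    have "cnj (?D2 i j) = fderiv (\<lambda>w. cnj (?D i j w)) z u"
      by (rule frechet_derivative_cnj[symmetric]) (rule hermitian_metric_onD(4)[OF G z])
    also have "fderiv (\<lambda>w. cnj (?D i j w)) z = fderiv (?D j i) z"
      by (rule frechet_derivative_cong_open[OF o z]) (rule D)
    finally show ?thesis .
  qed
  have "cnj ?S = (\<Sum>i\<in>UNIV. \<Sum>j\<in>UNIV. ?D2 j i * cnj (X $ i) * X $ j)"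
    by (simp add: D2)
  also have "\<dots> = ?S"
    by (subst sum.swap) (simp add: mult_ac)
  finally have "cnj ?S = ?S" .
  moreover have "Im s = 0" if "cnj s = s" for s using that by (simp add: complex_eq_iff)
  ultimately show ?thesis by blast
qed

lemma wirt_bar_dir_wirt_dir:
  assumes "\<And>v. (\<lambda>w. fderiv F w v) differentiable at z"
  shows "4 * wirt_bar_dir e (wirt_dir e F) z =
     fderiv (\<lambda>w. fderiv F w e) z e +
     fderiv (\<lambda>w. fderiv F w (\<i> *s e)) z (\<i> *s e) +
     \<i> * (fderiv (\<lambda>w. fderiv F w e) z (\<i> *s e) -
          fderiv (\<lambda>w. fderiv F w (\<i> *s e)) z e)"
proof -
  have "(wirt_dir e F has_derivative (\<lambda>h. (fderiv (\<lambda>w. fderiv F w e) z h -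
      \<i> * fderiv (\<lambda>w. fderiv F w (\<i> *s e)) z h) / 2)) (at z)"
    unfolding wirt_dir_def[abs_def] divide_inverse
    by (intro has_derivative_mult_left has_derivative_diff has_derivative_mult_right
         frechet_derivative_works[THEN iffD1] assms)
  note * = frechet_derivative_at[OF this, symmetric]
  show ?thesis by (simp add: wirt_bar_dir_def * field_simps)
qed

text \<open>Adding the second derivatives along the rays of directions 1 and \<i> gives the
  Laplacian, four times the complex Hessian. The field \<open>V\<close> has vanishing covariant
  derivative at \<open>z0\<close> in direction e, so the only surviving term is the
  curvature.\<close>

lemma second_variation:
  fixes G :: "complex^'n \<Rightarrow> complex^'n^'n" and X e x :: "complex^'n"
  assumes G: "hermitian_metric_on \<Omega> G" and z0: "z0 \<in> \<Omega>"
    and \<sigma>: "\<sigma> holomorphic_on ball 0 r" "0 < r" "\<sigma> 0 = 0" "deriv \<sigma> 0 = 0"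
  defines "V \<equiv> \<lambda>t. X - t *s covariant_term G z0 e X"
  shows "\<exists>a B. (\<forall>\<omega>. \<omega> * cnj \<omega> = 1 \<longrightarrow>
      second_order (\<lambda>s. herm (G (z0 + (of_real s * \<omega>) *s e + \<sigma> (of_real s * \<omega>) *s x))
        (V (of_real s * \<omega>)) (V (of_real s * \<omega>))) (a \<omega>) (B \<omega>)) \<and>
      Re (B 1 + B \<i>) = - 4 * Re (curv_form G z0 X X e e)"
proof -
  define Y where "Y = - covariant_term G z0 e X"
  let ?D = "\<lambda>v i j w. fderiv (\<lambda>w. G w $ i $ j) w v"
  let ?D2 = "\<lambda>u v i j. fderiv (?D v i j) z0 u"
  let ?W = "\<lambda>i j. wirt_dir e (\<lambda>w. G w $ i $ j)"
  let ?Wb = "\<lambda>i j. wirt_bar_dir e (\<lambda>w. G w $ i $ j) z0"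
  have o: "open \<Omega>" by (rule hermitian_metric_onD(1)[OF G])
  have V: "V t $ i = X $ i + t * Y $ i" for t i by (simp add: V_def Y_def)
  have lin: "linear (fderiv (\<lambda>w. G w $ i $ j) z0)" for i j
    using hermitian_metric_onD(3)[OF G z0] by (rule linear_frechet_derivative)
  define b where "b \<omega> i j =
     (?D2 (\<omega> *s e) (\<omega> *s e) i j + ?D ((\<omega>\<^sup>2 * deriv (deriv \<sigma>) 0) *s x) i j z0) * X $ i * cnj (X $ j) +
     2 * ?D (\<omega> *s e) i j z0 * (\<omega> * Y $ i * cnj (X $ j) + cnj \<omega> * X $ i * cnj (Y $ j)) +
     2 * G z0 $ i $ j * Y $ i * cnj (Y $ j)" for \<omega> i j
  define B where "B \<omega> = (\<Sum>i\<in>UNIV. \<Sum>j\<in>UNIV. b \<omega> i j)" for \<omega>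
  define a where "a \<omega> = (\<Sum>i\<in>UNIV. \<Sum>j\<in>UNIV.
     ?D (\<omega> *s e) i j z0 * X $ i * cnj (X $ j) +
     G z0 $ i $ j * (\<omega> * Y $ i * cnj (X $ j) + cnj \<omega> * X $ i * cnj (Y $ j)))" for \<omega>
  have "second_order (\<lambda>s. herm (G (z0 + (of_real s * \<omega>) *s e + \<sigma> (of_real s * \<omega>) *s x))
        (V (of_real s * \<omega>)) (V (of_real s * \<omega>))) (a \<omega>) (B \<omega>)" if \<omega>: "\<omega> * cnj \<omega> = 1" for \<omega>
  proof -
    have "second_order (\<lambda>s. G (z0 + (of_real s * \<omega>) *s e + \<sigma> (of_real s * \<omega>) *s x) $ i $ j)
      (?D (\<omega> *s e) i j z0) (?D2 (\<omega> *s e) (\<omega> *s e) i j + ?D ((\<omega>\<^sup>2 * deriv (deriv \<sigma>) 0) *s x) i j z0)" for i j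
      by (rule second_order_along_curve[OF o z0 hermitian_metric_onD(3)[OF G] hermitian_metric_onD(4)[OF G z0] \<sigma>])
    from second_order_herm_summand[OF this \<omega>]
    show ?thesis
      unfolding herm_def V a_def B_def b_def
      by (intro second_order_sum) (simp add: \<sigma>(3))
  qed
  moreover have "Re (B 1 + B \<i>) = - 4 * Re (curv_form G z0 X X e e)"
  proof -
    define S1 where "S1 = (\<Sum>i\<in>UNIV. \<Sum>j\<in>UNIV. (?D2 e e i j + ?D2 (\<i> *s e) (\<i> *s e) i j) * X $ i * cnj (X $ j))"
    define S2 where "S2 = (\<Sum>i\<in>UNIV. \<Sum>j\<in>UNIV. ?Wb i j * Y $ i * cnj (X $ j))"
    define S3 where "S3 = (\<Sum>i\<in>UNIV. \<Sum>j\<in>UNIV. ?W i j z0 * X $ i * cnj (Y $ j))"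
    define S4 where "S4 = (\<Sum>i\<in>UNIV. \<Sum>j\<in>UNIV. G z0 $ i $ j * Y $ i * cnj (Y $ j))"
    define T where "T = (\<Sum>i\<in>UNIV. \<Sum>j\<in>UNIV. wirt_bar_dir e (?W i j) z0 * X $ i * cnj (X $ j))"
    \<comment> \<open>1^2 + \<i>^2 = 0: the bending of the curve does not contribute to the
      Laplacian.\<close>
    have cancel: "?D ((1\<^sup>2 * b) *s x) i j z0 + ?D ((\<i>\<^sup>2 * b) *s x) i j z0 = 0" for b i j
    proof -
      have "(\<i>\<^sup>2 * b) *s x = - (b *s x)" by (simp add: vec_eq_iff)
      then show ?thesis using linear_neg[OF lin] by simp
    qed
    have D: "?D e i j z0 = ?W i j z0 + ?Wb i j" "?D (\<i> *s e) i j z0 = \<i> * (?W i j z0 - ?Wb i j)" for i j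
      by (simp_all add: wirt_dir_def wirt_bar_dir_def field_simps)
    have "B 1 + B \<i> = S1 + 4 * S2 + 4 * (S3 + S4)"
    proof -
      have "b 1 i j + b \<i> i j = (?D2 e e i j + ?D2 (\<i> *s e) (\<i> *s e) i j) * (X $ i * cnj (X $ j)) +
          4 * (?Wb i j * (Y $ i * cnj (X $ j))) + 4 * (?W i j z0 * (X $ i * cnj (Y $ j))) +
          4 * (G z0 $ i $ j * Y $ i * cnj (Y $ j))" for i j
        using cancel[where b="deriv (deriv \<sigma>) 0" and i=i and j=j, THEN eq_neg_iff_add_eq_0[THEN iffD2]]
        by (simp add: b_def D algebra_simps)
      then have "B 1 + B \<i> = (\<Sum>i\<in>UNIV. \<Sum>j\<in>UNIV.
        ((?D2 e e i j + ?D2 (\<i> *s e) (\<i> *s e) i j) * (X $ i * cnj (X $ j)) + 4 * (?Wb i j * (Y $ i * cnj (X $ j)))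
         + 4 * (?W i j z0 * (X $ i * cnj (Y $ j))) + 4 * (G z0 $ i $ j * Y $ i * cnj (Y $ j))))"
        by (simp add: B_def flip: sum.distrib)
      then show ?thesis
        by (simp add: S1_def S2_def S3_def S4_def sum.distrib sum_distrib_left mult.assoc)
    qed
    \<comment> \<open>This expresses that the covariant derivative of V at \<open>z0\<close>
      vanishes: for each j, the derivative of the metric contracted with X is compensated by the
      lowered velocity Y.\<close>
    moreover have "S3 + S4 = 0"
    proof -
      have "S3 + S4 = (\<Sum>j\<in>UNIV. \<Sum>i\<in>UNIV. ?W i j z0 * X $ i * cnj (Y $ j) + G z0 $ i $ j * Y $ i * cnj (Y $ j))"
        unfolding S3_def S4_def sum.distrib[symmetric] by (rule sum.swap)
      also have "\<dots> = (\<Sum>j\<in>UNIV. ((\<Sum>i\<in>UNIV. ?W i j z0 * X $ i) - (\<Sum>p\<in>UNIV. G z0 $ p $ j * covariant_term G z0 e X $ p)) * cnj (Y $ j))"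
        by (simp add: Y_def sum_distrib_left sum.distrib sum_negf algebra_simps sum_subtractf)
      also have "\<dots> = 0" by (simp add: metric_covariant_term[OF G z0])
      finally show ?thesis .
    qed
    moreover have "curv_form G z0 X X e e = - T - S2"
    proof -
      \<comment> \<open>Obtained by applying the antiholomorphic derivative to both sides of
        \<open>metric_covariant_term\<close>. The part of the product rule that differentiates the
        metric becomes \<open>S2\<close>, since Y is minus the covariant term.\<close>
      have j: "(\<Sum>p\<in>UNIV. G z0 $ p $ j * wirt_bar_dir e (\<lambda>w. covariant_term G w e X $ p) z0) =
          (\<Sum>i\<in>UNIV. wirt_bar_dir e (?W i j) z0 * X $ i) + (\<Sum>i\<in>UNIV. ?Wb i j * Y $ i)" for j
      proof -
        have "(\<Sum>p\<in>UNIV. ?Wb p j * covariant_term G z0 e X $ p + G z0 $ p $ j * wirt_bar_dir e (\<lambda>w. covariant_term G w e X $ p) z0)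
            = wirt_bar_dir e (\<lambda>w. \<Sum>p\<in>UNIV. G w $ p $ j * covariant_term G w e X $ p) z0"
          by (subst wirt_bar_dir_sum)
             (simp_all add: wirt_bar_dir_mult differentiable_mult hermitian_metric_onD(3)[OF G z0] differentiable_covariant_term[OF G z0])
        also have "\<dots> = wirt_bar_dir e (\<lambda>w. \<Sum>i\<in>UNIV. ?W i j w * X $ i) z0"
          by (rule wirt_bar_dir_cong[OF o z0]) (rule metric_covariant_term[OF G])
        also have "\<dots> = (\<Sum>i\<in>UNIV. wirt_bar_dir e (?W i j) z0 * X $ i)"
        proof -
          have d: "?W i j differentiable at z0" for i
            unfolding wirt_dir_def[abs_def] divide_inverse
            by (intro differentiable_mult differentiable_diff differentiable_const hermitian_metric_onD(4)[OF G z0])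
          then show ?thesis by (simp add: wirt_bar_dir_sum wirt_bar_dir_cmult differentiable_mult)
        qed
        finally show ?thesis by (simp add: Y_def sum.distrib sum_negf algebra_simps)
      qed
      have "T = (\<Sum>j\<in>UNIV. \<Sum>i\<in>UNIV. wirt_bar_dir e (?W i j) z0 * X $ i * cnj (X $ j))"
        unfolding T_def by (rule sum.swap)
      moreover have "S2 = (\<Sum>j\<in>UNIV. \<Sum>i\<in>UNIV. ?Wb i j * Y $ i * cnj (X $ j))"
        unfolding S2_def by (rule sum.swap)
      ultimately show ?thesis
        unfolding curv_form_covariant_term[OF G z0] j
        by (simp add: sum.distrib sum_distrib_left distrib_left mult_ac)
    qed
    moreover have "4 * Re T = Re S1"
    proof -
      let ?K = "\<lambda>u v. (\<Sum>i\<in>UNIV. \<Sum>j\<in>UNIV. ?D2 u v i j * X $ i * cnj (X $ j))"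
      have "4 * T = (\<Sum>i\<in>UNIV. \<Sum>j\<in>UNIV. 4 * wirt_bar_dir e (?W i j) z0 * X $ i * cnj (X $ j))"
        by (simp add: T_def sum_distrib_left mult.assoc)
      also have "\<dots> = S1 + \<i> * (?K (\<i> *s e) e - ?K e (\<i> *s e))"
        by (simp add: wirt_bar_dir_wirt_dir[OF hermitian_metric_onD(4)[OF G z0]] S1_def
            sum_distrib_left algebra_simps sum.distrib sum_subtractf)
      finally have "Re (4 * T) = Re (S1 + \<i> * (?K (\<i> *s e) e - ?K e (\<i> *s e)))" by simp
      also have "\<dots> = Re S1"
        using second_derivative_metric_real[OF G z0] by (simp only: plus_complex.simps times_complex.simps minus_complex.simps) simp
      finally show ?thesis by simp
    qed
    ultimately show ?thesis by simp
  qed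
  ultimately show ?thesis by blast
qed

text \<open>\<open>|q|\<^sup>2\<close> is subharmonic, so a function touching it from above has nonnegative Laplacian.\<close>

lemma curvature_nonpos_of_touching:
  fixes G :: "complex^'n \<Rightarrow> complex^'n^'n"
  assumes G: "hermitian_metric_on \<Omega> G" and z0: "z0 \<in> \<Omega>"
    and \<sigma>: "\<sigma> holomorphic_on ball 0 r" "0 < r" "\<sigma> 0 = 0" "deriv \<sigma> 0 = 0"
    and q: "q holomorphic_on ball 0 r"
    and le: "\<And>t. t \<in> ball 0 r \<Longrightarrow> (norm (q t))\<^sup>2 \<le>
        Re (herm (G (z0 + t *s e + \<sigma> t *s x)) (X - t *s covariant_term G z0 e X) (X - t *s covariant_term G z0 e X))"
    and eq: "(norm (q 0))\<^sup>2 = Re (herm (G z0) X X)"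
  shows "Re (curv_form G z0 X X e e) \<le> 0"
proof -
  let ?V = "\<lambda>t. X - t *s covariant_term G z0 e X"
  let ?H = "\<lambda>\<omega> s. herm (G (z0 + (of_real s * \<omega>) *s e + \<sigma> (of_real s * \<omega>) *s x)) (?V (of_real s * \<omega>)) (?V (of_real s * \<omega>))"
  obtain a B where B: "\<And>\<omega>. \<omega> * cnj \<omega> = 1 \<Longrightarrow> second_order (?H \<omega>) (a \<omega>) (B \<omega>)"
    "Re (B 1 + B \<i>) = - 4 * Re (curv_form G z0 X X e e)"
    using second_variation[OF G z0 \<sigma>, where X=X and e=e and x=x] by blast
  \<comment> \<open>The second derivative of |q|^2 along the ray of direction \<omega>. The sum C 1
    + C \<i> equals 4 |q'(0)|^2, because the terms containing q'' cancel.\<close>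
  define C where "C \<omega> = \<omega>\<^sup>2 * deriv (deriv q) 0 * cnj (q 0) + 2 * (\<omega> * deriv q 0) * cnj (\<omega> * deriv q 0) +
      q 0 * cnj (\<omega>\<^sup>2 * deriv (deriv q) 0)" for \<omega>
  have nq: "Re (w * cnj w) = (norm w)\<^sup>2" for w :: complex
    by (metis Re_complex_of_real complex_norm_square)
  have "0 \<le> Re (B \<omega> + - C \<omega>)" if \<omega>: "\<omega> * cnj \<omega> = 1" for \<omega>
  proof (rule second_order_local_min)
    have "second_order (\<lambda>s. q (of_real s * \<omega>) * cnj (q (of_real s * \<omega>)))
        (\<omega> * deriv q 0 * cnj (q 0) + q 0 * cnj (\<omega> * deriv q 0)) (C \<omega>)"
      using second_order_mult[OF second_order_holomorphic[OF q \<sigma>(2), of \<omega>] second_order_cnj[OF second_order_holomorphic[OF q \<sigma>(2), of \<omega>]]]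
      by (simp add: C_def)
    from second_order_add[OF B(1)[OF \<omega>] second_order_minus[OF this]]
    show "second_order (\<lambda>s. ?H \<omega> s + - (q (of_real s * \<omega>) * cnj (q (of_real s * \<omega>))))
      (a \<omega> + - (\<omega> * deriv q 0 * cnj (q 0) + q 0 * cnj (\<omega> * deriv q 0))) (B \<omega> + - C \<omega>)" .
    have n: "norm \<omega> = 1"
      using \<omega> by (metis complex_mod_sqrt_Re_mult_cnj real_sqrt_one one_complex.simps(1))
    have "\<forall>\<^sub>F s in nhds 0. s \<in> ball (0::real) r" using \<sigma>(2) by (intro eventually_nhds_in_open) auto
    then show "\<forall>\<^sub>F s in nhds 0.
       Re (?H \<omega> 0 + - (q (of_real 0 * \<omega>) * cnj (q (of_real 0 * \<omega>)))) \<le> Re (?H \<omega> s + - (q (of_real s * \<omega>) * cnj (q (of_real s * \<omega>))))"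
    proof eventually_elim
      case (elim s)
      then have "(norm (q (of_real s * \<omega>)))\<^sup>2 \<le> Re (?H \<omega> s)" using n by (intro le) (simp add: norm_mult)
      then show ?case using eq by (simp add: nq \<sigma>(3) del: times_complex.simps complex_mult_cnj)
    qed
  qed
  from this[of 1] this[of \<i>] have "Re (C 1 + C \<i>) \<le> Re (B 1 + B \<i>)" by simp
  moreover have "C 1 + C \<i> = 4 * (deriv q 0 * cnj (deriv q 0))"
    by (simp add: C_def algebra_simps)
  then have "Re (C 1 + C \<i>) = 4 * (norm (deriv q 0))\<^sup>2"
    using nq[of "deriv q 0"] by simp
  ultimately show ?thesis using B(2) zero_le_power2[of "norm (deriv q 0)"] by linarith
qed


section \<open>The local maximum principle\<close>


lemma frechet_derivative_eq_taylor_coeff: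
  assumes u: "holomorphic_fun_on u S" and z: "z \<in> S"
  shows "fderiv u z v = line_coeff (Suc 0) u z v"
proof -
  have "((\<lambda>s. u (z + s *s v)) has_field_derivative fderiv u (z + 0 *s v) v) (at 0)"
    by (rule holomorphic_fun_on_curve[OF u has_derivative_line]) (use z in simp)
  then show ?thesis by (simp add: taylor_coeff_1 DERIV_imp_deriv)
qed

text \<open>\<open>holomorphic_fun_on\<close> demands derivatives pointwise only. Cauchy's formula
  upgrades this to continuous differentiability, which the inverse function theorem
  requires.\<close>

lemma continuous_on_frechet_derivative:
  assumes u: "holomorphic_fun_on u S" and S: "open S"
  shows "continuous_on S (\<lambda>z. fderiv u z v)"
proof -
  have "continuous_on S (\<lambda>z. line_coeff (Suc 0) u z v)"
    unfolding continuous_on_eq_continuous_at[OF S]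
  proof
    fix z assume "z \<in> S"
    from continuous_at_taylor_coeff_line[OF u S this, of v "Suc 0"]
    have "isCont (\<lambda>z. (\<lambda>p. line_coeff (Suc 0) u (fst p) (snd p)) (z, v)) z"
      by (rule isCont_o2[rotated]) (intro continuous_intros)
    then show "isCont (\<lambda>z. line_coeff (Suc 0) u z v) z" by simp
  qed
  then show ?thesis
    by (simp add: frechet_derivative_eq_taylor_coeff[OF u] cong: continuous_on_cong)
qed

text \<open>The inverse function theorem is applied to (t, s) \<mapsto> (t, \<eta> (z0 + t e + s
  x)), a map between two-dimensional spaces whatever the dimension of the domain. The derivative of
  \<sigma> vanishes at 0 because e is tangent to the level set.\<close>

lemma implicit_curve:
  fixes \<eta> :: "complex^'n \<Rightarrow> complex"
  assumes \<eta>: "holomorphic_fun_on \<eta> S" and S: "open S" and z0: "z0 \<in> S"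
    and x: "fderiv \<eta> z0 x \<noteq> 0" and e: "fderiv \<eta> z0 e = 0"
  obtains r \<sigma> where "0 < r" "\<sigma> holomorphic_on ball 0 r" "\<sigma> 0 = 0" "deriv \<sigma> 0 = 0"
    "\<And>t. t \<in> ball 0 r \<Longrightarrow> z0 + t *s e + \<sigma> t *s x \<in> S"
    "\<And>t. t \<in> ball 0 r \<Longrightarrow> \<eta> (z0 + t *s e + \<sigma> t *s x) = \<eta> z0"
proof -
  define m where "m p = z0 + fst p *s e + snd p *s x" for p :: "complex \<times> complex"
  define L where "L p = fderiv \<eta> (m p)" for p
  define U where "U = m -` S"
  define H where "H p = (fst p, \<eta> (m p))" for p
  define H' where "H' p = Blinfun (\<lambda>q. (fst q, fst q * L p e + snd q * L p x))" for p
  have cm: "continuous_on T m" for T unfolding m_def by (intro continuous_intros)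
  have U: "open U" unfolding U_def by (rule open_vimage[OF S cm])
  have H'_apply: "blinfun_apply (H' p) q = (fst q, fst q * L p e + snd q * L p x)" for p q
  proof -
    have "bounded_linear (\<lambda>q. (fst q, fst q * L p e + snd q * L p x))"
      by (intro bounded_linear_Pair bounded_linear_add bounded_linear_fst
          bounded_linear_mult_const[OF bounded_linear_fst] bounded_linear_mult_const[OF bounded_linear_snd])
    then show ?thesis by (simp add: H'_def bounded_linear_Blinfun_apply)
  qed
  have dH: "(H has_derivative blinfun_apply (H' p)) (at p)" if p: "p \<in> U" for p
  proof -
    have mp: "m p \<in> S" using p by (simp add: U_def)
    have "(m has_derivative (\<lambda>q. fst q *s e + snd q *s x)) (at p)"
      unfolding m_def[abs_def]
      by (rule has_derivative_eq_rhs, (rule has_derivative_add has_derivative_const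
           bounded_linear.has_derivative[OF bounded_bilinear.bounded_linear_left[OF bounded_bilinear_vector_scalar_mult]]
           has_derivative_fst has_derivative_snd has_derivative_ident)+) simp
    from has_derivative_compose[OF this holomorphic_fun_on_derivative(1)[OF \<eta> mp]]
    have "((\<lambda>p. \<eta> (m p)) has_derivative (\<lambda>q. L p (fst q *s e + snd q *s x))) (at p)"
      by (simp add: L_def)
    then have "((\<lambda>p. \<eta> (m p)) has_derivative (\<lambda>q. fst q * L p e + snd q * L p x)) (at p)"
      by (rule has_derivative_eq_rhs)
         (simp add: L_def fun_eq_iff holomorphic_fun_on_add_derivative[OF \<eta> mp] holomorphic_fun_on_derivative(2)[OF \<eta> mp])
    then have "(H has_derivative (\<lambda>q. (fst q, fst q * L p e + snd q * L p x))) (at p)"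
      unfolding H_def[abs_def] by (intro has_derivative_Pair has_derivative_fst has_derivative_ident)
    then show ?thesis by (rule has_derivative_eq_rhs) (simp add: fun_eq_iff H'_apply)
  qed
  have contL: "continuous_on U (\<lambda>p. L p v)" for v
    unfolding L_def U_def
    by (rule continuous_on_compose2[OF continuous_on_frechet_derivative[OF \<eta> S] cm]) auto
  have contH': "continuous_on U H'"
    by (rule continuous_on_blinfun_componentwise)
       (auto simp: H'_apply intro!: continuous_intros contL)
  have m0: "m 0 = z0" by (simp add: m_def)
  have L0: "L 0 e = 0" "L 0 x \<noteq> 0" using e x by (simp_all add: L_def m0)
  have blin: "bounded_linear (\<lambda>q :: complex \<times> complex. (fst q, snd q / L 0 x))"
    by (intro bounded_linear_Pair bounded_linear_fst bounded_linear_compose[OF bounded_linear_divide bounded_linear_snd])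
  have inv: "Blinfun (\<lambda>q. (fst q, snd q / L 0 x)) o\<^sub>L H' 0 = id_blinfun"
    by (rule blinfun_eqI) (simp add: bounded_linear_Blinfun_apply[OF blin] H'_apply L0)
  have "0 \<in> U" using z0 by (simp add: U_def m0)
  obtain U' V g g' where *: "open U'" "U' \<subseteq> U" "0 \<in> U'" "open V" "H 0 \<in> V" "homeomorphism U' V H g"
    "\<And>y. y \<in> V \<Longrightarrow> (g has_derivative (g' y)) (at y)"
    "\<And>y. y \<in> V \<Longrightarrow> g' y = inv (blinfun_apply (H' (g y)))"
    "\<And>y. y \<in> V \<Longrightarrow> bij (blinfun_apply (H' (g y)))"
    using inverse_function_theorem[OF U dH contH' \<open>0 \<in> U\<close> inv] by metis
  have H0: "H 0 = (0, \<eta> z0)" by (simp add: H_def m0)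
  have gH: "g (H p) = p" if "p \<in> U'" for p using *(6) that by (simp add: homeomorphism_def)
  have Hg: "H (g y) = y" "g y \<in> U'" if "y \<in> V" for y using *(6) that by (auto simp: homeomorphism_def)
  define \<sigma> where "\<sigma> t = snd (g (t, \<eta> z0))" for t
  have "open ((\<lambda>t. (t, \<eta> z0)) -` V)"
    by (rule open_vimage[OF *(4)]) (intro continuous_intros)
  moreover have "0 \<in> (\<lambda>t. (t, \<eta> z0)) -` V" using *(5) H0 by simp
  ultimately obtain r where r: "0 < r" "ball 0 r \<subseteq> (\<lambda>t. (t, \<eta> z0)) -` V"
    using open_contains_ball by blast
  have g_eq: "g (t, \<eta> z0) = (t, \<sigma> t)" if "t \<in> ball 0 r" for t
  proof -
    have "fst (H (g (t, \<eta> z0))) = t" using Hg(1)[of "(t, \<eta> z0)"] r(2) that by auto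
    then show ?thesis by (simp add: H_def \<sigma>_def prod_eq_iff)
  qed
  \<comment> \<open>The real derivative supplied by the inverse function theorem turns out to be
    multiplication by a complex number, so \<sigma> is holomorphic.\<close>
  have der: "(\<sigma> has_field_derivative - L (t, \<sigma> t) e / L (t, \<sigma> t) x) (at t)" if t: "t \<in> ball 0 r" for t
  proof -
    let ?y = "(t, \<eta> z0)"
    have y: "?y \<in> V" using r(2) t by auto
    have "((\<lambda>t. (t, \<eta> z0)) has_derivative (\<lambda>h. (h, 0))) (at t)"
      by (intro has_derivative_Pair has_derivative_ident has_derivative_const)
    from has_derivative_snd[OF has_derivative_compose[OF this *(7)[OF y]]]
    have d: "(\<sigma> has_derivative (\<lambda>h. snd (g' ?y (h, 0)))) (at t)" by (simp add: \<sigma>_def[abs_def])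
    have b: "bij (blinfun_apply (H' (t, \<sigma> t)))" using *(9)[OF y] g_eq[OF t] by simp
    have nz: "L (t, \<sigma> t) x \<noteq> 0"
    proof
      assume "L (t, \<sigma> t) x = 0"
      then have "blinfun_apply (H' (t, \<sigma> t)) (0, 1) = blinfun_apply (H' (t, \<sigma> t)) (0, 0)"
        by (simp add: H'_apply)
      from injD[OF bij_is_inj[OF b] this] show False by simp
    qed
    have "snd (g' ?y (h, 0)) = (- L (t, \<sigma> t) e / L (t, \<sigma> t) x) * h" for h
    proof -
      have "blinfun_apply (H' (t, \<sigma> t)) (g' ?y (h, 0)) = (h, 0)"
        using *(8)[OF y] g_eq[OF t] bij_is_surj[OF b] by (simp add: surj_f_inv_f)
      then have "fst (g' ?y (h, 0)) = h" "h * L (t, \<sigma> t) e + snd (g' ?y (h, 0)) * L (t, \<sigma> t) x = 0"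
        by (auto simp: H'_apply)
      then show ?thesis using nz by (simp add: field_simps eq_neg_iff_add_eq_0)
    qed
    then have "(\<lambda>h. snd (g' ?y (h, 0))) = (*) (- L (t, \<sigma> t) e / L (t, \<sigma> t) x)" by auto
    with d show ?thesis unfolding has_field_derivative_def by metis
  qed
  have \<sigma>0: "\<sigma> 0 = 0" using gH[OF *(3)] H0 by (simp add: \<sigma>_def)
  show ?thesis
  proof (rule that[OF r(1)])
    show "\<sigma> holomorphic_on ball 0 r" using der by (subst holomorphic_on_open) blast+
    show "\<sigma> 0 = 0" by (rule \<sigma>0)
    show "deriv \<sigma> 0 = 0"
      using DERIV_imp_deriv[OF der[of 0]] r(1) \<sigma>0 L0(1) by (simp add: zero_prod_def)
    fix t assume t: "t \<in> ball (0::complex) r"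
    have y: "(t, \<eta> z0) \<in> V" using r(2) t by auto
    have "m (t, \<sigma> t) \<in> S" using Hg(2)[OF y] *(2) g_eq[OF t] by (auto simp: U_def)
    then show "z0 + t *s e + \<sigma> t *s x \<in> S" by (simp add: m_def)
    show "\<eta> (z0 + t *s e + \<sigma> t *s x) = \<eta> z0"
      using Hg(1)[OF y] g_eq[OF t] by (simp add: H_def m_def)
  qed
qed

lemma herm_orthogonal_of_min:
  fixes G :: "complex^'n^'n"
  assumes G: "pos_hermitian G" and min: "\<And>c. Re (herm G X X) \<le> Re (herm G (X + c *s v) (X + c *s v))"
  shows "herm G v X = 0"
proof (rule ccontr)
  assume nz: "herm G v X \<noteq> 0"
  then have "v \<noteq> 0" by auto
  define h where "h = Re (herm G v v)"
  have h: "0 < h" "herm G v v = of_real h"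
    using herm_self_pos[OF G \<open>v \<noteq> 0\<close>] herm_self_real[OF G] by (auto simp: h_def)
  define b where "b = herm G v X"
  \<comment> \<open>The minimizer of the quadratic function c \<mapsto> |X + c v|^2, which lowers
    the value by |b|^2 / h.\<close>
  define c where "c = - cnj b / of_real h"
  have b': "herm G X v = cnj b" using herm_commute[OF G, of X v] by (simp add: b_def)
  have "herm G (X + c *s v) (X + c *s v) = herm G X X + (c * b + cnj c * cnj b + c * cnj c * of_real h)"
    by (simp add: herm_add_left herm_add_right herm_scale_left herm_scale_right b' h(2) b_def[symmetric] algebra_simps)
  also have "c * b + cnj c * cnj b + c * cnj c * of_real h = - (b * cnj b) / of_real h"
    using h(1) by (simp add: c_def field_simps)
  also have "\<dots> = of_real (- ((norm b)\<^sup>2 / h))"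
    by (simp flip: complex_norm_square)
  finally have "Re (herm G (X + c *s v) (X + c *s v)) = Re (herm G X X) - (norm b)\<^sup>2 / h" by simp
  moreover have "0 < (norm b)\<^sup>2 / h" using nz h by (simp add: b_def)
  ultimately show False using min[of c] by simp
qed

text \<open>Near 0 the quotient p t / p 0 has positive real part, so the principal logarithm
  provides a root. Only moduli are compared, so the constant p 0 may be replaced by its absolute
  value.\<close>

lemma holomorphic_kth_root:
  assumes p: "p holomorphic_on ball 0 r" and r: "0 < r" and p0: "p 0 \<noteq> 0" and k: "0 < k"
  obtains \<delta> q where "0 < \<delta>" "\<delta> \<le> r" "q holomorphic_on ball 0 \<delta>"
    "\<And>t. t \<in> ball 0 \<delta> \<Longrightarrow> norm (q t) ^ k = norm (p t)"
proof -
  have "continuous_on (ball 0 r) (\<lambda>t. p t / p 0)"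
    using p0 by (intro continuous_intros holomorphic_on_imp_continuous_on p) auto
  then have "continuous (at 0) (\<lambda>t. p t / p 0)" using r by (simp add: continuous_on_eq_continuous_at)
  then have "((\<lambda>t. p t / p 0) \<longlongrightarrow> 1) (at 0)" using p0 by (simp add: continuous_within)
  then obtain d where d: "0 < d" "\<And>t. t \<noteq> 0 \<Longrightarrow> dist t 0 < d \<Longrightarrow> dist (p t / p 0) 1 < 1"
    using tendstoD[of "\<lambda>t. p t / p 0" 1 "at 0" 1] by (auto simp: eventually_at)
  define \<delta> where "\<delta> = min d r"
  have \<delta>: "0 < \<delta>" "\<delta> \<le> r" using d r by (auto simp: \<delta>_def)
  have D: "dist (p t / p 0) 1 < 1" if "t \<in> ball 0 \<delta>" for t
    using d(2)[of t] that p0 by (cases "t = 0") (auto simp: \<delta>_def)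
  have pos: "0 < Re (p t / p 0)" if "t \<in> ball 0 \<delta>" for t
  proof -
    have "\<bar>Re (p t / p 0 - 1)\<bar> < 1"
      using D[OF that] abs_Re_le_cmod[of "p t / p 0 - 1"] by (simp add: dist_norm)
    then show ?thesis by simp
  qed
  define q where "q t = of_real (root k (norm (p 0))) * exp (Ln (p t / p 0) / of_nat k)" for t
  have "q holomorphic_on ball 0 \<delta>"
    unfolding q_def using pos \<delta>(2) k p0
    by (intro holomorphic_intros holomorphic_on_subset[OF p]) (force simp: complex_nonpos_Reals_iff)+
  moreover have "norm (q t) ^ k = norm (p t)" if t: "t \<in> ball 0 \<delta>" for t
  proof -
    have "p t / p 0 \<noteq> 0" using pos[OF t] by force
    then have "exp (Ln (p t / p 0) / of_nat k) ^ k = p t / p 0"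
      using k by (simp flip: exp_of_nat_mult)
    then have "q t ^ k = of_real (root k (norm (p 0)) ^ k) * (p t / p 0)"
      by (simp add: q_def power_mult_distrib)
    also have "root k (norm (p 0)) ^ k = norm (p 0)" using k by simp
    finally have "norm (q t ^ k) = norm (p t)" using p0 by (simp add: norm_mult norm_divide)
    then show ?thesis by (simp add: norm_power)
  qed
  ultimately show ?thesis using that \<delta> by blast
qed

text \<open>The hypotheses say that \<open>|line_coeff k u z V|\<^sup>2 / |V|\<^sup>2\<^sup>k\<close>, restricted to the hypersurface
  \<open>\<eta> z = \<eta> z0\<close>, is maximal at \<open>(z0, X)\<close>.\<close>

lemma ricci_perp_nonpos_at_maximum:
  fixes G :: "complex^'n \<Rightarrow> complex^'n^'n"
  assumes G: "hermitian_metric_on \<Omega> G" and S: "open S" "S \<subseteq> \<Omega>" and z0: "z0 \<in> S"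
    and u: "holomorphic_fun_on u S" and \<eta>: "holomorphic_fun_on \<eta> S" and k: "0 < k" and m: "0 < m"
    and le: "\<And>z V. z \<in> S \<Longrightarrow> \<eta> z = \<eta> z0 \<Longrightarrow> (norm (line_coeff k u z V))\<^sup>2 \<le> m * Re (herm (G z) V V) ^ k"
    and X: "X \<noteq> 0" and eq: "(norm (line_coeff k u z0 X))\<^sup>2 = m * Re (herm (G z0) X X) ^ k"
    and inv: "\<And>e. fderiv \<eta> z0 e = 0 \<Longrightarrow> line_coeff k u z0 (X + e) = line_coeff k u z0 X"
  shows "Re (ricci_perp G z0 X) \<le> 0"
proof -
  have \<Omega>: "z0 \<in> \<Omega>" using z0 S by blast
  have pos: "pos_hermitian (G z)" if "z \<in> S" for z
    using hermitian_metric_onD(2)[OF G] that S by blast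
  have nonneg: "0 \<le> Re (herm (G z) V V)" if "z \<in> S" for z V
    using herm_self_pos[OF pos[OF that], of V] by (cases "V = 0") (auto simp: less_imp_le)
  note lin = holomorphic_fun_on_derivative(2)[OF \<eta> z0] holomorphic_fun_on_add_derivative[OF \<eta> z0]
  have P0: "line_coeff k u z0 X \<noteq> 0"
    using eq m herm_self_pos[OF pos[OF z0] X] by auto
  \<comment> \<open>If X were tangent to the level set, adding -X would not change the form, which
    would then equal its value 0 at the zero vector.\<close>
  have \<eta>X: "fderiv \<eta> z0 X \<noteq> 0"
  proof
    assume "fderiv \<eta> z0 X = 0"
    then have "fderiv \<eta> z0 (- 1 *s X) = 0" by (simp only: lin) simp
    from inv[OF this] have "line_coeff k u z0 0 = line_coeff k u z0 X" by (simp add: vector_smult_lneg)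
    moreover have "line_coeff k u z0 0 = 0"
      using k by (cases k) (auto simp: taylor_coeff_def)
    ultimately show False using P0 by simp
  qed
  \<comment> \<open>The form is constant on X + ker d\<eta>, and it is bounded by a multiple of the
    k-th power of the squared length with equality at X. Hence X has least length in this
    class.\<close>
  have orth: "herm (G z0) v X = 0" if v: "fderiv \<eta> z0 v = 0" for v
  proof (rule herm_orthogonal_of_min[OF pos[OF z0]])
    fix c
    have "fderiv \<eta> z0 (c *s v) = 0" using v lin by simp
    from inv[OF this] le[OF z0 refl, of "X + c *s v"] eq
    have "Re (herm (G z0) X X) ^ k \<le> Re (herm (G z0) (X + c *s v) (X + c *s v)) ^ k"
      using m by simp
    then show "Re (herm (G z0) X X) \<le> Re (herm (G z0) (X + c *s v) (X + c *s v))"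
      using k nonneg[OF z0] by (simp add: power_mono_iff)
  qed
  show ?thesis
  proof (rule ricci_perp_nonpos[where G = G and z = z0, OF pos[OF z0] X])
    fix e assume e: "herm (G z0) e X = 0"
    have \<eta>e: "fderiv \<eta> z0 e = 0"
    proof -
      \<comment> \<open>A multiple of X moves e into ker d\<eta>, which is orthogonal to X; as e is
        orthogonal to X as well, that multiple is zero.\<close>
      define \<alpha> where "\<alpha> = fderiv \<eta> z0 e / fderiv \<eta> z0 X"
      have "fderiv \<eta> z0 (e + (- \<alpha>) *s X) = 0"
        using \<eta>X by (simp only: lin) (simp add: \<alpha>_def)
      from orth[OF this] have "\<alpha> * herm (G z0) X X = 0"
        using e by (simp only: herm_add_left herm_scale_left) simp
      then have "\<alpha> = 0" using herm_self_pos[OF pos[OF z0] X] by auto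
      then show ?thesis using \<eta>X by (simp add: \<alpha>_def)
    qed
    obtain r \<sigma> where \<sigma>: "0 < r" "\<sigma> holomorphic_on ball 0 r" "\<sigma> 0 = 0" "deriv \<sigma> 0 = 0"
      "\<And>t. t \<in> ball 0 r \<Longrightarrow> z0 + t *s e + \<sigma> t *s X \<in> S"
      "\<And>t. t \<in> ball 0 r \<Longrightarrow> \<eta> (z0 + t *s e + \<sigma> t *s X) = \<eta> z0"
      using implicit_curve[OF \<eta> S(1) z0 \<eta>X \<eta>e] by blast
    let ?a = "covariant_term G z0 e X"
    define c where "c t = z0 + t *s e + \<sigma> t *s X" for t
    define V where "V t = X - t *s ?a" for t
    have dc: "(c has_derivative (\<lambda>h. h *s (e + deriv \<sigma> t *s X))) (at t)" if "t \<in> ball 0 r" for t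
    proof -
      have "(\<sigma> has_field_derivative deriv \<sigma> t) (at t)"
        using holomorphic_derivI[OF \<sigma>(2) open_ball that] by simp
      from has_derivative_add[OF has_derivative_line has_derivative_vector_scalar_mult[OF this]]
      have "((\<lambda>t. z0 + t *s e + \<sigma> t *s X) has_derivative (\<lambda>h. h *s e + h *s (deriv \<sigma> t *s X))) (at t)" .
      then show ?thesis unfolding c_def[abs_def]
        by (rule has_derivative_eq_rhs) (simp add: fun_eq_iff vec_eq_iff algebra_simps)
    qed
    have dV: "(V has_derivative (\<lambda>h. h *s (- ?a))) (at t)" for t
    proof -
      have "V = (\<lambda>t. X + t *s (- ?a))" by (simp add: V_def fun_eq_iff vec_eq_iff)
      then show ?thesis using has_derivative_line by metis
    qed
    have c0: "c 0 = z0" using \<sigma>(3) by (simp add: c_def)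
    have "\<exists>\<delta>>0. (\<lambda>t. line_coeff k u (c t) (V t)) holomorphic_on ball 0 \<delta>"
      using c0 z0 by (intro holomorphic_taylor_coeff_curve[OF u S(1) \<sigma>(1) dc dV]) auto
    then obtain d where d: "0 < d" "(\<lambda>t. line_coeff k u (c t) (V t)) holomorphic_on ball 0 d"
      by blast
    define \<delta> where "\<delta> = min d r"
    have \<delta>: "0 < \<delta>" "\<delta> \<le> r" "(\<lambda>t. line_coeff k u (c t) (V t)) holomorphic_on ball 0 \<delta>"
      using d \<sigma>(1) by (auto simp: \<delta>_def intro: holomorphic_on_subset)
    \<comment> \<open>Dividing by sqrt m and taking a k-th root q turns the bound of degree k into
      |q|^2 \<le> |V|^2 along the curve, with equality at t = 0.\<close>
    have hol: "(\<lambda>t. line_coeff k u (c t) (V t) / of_real (sqrt m)) holomorphic_on ball 0 \<delta>"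
      using m by (intro holomorphic_intros \<delta>(3)) auto
    have "line_coeff k u (c 0) (V 0) / of_real (sqrt m) \<noteq> 0" using P0 m c0 by (simp add: V_def)
    from holomorphic_kth_root[OF hol \<delta>(1) this k]
    obtain \<epsilon> q where q: "0 < \<epsilon>" "\<epsilon> \<le> \<delta>" "q holomorphic_on ball 0 \<epsilon>"
      "\<And>t. t \<in> ball 0 \<epsilon> \<Longrightarrow> norm (q t) ^ k = norm (line_coeff k u (c t) (V t) / of_real (sqrt m))"
      by blast
    have qk: "((norm (q t))\<^sup>2) ^ k = (norm (line_coeff k u (c t) (V t)))\<^sup>2 / m" if "t \<in> ball 0 \<epsilon>" for t
    proof -
      have "((norm (q t))\<^sup>2) ^ k = (norm (q t) ^ k)\<^sup>2" by (simp add: power_mult[symmetric] mult.commute)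
      then show ?thesis using q(4)[OF that] m by (simp add: norm_divide power_divide)
    qed
    show "Re (curv_form G z0 X X e e) \<le> 0"
    proof (rule curvature_nonpos_of_touching[OF G \<Omega> holomorphic_on_subset[OF \<sigma>(2)] q(1) \<sigma>(3,4) q(3)])
      show "ball 0 \<epsilon> \<subseteq> ball (0::complex) r" using q(2) \<delta>(2) by auto
      show "(norm (q t))\<^sup>2 \<le> Re (herm (G (z0 + t *s e + \<sigma> t *s X)) (X - t *s ?a) (X - t *s ?a))"
        if t: "t \<in> ball 0 \<epsilon>" for t
      proof -
        have tr: "t \<in> ball 0 r" using t q(2) \<delta>(2) by auto
        have cS: "c t \<in> S" "\<eta> (c t) = \<eta> z0" using \<sigma>(5,6)[OF tr] by (auto simp: c_def)
        have "((norm (q t))\<^sup>2) ^ k \<le> Re (herm (G (c t)) (V t) (V t)) ^ k"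
          unfolding qk[OF t] using le[OF cS, of "V t"] m by (simp add: pos_divide_le_eq mult.commute)
        then have "(norm (q t))\<^sup>2 \<le> Re (herm (G (c t)) (V t) (V t))"
          using k nonneg[OF cS(1)] by (simp add: power_mono_iff)
        then show ?thesis by (simp add: c_def V_def)
      qed
      have "((norm (q 0))\<^sup>2) ^ k = Re (herm (G z0) X X) ^ k"
        using qk[of 0] q(1) eq m c0 by (simp add: V_def)
      then show "(norm (q 0))\<^sup>2 = Re (herm (G z0) X X)"
        using k nonneg[OF z0] by (metis power_eq_imp_eq_base zero_le_power2)
    qed
  qed
qed


section \<open>The maximum principle on a manifold\<close>


lemma chartD:
  assumes "complex_manifold A" "(U, \<phi>) \<in> A"
  shows chart_open: "open U" and chart_image_open: "open (\<phi> ` U)"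
    and chart_continuous: "continuous_on U \<phi>"
    and chart_inv_continuous: "continuous_on (\<phi> ` U) (inv_into U \<phi>)"
    and chart_inv: "x \<in> U \<Longrightarrow> inv_into U \<phi> (\<phi> x) = x"
proof -
  have "open U \<and> open (\<phi> ` U) \<and> homeomorphism U (\<phi> ` U) \<phi> (inv_into U \<phi>)"
    using assms unfolding complex_manifold_def by blast
  then show "open U" "open (\<phi> ` U)" "continuous_on U \<phi>"
    "continuous_on (\<phi> ` U) (inv_into U \<phi>)" "x \<in> U \<Longrightarrow> inv_into U \<phi> (\<phi> x) = x"
    by (simp_all add: homeomorphism_def)
qed

lemma chart_image_Int_open:
  assumes A: "complex_manifold A" "(U, \<phi>) \<in> A" and T: "open T"
  shows "open (\<phi> ` (U \<inter> T))"
proof -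
  have "\<phi> ` (U \<inter> T) = \<phi> ` U \<inter> inv_into U \<phi> -` T"
    using chart_inv[OF A] by (force simp: image_iff)
  then show ?thesis
    using continuous_open_preimage[OF chart_inv_continuous[OF A] chart_image_open[OF A] T] by simp
qed

lemma chart_preimage_open:
  assumes "complex_manifold A" "(U, \<phi>) \<in> A" "open T"
  shows "open (U \<inter> \<phi> -` T)"
  using continuous_open_preimage[OF chart_continuous[OF assms(1,2)] chart_open[OF assms(1,2)] assms(3)] .

lemma chart_cover:
  assumes "complex_manifold A"
  obtains U \<phi> where "(U, \<phi>) \<in> A" "x \<in> U"
proof -
  have "x \<in> (\<Union>(U,\<phi>)\<in>A. U)" using assms unfolding complex_manifold_def by simp
  then show ?thesis using that by auto
qed

lemma holomorphic_vec_on_derivative: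
  fixes \<tau> :: "complex^'n \<Rightarrow> complex^'m"
  assumes \<tau>: "holomorphic_vec_on \<tau> S" and z: "z \<in> S"
  shows "(\<tau> has_derivative fderiv \<tau> z) (at z)"
    and "fderiv \<tau> z (c *s v) = c *s fderiv \<tau> z v"
    and "fderiv \<tau> z v $ i = fderiv (\<lambda>z. \<tau> z $ i) z v"
proof -
  define L where "L v = (\<chi> i. fderiv (\<lambda>z. \<tau> z $ i) z v)" for v
  have h: "holomorphic_fun_on (\<lambda>z. \<tau> z $ i) S" for i
    using \<tau> unfolding holomorphic_vec_on_def by blast
  have "(\<tau> has_derivative L) (at z)"
  proof (subst has_derivative_componentwise_within, rule ballI)
    fix b :: "complex^'m" assume "b \<in> Basis"
    then obtain i c where b: "b = axis i c" by (auto simp: Basis_vec_def)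
    have "((\<lambda>z. \<tau> z $ i \<bullet> c) has_derivative (\<lambda>v. fderiv (\<lambda>z. \<tau> z $ i) z v \<bullet> c)) (at z)"
      by (intro has_derivative_inner_left holomorphic_fun_on_derivative(1)[OF h z])
    then show "((\<lambda>z. \<tau> z \<bullet> b) has_derivative (\<lambda>v. L v \<bullet> b)) (at z)"
      by (simp add: b inner_axis L_def)
  qed
  then have L: "fderiv \<tau> z = L" by (rule frechet_derivative_at[symmetric])
  show "(\<tau> has_derivative fderiv \<tau> z) (at z)"
    unfolding L by fact
  show "fderiv \<tau> z (c *s v) = c *s fderiv \<tau> z v"
    by (simp add: L L_def vec_eq_iff holomorphic_fun_on_derivative(2)[OF h z])
  show "fderiv \<tau> z v $ i = fderiv (\<lambda>z. \<tau> z $ i) z v" by (simp add: L L_def)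
qed

lemma transition_holomorphic:
  assumes "complex_manifold A" "(U, \<phi>) \<in> A" "(W, \<psi>) \<in> A"
  shows "holomorphic_vec_on (\<psi> \<circ> inv_into U \<phi>) (\<phi> ` (U \<inter> W))"
  using assms unfolding complex_manifold_def by blast

abbreviation dtransition ::
  "'a set \<Rightarrow> ('a \<Rightarrow> complex^'n) \<Rightarrow> ('a \<Rightarrow> complex^'n) \<Rightarrow> 'a \<Rightarrow> complex^'n \<Rightarrow> complex^'n" where
  "dtransition U \<phi> \<psi> x \<equiv> fderiv (\<psi> \<circ> inv_into U \<phi>) (\<phi> x)"

lemma transition_derivative_nonzero:
  assumes A: "complex_manifold A" and U: "(U, \<phi>) \<in> A" and W: "(W, \<psi>) \<in> A" and x: "x \<in> U" "x \<in> W"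
    and v: "v \<noteq> 0"
  shows "dtransition U \<phi> \<psi> x v \<noteq> 0"
proof
  let ?\<tau> = "\<psi> \<circ> inv_into U \<phi>" and ?\<tau>' = "\<phi> \<circ> inv_into W \<psi>"
  assume 0: "fderiv ?\<tau> (\<phi> x) v = 0"
  have d: "(?\<tau> has_derivative fderiv ?\<tau> (\<phi> x)) (at (\<phi> x))" "(?\<tau>' has_derivative fderiv ?\<tau>' (\<psi> x)) (at (\<psi> x))"
    using holomorphic_vec_on_derivative(1)[OF transition_holomorphic[OF A U W]]
      holomorphic_vec_on_derivative(1)[OF transition_holomorphic[OF A W U]] x by blast+
  have \<tau>x: "?\<tau> (\<phi> x) = \<psi> x" using chart_inv[OF A U x(1)] by simp
  have "((\<lambda>z. ?\<tau>' (?\<tau> z)) has_derivative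
      (\<lambda>v. fderiv ?\<tau>' (\<psi> x) (fderiv ?\<tau> (\<phi> x) v))) (at (\<phi> x))"
    using has_derivative_compose[OF d(1), of ?\<tau>'] d(2) by (simp only: \<tau>x)
  moreover have "((\<lambda>z. ?\<tau>' (?\<tau> z)) has_derivative (\<lambda>v. v)) (at (\<phi> x))"
  proof (rule has_derivative_transform_within_open[OF has_derivative_ident])
    show "open (\<phi> ` (U \<inter> W))" by (rule chart_image_Int_open[OF A U chart_open[OF A W]])
    show "\<phi> x \<in> \<phi> ` (U \<inter> W)" using x by blast
    fix z assume "z \<in> \<phi> ` (U \<inter> W)"
    then show "z = ?\<tau>' (?\<tau> z)" using chart_inv[OF A U] chart_inv[OF A W] by auto
  qed
  ultimately have "(\<lambda>v. fderiv ?\<tau>' (\<psi> x) (fderiv ?\<tau> (\<phi> x) v)) = (\<lambda>v. v)"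
    by (rule has_derivative_unique)
  from fun_cong[OF this, of v]
  have "v = fderiv ?\<tau>' (\<psi> x) 0" using 0 by simp
  also have "\<dots> = 0"
    by (rule linear_0[OF has_derivative_linear[OF d(2)]])
  finally show False using v by simp
qed

section \<open>Taylor forms and their behaviour under change of chart\<close>

definition holomorphic_near ::
  "('a::topological_space set \<times> ('a \<Rightarrow> complex^'n)) set \<Rightarrow> 'a set \<Rightarrow> ('a \<Rightarrow> complex) \<Rightarrow> bool" where
  "holomorphic_near A T u \<longleftrightarrow> open T \<and>
     (\<forall>(U,\<phi>)\<in>A. holomorphic_fun_on (u \<circ> inv_into U \<phi>) (\<phi> ` (U \<inter> T)))"

text \<open>Where the lower Taylor polynomials vanish, the \<open>k\<close>-th one is a form on the tangent space
  that does not depend on the chart.\<close>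

definition taylor_form ::
  "nat \<Rightarrow> ('a \<Rightarrow> complex) \<Rightarrow> ('a set \<times> ('a \<Rightarrow> complex^'n)) \<Rightarrow> complex^'n \<Rightarrow> complex^'n \<Rightarrow> complex" where
  "taylor_form k u c z V = line_coeff k (u \<circ> inv_into (fst c) (snd c)) z V"

lemma taylor_form_limit:
  assumes A: "complex_manifold A" and U: "(U, \<phi>) \<in> A" and u: "holomorphic_near A T u"
    and x: "x \<in> U \<inter> T"
    and v: "\<And>j V. j < k \<Longrightarrow> taylor_form j u (U, \<phi>) (\<phi> x) V = 0"
    and wn: "wn \<longlonglongrightarrow> V" and sn: "sn \<longlonglongrightarrow> 0" "\<And>n. sn n \<noteq> 0"
  shows "(\<lambda>n. (u \<circ> inv_into U \<phi>) (\<phi> x + sn n *s wn n) / sn n ^ k) \<longlonglongrightarrow> taylor_form k u (U, \<phi>) (\<phi> x) V"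
  unfolding taylor_form_def fst_conv snd_conv
proof (rule taylor_coeff_line_limit[OF _ _ _ _ wn sn])
  show "open (\<phi> ` (U \<inter> T))"
    using chart_image_Int_open[OF A U] u by (simp add: holomorphic_near_def)
  show "holomorphic_fun_on (u \<circ> inv_into U \<phi>) (\<phi> ` (U \<inter> T))"
    using u U unfolding holomorphic_near_def by blast
  show "\<phi> x \<in> \<phi> ` (U \<inter> T)" using x by blast
qed (use v in \<open>auto simp: taylor_form_def\<close>)

text \<open>A nonlinear transition map carries a complex line to a curve. Its secant directions
  converge to the image of V under the differential, and the limit lemma tolerates moving
  directions, so both forms are limits of the same sequence.\<close>

lemma taylor_form_transition:
  assumes A: "complex_manifold A" and U: "(U, \<phi>) \<in> A" and W: "(W, \<psi>) \<in> A"
    and u: "holomorphic_near A T u" and x: "x \<in> U" "x \<in> W" "x \<in> T"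
    and v: "\<And>j V. j < k \<Longrightarrow> taylor_form j u (U, \<phi>) (\<phi> x) V = 0"
           "\<And>j V. j < k \<Longrightarrow> taylor_form j u (W, \<psi>) (\<psi> x) V = 0"
  shows "taylor_form k u (U, \<phi>) (\<phi> x) V =
         taylor_form k u (W, \<psi>) (\<psi> x) (dtransition U \<phi> \<psi> x V)"
proof -
  let ?\<tau> = "\<psi> \<circ> inv_into U \<phi>"
  define sn where "sn n = inverse (complex_of_nat (Suc n))" for n
  have sn: "sn \<longlonglongrightarrow> 0"
    unfolding sn_def[abs_def] by (rule LIMSEQ_Suc[OF lim_inverse_n])
  have sn0: "sn n \<noteq> 0" for n by (simp add: sn_def del: of_nat_Suc)
  define zn where "zn n = \<phi> x + sn n *s V" for n
  \<comment> \<open>The secant direction, chosen so that moving from \<open>\<psi> x\<close> by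
    \<open>sn n *s wn n\<close> reaches exactly the image of \<open>zn n\<close>.\<close>
  define wn where "wn n = inverse (sn n) *s (?\<tau> (zn n) - \<psi> x)" for n
  have \<tau>x: "?\<tau> (\<phi> x) = \<psi> x" using chart_inv[OF A U x(1)] by simp
  have zn: "zn \<longlonglongrightarrow> \<phi> x"
    unfolding zn_def[abs_def] by (rule tendsto_eq_intros refl sn)+ simp
  have o: "open (\<phi> ` (U \<inter> W))" by (rule chart_image_Int_open[OF A U chart_open[OF A W]])
  have \<phi>x: "\<phi> x \<in> \<phi> ` (U \<inter> W)" using x by blast
  have ev: "\<forall>\<^sub>F n in sequentially. zn n \<in> \<phi> ` (U \<inter> W)"
    by (rule topological_tendstoD[OF zn o \<phi>x])
  have wn: "wn \<longlonglongrightarrow> fderiv ?\<tau> (\<phi> x) V"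
  proof (rule vec_tendstoI)
    fix i
    have "holomorphic_fun_on (\<lambda>z. ?\<tau> z $ i) (\<phi> ` (U \<inter> W))"
      using transition_holomorphic[OF A U W] by (simp add: holomorphic_vec_on_def)
    from holomorphic_fun_on_curve[OF this has_derivative_line, of "\<phi> x" 0 V] \<phi>x
    have "((\<lambda>h. (?\<tau> (\<phi> x + h *s V) $ i - \<psi> x $ i) / h) \<longlongrightarrow> fderiv ?\<tau> (\<phi> x) V $ i) (at 0)"
      unfolding holomorphic_vec_on_derivative(3)[OF transition_holomorphic[OF A U W] \<phi>x]
      by (simp add: DERIV_def \<tau>x[simplified])
    moreover have "filterlim sn (at 0) sequentially" by (rule filterlim_atI[OF sn]) (simp add: sn0)
    ultimately have "(\<lambda>n. (?\<tau> (zn n) $ i - \<psi> x $ i) / sn n) \<longlonglongrightarrow> fderiv ?\<tau> (\<phi> x) V $ i"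
      unfolding zn_def by (rule filterlim_compose)
    then show "(\<lambda>n. wn n $ i) \<longlonglongrightarrow> fderiv ?\<tau> (\<phi> x) V $ i"
      by (simp add: wn_def divide_inverse mult.commute right_diff_distrib)
  qed
  have "(\<lambda>n. (u \<circ> inv_into W \<psi>) (\<psi> x + sn n *s wn n) / sn n ^ k) \<longlonglongrightarrow>
        taylor_form k u (W, \<psi>) (\<psi> x) (fderiv ?\<tau> (\<phi> x) V)"
    by (rule taylor_form_limit[OF A W u _ v(2) wn sn sn0]) (use x in auto)
  moreover have "\<forall>\<^sub>F n in sequentially. (u \<circ> inv_into W \<psi>) (\<psi> x + sn n *s wn n) / sn n ^ k =
      (u \<circ> inv_into U \<phi>) (\<phi> x + sn n *s V) / sn n ^ k"
    using ev
  proof eventually_elim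
    case (elim n)
    have "sn n *s wn n = ?\<tau> (zn n) - \<psi> x" using sn0[of n] by (simp add: wn_def vector_smult_assoc)
    then have "\<psi> x + sn n *s wn n = ?\<tau> (zn n)" by simp
    moreover have "inv_into W \<psi> (?\<tau> (zn n)) = inv_into U \<phi> (zn n)"
      using elim chart_inv[OF A U] chart_inv[OF A W] by auto
    ultimately show ?case by (simp add: zn_def)
  qed
  ultimately have "(\<lambda>n. (u \<circ> inv_into U \<phi>) (\<phi> x + sn n *s V) / sn n ^ k) \<longlonglongrightarrow>
        taylor_form k u (W, \<psi>) (\<psi> x) (fderiv ?\<tau> (\<phi> x) V)"
    by (rule Lim_transform_eventually)
  moreover have l2: "(\<lambda>n. (u \<circ> inv_into U \<phi>) (\<phi> x + sn n *s V) / sn n ^ k) \<longlonglongrightarrow> taylor_form k u (U, \<phi>) (\<phi> x) V"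
    by (rule taylor_form_limit[OF A U u _ v(1) tendsto_const sn sn0]) (use x in auto)
  ultimately show ?thesis by (intro LIMSEQ_unique[OF l2])
qed


section \<open>Maximizing over tangent directions at the points of a compact set\<close>

text \<open>Expresses compactness of the projectivized tangent bundle over D. Homogeneity reduces to
  unit vectors in a chart, finitely many closed coordinate balls cover D, and invariance under
  transition maps makes their maxima comparable.\<close>

lemma exists_maximal_direction:
  fixes A :: "('a::{t2_space,second_countable_topology} set \<times> ('a \<Rightarrow> complex^'n)) set"
    and Q :: "'a set \<times> ('a \<Rightarrow> complex^'n) \<Rightarrow> complex^'n \<Rightarrow> complex^'n \<Rightarrow> real"
  assumes A: "complex_manifold A" and D: "compact D" "D \<noteq> {}"
    and cont: "\<And>U \<phi>. (U, \<phi>) \<in> A \<Longrightarrow>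
       continuous_on (\<phi> ` (U \<inter> D) \<times> (- {0})) (\<lambda>p. Q (U, \<phi>) (fst p) (snd p))"
    and homog: "\<And>U \<phi> x c V. (U, \<phi>) \<in> A \<Longrightarrow> x \<in> U \<inter> D \<Longrightarrow> c \<noteq> 0 \<Longrightarrow>
       Q (U, \<phi>) (\<phi> x) (c *s V) = Q (U, \<phi>) (\<phi> x) V"
    and inv: "\<And>U \<phi> W \<psi> x V. (U, \<phi>) \<in> A \<Longrightarrow> (W, \<psi>) \<in> A \<Longrightarrow> x \<in> U \<inter> W \<inter> D \<Longrightarrow>
       Q (U, \<phi>) (\<phi> x) V = Q (W, \<psi>) (\<psi> x) (dtransition U \<phi> \<psi> x V)"
  obtains U \<phi> x X where "(U, \<phi>) \<in> A" "x \<in> U \<inter> D" "X \<noteq> 0"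
    "\<And>W \<psi> y V. (W, \<psi>) \<in> A \<Longrightarrow> y \<in> W \<inter> D \<Longrightarrow> V \<noteq> 0 \<Longrightarrow> Q (W, \<psi>) (\<psi> y) V \<le> Q (U, \<phi>) (\<phi> x) X"
proof -
  have clD: "closed D" using D(1) by (rule compact_imp_closed)
  \<comment> \<open>On the neighbourhood \<open>O'\<close> of x the function is dominated by a value
    attained in the same chart. The point of attainment may lie outside \<open>O'\<close>, since the
    maximum is taken over a closed ball and \<open>O'\<close> comes from the open one.\<close>
  define R where "R x c O' z0 X0 \<longleftrightarrow> c \<in> A \<and> open O' \<and> x \<in> O' \<and> O' \<subseteq> fst c \<and>
      z0 \<in> snd c ` (fst c \<inter> D) \<and> X0 \<noteq> 0 \<and>
        (\<forall>y\<in>O' \<inter> D. \<forall>V. V \<noteq> 0 \<longrightarrow> Q c (snd c y) V \<le> Q c z0 X0)" for x c O' z0 X0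
  have "\<exists>c O' z0 X0. R x c O' z0 X0" if x: "x \<in> D" for x
  proof -
    obtain U \<phi> where U: "(U, \<phi>) \<in> A" "x \<in> U" using chart_cover[OF A] by blast
    obtain r where r: "0 < r" "cball (\<phi> x) r \<subseteq> \<phi> ` U"
      using chart_image_open[OF A U(1)] U(2) open_contains_cball by blast
    have K: "compact (inv_into U \<phi> ` cball (\<phi> x) r \<inter> D)"
      using continuous_on_subset[OF chart_inv_continuous[OF A U(1)] r(2)]
      by (intro compact_Int_closed compact_continuous_image compact_cball clD)
    have KU: "inv_into U \<phi> ` cball (\<phi> x) r \<subseteq> U"
      using r(2) inv_into_into[of _ \<phi> U] by blast
    define C where "C = \<phi> ` (inv_into U \<phi> ` cball (\<phi> x) r \<inter> D) \<times> sphere (0 :: complex^'n) 1"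
    have cC: "compact C"
      unfolding C_def using KU
      by (intro compact_Times compact_continuous_image K continuous_on_subset[OF chart_continuous[OF A U(1)]] compact_sphere) auto
    have "x \<in> inv_into U \<phi> ` cball (\<phi> x) r"
      using chart_inv[OF A U(1,2)] r(1) by (intro image_eqI[of _ _ "\<phi> x"]) auto
    then have neC: "C \<noteq> {}" using x by (auto simp: C_def)
    have contC: "continuous_on C (\<lambda>p. Q (U, \<phi>) (fst p) (snd p))"
      by (rule continuous_on_subset[OF cont[OF U(1)]]) (use KU in \<open>auto simp: C_def\<close>)
    obtain p where p: "p \<in> C" "\<And>q. q \<in> C \<Longrightarrow> Q (U, \<phi>) (fst q) (snd q) \<le> Q (U, \<phi>) (fst p) (snd p)"
      using continuous_attains_sup[OF cC neC contC] by blast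
    define O' where "O' = U \<inter> \<phi> -` ball (\<phi> x) r"
    have O'1: "open O'"
      unfolding O'_def by (rule chart_preimage_open[OF A U(1) open_ball])
    have O'2: "x \<in> O'" "O' \<subseteq> U" using U(2) r(1) by (auto simp: O'_def)
    have p': "fst p \<in> \<phi> ` (U \<inter> D)" "snd p \<noteq> 0" using p(1) KU by (auto simp: C_def)
    have Q': "Q (U, \<phi>) (\<phi> y) V \<le> Q (U, \<phi>) (fst p) (snd p)" if y: "y \<in> O' \<inter> D" and V: "V \<noteq> 0" for y V
    proof -
      have yU: "y \<in> U" using y by (simp add: O'_def)
      have "\<phi> y \<in> cball (\<phi> x) r" using y by (simp add: O'_def)
      then have "y \<in> inv_into U \<phi> ` cball (\<phi> x) r"
        using chart_inv[OF A U(1) yU] by (intro image_eqI[of _ _ "\<phi> y"]) auto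
      then have "(\<phi> y, of_real (1 / norm V) *s V) \<in> C"
        using y V by (auto simp: C_def norm_vector_scalar_mult norm_divide)
      from p(2)[OF this] have "Q (U, \<phi>) (\<phi> y) (of_real (1 / norm V) *s V) \<le> Q (U, \<phi>) (fst p) (snd p)" by simp
      then show ?thesis using homog[OF U(1), of y "of_real (1 / norm V)" V] y yU V by simp
    qed
    have "R x (U, \<phi>) O' (fst p) (snd p)"
      unfolding R_def using U(1) O'1 O'2 p' Q' by simp
    then show ?thesis by blast
  qed
  then obtain c O' z0 X0 where R: "\<And>x. x \<in> D \<Longrightarrow> R x (c x) (O' x) (z0 x) (X0 x)"
    by metis
  have *: "c x \<in> A" "open (O' x)" "x \<in> O' x" "O' x \<subseteq> fst (c x)"
    "z0 x \<in> snd (c x) ` (fst (c x) \<inter> D)" "X0 x \<noteq> 0"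
    "y \<in> O' x \<inter> D \<Longrightarrow> V \<noteq> 0 \<Longrightarrow> Q (c x) (snd (c x) y) V \<le> Q (c x) (z0 x) (X0 x)"
    if "x \<in> D" for x y V
    using R[OF that] unfolding R_def by blast+
  obtain F where F: "F \<subseteq> D" "finite F" "D \<subseteq> (\<Union>x\<in>F. O' x)"
    using compactE_image[OF D(1), of D O'] *(2,3) by blast
  have "F \<noteq> {}" using F(3) D(2) by auto
  let ?q = "\<lambda>x. Q (c x) (z0 x) (X0 x)"
  have "finite (?q ` F)" "?q ` F \<noteq> {}" using F(2) \<open>F \<noteq> {}\<close> by auto
  then have "Max (?q ` F) \<in> ?q ` F" by (rule Max_in)
  then obtain x1 where x1: "x1 \<in> F" "Max (?q ` F) = ?q x1" by blast
  have max: "?q x \<le> ?q x1" if "x \<in> F" for x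
    using Max_ge[OF \<open>finite (?q ` F)\<close>] that x1(2) by auto
  obtain U \<phi> where U: "c x1 = (U, \<phi>)" by (cases "c x1")
  have x1D: "x1 \<in> D" using x1(1) F(1) by blast
  obtain x where x: "z0 x1 = \<phi> x" "x \<in> U \<inter> D" using *(5)[OF x1D] U by auto
  show ?thesis
  proof (rule that)
    show UA: "(U, \<phi>) \<in> A" using *(1)[OF x1D] U by simp
    show "x \<in> U \<inter> D" "X0 x1 \<noteq> 0" using x *(6)[OF x1D] by auto
    fix W \<psi> y and V :: "complex^'n"
    assume W: "(W, \<psi>) \<in> A" and y: "y \<in> W \<inter> D" and V: "V \<noteq> 0"
    obtain x2 where x2: "x2 \<in> F" "y \<in> O' x2" using F(3) y by blast
    have x2D: "x2 \<in> D" using x2(1) F(1) by blast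
    obtain U2 \<phi>2 where U2: "c x2 = (U2, \<phi>2)" by (cases "c x2")
    have U2A: "(U2, \<phi>2) \<in> A" using *(1)[OF x2D] U2 by simp
    have yU2: "y \<in> U2" using *(4)[OF x2D] x2(2) U2 by auto
    let ?V = "fderiv (\<phi>2 \<circ> inv_into W \<psi>) (\<psi> y) V"
    have "?V \<noteq> 0" using transition_derivative_nonzero[OF A W U2A _ yU2 V] y by blast
    then have "Q (U2, \<phi>2) (\<phi>2 y) ?V \<le> ?q x2"
      using *(7)[OF x2D, of y ?V] x2(2) y U2 by simp
    also have "\<dots> \<le> ?q x1" by (rule max[OF x2(1)])
    finally show "Q (W, \<psi>) (\<psi> y) V \<le> Q (U, \<phi>) (\<phi> x) (X0 x1)"
      using inv[OF W U2A, of y V] y yU2 x U by simp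
  qed
qed

lemma kaehler_metric_chart:
  assumes A: "complex_manifold A" and g: "kaehler_metric A g" and U: "(U, \<phi>) \<in> A"
  shows "hermitian_metric_on (\<phi> ` U) (g (U, \<phi>))"
proof -
  note * = conjunct2[OF g[unfolded kaehler_metric_def], THEN bspec, OF U, unfolded prod.case]
  have ck: "ck_on (Suc (Suc 0)) (\<lambda>z. g (U,\<phi>) z $ i $ j) (\<phi> ` U)" for i j
    using * by blast
  have "pos_hermitian (g (U, \<phi>) z)" if "z \<in> \<phi> ` U" for z
    using * that unfolding pos_hermitian_def by blast
  then show ?thesis
    unfolding hermitian_metric_on_def
    using chart_image_open[OF A U] ck by (simp only: ck_on.simps) blast
qed

lemma kaehler_metric_transition:
  assumes A: "complex_manifold A" and g: "kaehler_metric A g" and U: "(U, \<phi>) \<in> A" and W: "(W, \<psi>) \<in> A"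
    and x: "x \<in> U" "x \<in> W"
  shows "herm (g (U, \<phi>) (\<phi> x)) v w = herm (g (W, \<psi>) (\<psi> x))
    (dtransition U \<phi> \<psi> x v)
    (dtransition U \<phi> \<psi> x w)"
proof -
  have "\<phi> x \<in> \<phi> ` (U \<inter> W)" using x by blast
  note conjunct1[OF g[unfolded kaehler_metric_def], THEN bspec, OF U, unfolded prod.case,
      THEN bspec, OF W, unfolded prod.case, THEN bspec, OF this]
  then show ?thesis unfolding chart_inv[OF A U x(1)] by blast
qed

lemma taylor_form_scale:
  assumes A: "complex_manifold A" and U: "(U, \<phi>) \<in> A" and u: "holomorphic_near A T u"
    and x: "x \<in> U \<inter> T"
  shows "taylor_form k u (U, \<phi>) (\<phi> x) (c *s V) = c ^ k * taylor_form k u (U, \<phi>) (\<phi> x) V"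
proof -
  let ?u = "u \<circ> inv_into U \<phi>"
  define N where "N = (\<lambda>s. \<phi> x + s *s V) -` (\<phi> ` (U \<inter> T))"
  have oS: "open (\<phi> ` (U \<inter> T))"
    using chart_image_Int_open[OF A U] u by (simp add: holomorphic_near_def)
  have h: "holomorphic_fun_on ?u (\<phi> ` (U \<inter> T))"
    using u U unfolding holomorphic_near_def by blast
  have N: "open N" unfolding N_def by (rule open_vimage[OF oS]) (intro continuous_intros)
  have M: "open ((\<lambda>s. c * s) -` N)" by (rule open_vimage[OF N]) (intro continuous_intros)
  have "0 \<in> N" using x by (simp add: N_def)
  have "(deriv ^^ k) (\<lambda>s. ?u (\<phi> x + (c * s) *s V)) 0 = c ^ k * (deriv ^^ k) (\<lambda>s. ?u (\<phi> x + s *s V)) (c * 0)"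
    by (rule higher_deriv_compose_linear[where f = "\<lambda>s. ?u (\<phi> x + s *s V)", OF holomorphic_on_line[OF h N] M N])
       (use \<open>0 \<in> N\<close> in \<open>auto simp: N_def\<close>)
  then show ?thesis
    by (simp add: taylor_form_def taylor_coeff_def vector_smult_assoc mult.commute)
qed

lemma continuous_on_taylor_form:
  assumes A: "complex_manifold A" and U: "(U, \<phi>) \<in> A" and u: "holomorphic_near A T u"
  shows "continuous_on (\<phi> ` (U \<inter> T) \<times> N) (\<lambda>p. taylor_form k u (U, \<phi>) (fst p) (snd p))"
proof -
  have "isCont (\<lambda>p. taylor_form k u (U, \<phi>) (fst p) (snd p)) p" if "p \<in> \<phi> ` (U \<inter> T) \<times> N" for p
    using continuous_at_taylor_coeff_line[of "u \<circ> inv_into U \<phi>" "\<phi> ` (U \<inter> T)" "fst p" "snd p" k]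
      chart_image_Int_open[OF A U] u U that
    unfolding holomorphic_near_def taylor_form_def by auto
  then show ?thesis by (simp add: continuous_at_imp_continuous_on)
qed

text \<open>The local data shared by both applications: the level set of \<eta> through x lies in D,
  \<rho> is constant on it, and the form depends on the direction only modulo ker d\<eta>. For maps
  onto a curve \<eta> is a coordinate of the map, for a contracted hypersurface it is the defining
  equation.\<close>

definition taylor_level_chart ::
  "'a::topological_space set \<Rightarrow> 'a set \<Rightarrow> ('a \<Rightarrow> real) \<Rightarrow> nat \<Rightarrow> ('a \<Rightarrow> complex) \<Rightarrow> 'a \<Rightarrow>
   'a set \<Rightarrow> ('a \<Rightarrow> complex^'n) \<Rightarrow> 'a set \<Rightarrow> (complex^'n \<Rightarrow> complex) \<Rightarrow> bool" where
  "taylor_level_chart T D \<rho> k u x U \<phi> W \<eta> \<longleftrightarrow> open W \<and> x \<in> W \<and> W \<subseteq> U \<inter> T \<and>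
     holomorphic_fun_on \<eta> (\<phi> ` W) \<and> (\<forall>y\<in>W. \<eta> (\<phi> y) = \<eta> (\<phi> x) \<longrightarrow> y \<in> D \<and> \<rho> y = \<rho> x) \<and>
     (\<forall>X e. fderiv \<eta> (\<phi> x) e = 0 \<longrightarrow>
        taylor_form k u (U, \<phi>) (\<phi> x) (X + e) = taylor_form k u (U, \<phi>) (\<phi> x) X)"

text \<open>The weight \<rho> lets D have a boundary: in the curve case it vanishes on the rim and
  pushes the maximum into the interior, while for a hypersurface it is constantly 1. Positivity at a
  single point is enough to make the maximum positive.\<close>

lemma no_normalized_taylor_form:
  fixes A :: "('a::{t2_space,second_countable_topology} set \<times> ('a \<Rightarrow> complex^'n)) set"
  assumes A: "complex_manifold A" and g: "kaehler_metric A g" and ric: "ricci_perp_positive A g"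
    and D: "compact D" "D \<subseteq> T" and u: "holomorphic_near A T u" and k: "0 < k"
    and inv: "\<And>U \<phi> W \<psi> x V. (U, \<phi>) \<in> A \<Longrightarrow> (W, \<psi>) \<in> A \<Longrightarrow> x \<in> U \<inter> W \<inter> D \<Longrightarrow>
       taylor_form k u (U, \<phi>) (\<phi> x) V =
       taylor_form k u (W, \<psi>) (\<psi> x) (dtransition U \<phi> \<psi> x V)"
    and \<rho>: "continuous_on D \<rho>" "\<And>x. x \<in> D \<Longrightarrow> (0::real) \<le> \<rho> x"
    and local: "\<And>x. x \<in> D \<Longrightarrow> 0 < \<rho> x \<Longrightarrow>
       \<exists>U \<phi> W \<eta>. (U, \<phi>) \<in> A \<and> taylor_level_chart T D \<rho> k u x U \<phi> W \<eta>"
    and U1: "(U1, \<phi>1) \<in> A" "x1 \<in> U1 \<inter> D" "0 < \<rho> x1" "taylor_form k u (U1, \<phi>1) (\<phi>1 x1) V1 \<noteq> 0"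
  shows False
proof -
  define Q where "Q c z V = \<rho> (inv_into (fst c) (snd c) z) * (norm (taylor_form k u c z V))\<^sup>2 / Re (herm (g c z) V V) ^ k"
    for c :: "'a set \<times> ('a \<Rightarrow> complex^'n)" and z V
  note metric = kaehler_metric_chart[OF A g]
  have pos: "0 < Re (herm (g (U, \<phi>) (\<phi> x)) V V)" if "(U, \<phi>) \<in> A" "x \<in> U" "V \<noteq> 0" for U \<phi> x V
    using herm_self_pos[OF hermitian_metric_onD(2)[OF metric[OF that(1)]]] that by blast
  have Q: "Q (U, \<phi>) (\<phi> x) V = \<rho> x * (norm (taylor_form k u (U, \<phi>) (\<phi> x) V))\<^sup>2 / Re (herm (g (U, \<phi>) (\<phi> x)) V V) ^ k"
    if "(U, \<phi>) \<in> A" "x \<in> U" for U \<phi> x V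
    using chart_inv[OF A that] by (simp add: Q_def)
  have form0: "taylor_form k u c z 0 = 0" for c :: "'a set \<times> ('a \<Rightarrow> complex^'n)" and z
    using k by (cases k) (auto simp: taylor_form_def taylor_coeff_def)
  have "D \<noteq> {}" using U1(2) by blast
  have Qinv: "Q (U, \<phi>) (\<phi> x) V = Q (W, \<psi>) (\<psi> x) (dtransition U \<phi> \<psi> x V)"
    if "(U, \<phi>) \<in> A" "(W, \<psi>) \<in> A" "x \<in> U \<inter> W \<inter> D" for U \<phi> W \<psi> x V
    using that inv[OF that, of V] kaehler_metric_transition[OF A g that(1,2), of x V V] by (simp add: Q)
  obtain U \<phi> x X where max: "(U, \<phi>) \<in> A" "x \<in> U \<inter> D" "X \<noteq> 0"
    "\<And>W \<psi> y V. (W, \<psi>) \<in> A \<Longrightarrow> y \<in> W \<inter> D \<Longrightarrow> V \<noteq> 0 \<Longrightarrow> Q (W, \<psi>) (\<psi> y) V \<le> Q (U, \<phi>) (\<phi> x) X"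
  proof (rule exists_maximal_direction[OF A D(1) \<open>D \<noteq> {}\<close> _ _ Qinv])
    fix U \<phi> assume U: "(U, \<phi>) \<in> A"
    let ?S = "\<phi> ` (U \<inter> D) \<times> (- {0 :: complex^'n})"
    have cT: "continuous_on ?S (\<lambda>p. taylor_form k u (U, \<phi>) (fst p) (snd p))"
      by (rule continuous_on_subset[OF continuous_on_taylor_form[OF A U u, of UNIV]]) (use D(2) in auto)
    have cI: "continuous_on (\<phi> ` (U \<inter> D)) (\<lambda>z. \<rho> (inv_into U \<phi> z))"
      by (rule continuous_on_compose2[OF \<rho>(1) continuous_on_subset[OF chart_inv_continuous[OF A U]]])
         (use chart_inv[OF A U] in auto)
    have c\<rho>: "continuous_on ?S (\<lambda>p. \<rho> (inv_into U \<phi> (fst p)))"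
      by (rule continuous_on_compose2[OF cI]) (auto intro!: continuous_intros)
    have cG: "continuous_on (\<phi> ` U) (\<lambda>z. g (U, \<phi>) z $ i $ j)" for i j
      by (intro continuous_at_imp_continuous_on ballI differentiable_imp_continuous_within
            hermitian_metric_onD(3)[OF metric[OF U]])
    have cG': "continuous_on ?S (\<lambda>p. g (U, \<phi>) (fst p) $ i $ j)" for i j
      by (rule continuous_on_compose2[OF cG]) (auto intro!: continuous_intros)
    have cH: "continuous_on ?S (\<lambda>p. Re (herm (g (U, \<phi>) (fst p)) (snd p) (snd p)))"
      unfolding herm_def by (intro continuous_intros cG')
    have "Re (herm (g (U, \<phi>) (fst p)) (snd p) (snd p)) ^ k \<noteq> 0" if "p \<in> ?S" for p
    proof -
      have "fst p \<in> \<phi> ` (U \<inter> D)" "snd p \<noteq> 0" using that by (simp_all add: mem_Times_iff)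
      then obtain y where "y \<in> U" "fst p = \<phi> y" "snd p \<noteq> 0" by blast
      then show ?thesis using pos[OF U, of y "snd p"] by simp
    qed
    then show "continuous_on ?S (\<lambda>p. Q (U, \<phi>) (fst p) (snd p))"
      unfolding Q_def fst_conv snd_conv
      by (intro continuous_on_divide continuous_on_mult continuous_on_power continuous_on_norm cH c\<rho> cT) blast
  next
    fix U \<phi> x V and c :: complex assume *: "(U, \<phi>) \<in> A" "x \<in> U \<inter> D" "c \<noteq> 0"
    have "Re (herm (g (U, \<phi>) (\<phi> x)) (c *s V) (c *s V)) = (norm c)\<^sup>2 * Re (herm (g (U, \<phi>) (\<phi> x)) V V)"
    proof -
      have "herm (g (U, \<phi>) (\<phi> x)) (c *s V) (c *s V) = of_real ((norm c)\<^sup>2) * herm (g (U, \<phi>) (\<phi> x)) V V"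
        unfolding complex_norm_square by (simp add: herm_scale_left herm_scale_right mult.assoc)
      then show ?thesis by simp
    qed
    moreover have "taylor_form k u (U, \<phi>) (\<phi> x) (c *s V) = c ^ k * taylor_form k u (U, \<phi>) (\<phi> x) V"
      by (rule taylor_form_scale[OF A *(1) u]) (use * D(2) in blast)
    moreover have "((norm c)\<^sup>2) ^ k = (norm c ^ k)\<^sup>2" by (simp add: power_mult[symmetric] mult.commute)
    ultimately show "Q (U, \<phi>) (\<phi> x) (c *s V) = Q (U, \<phi>) (\<phi> x) V"
      using * by (simp add: Q norm_mult norm_power power_mult_distrib)
  qed blast+
  have xD: "x \<in> D" using max(2) by blast
  have "V1 \<noteq> 0" using U1(4) form0 by metis
  then have "0 < Q (U1, \<phi>1) (\<phi>1 x1) V1"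
    using U1 pos[OF U1(1)] by (simp add: Q)
  also have "\<dots> \<le> Q (U, \<phi>) (\<phi> x) X" by (rule max(4)) (use U1 \<open>V1 \<noteq> 0\<close> in auto)
  finally have Qpos: "0 < Q (U, \<phi>) (\<phi> x) X" .
  \<comment> \<open>Q carries the factor \<rho>, so a positive maximum avoids the points for which
    \<open>local\<close> provides no level chart.\<close>
  then have "\<rho> x \<noteq> 0" using max(1,2) by (auto simp: Q)
  then have \<rho>x: "0 < \<rho> x" using \<rho>(2)[OF xD] by simp
  from local[OF xD \<rho>x] obtain U' \<phi>' W \<eta> where l: "(U', \<phi>') \<in> A" "open W" "x \<in> W" "W \<subseteq> U' \<inter> T"
    "holomorphic_fun_on \<eta> (\<phi>' ` W)" "\<And>y. y \<in> W \<Longrightarrow> \<eta> (\<phi>' y) = \<eta> (\<phi>' x) \<Longrightarrow> y \<in> D \<and> \<rho> y = \<rho> x"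
    "\<And>X e. fderiv \<eta> (\<phi>' x) e = 0 \<Longrightarrow>
          taylor_form k u (U', \<phi>') (\<phi>' x) (X + e) = taylor_form k u (U', \<phi>') (\<phi>' x) X"
    unfolding taylor_level_chart_def by blast
  \<comment> \<open>The level chart need not be the chart in which the maximum was found, so the
    maximizing vector is transported; Q does not change.\<close>
  define X' where "X' = fderiv (\<phi>' \<circ> inv_into U \<phi>) (\<phi> x) X"
  have xU': "x \<in> U'" using l by blast
  have X': "X' \<noteq> 0" unfolding X'_def
    by (rule transition_derivative_nonzero[OF A max(1) l(1) _ xU' max(3)]) (use max in blast)
  have QX': "Q (U, \<phi>) (\<phi> x) X = Q (U', \<phi>') (\<phi>' x) X'"
    unfolding X'_def by (rule Qinv[OF max(1) l(1)]) (use max xU' in blast)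
  \<comment> \<open>On the level set the weight equals \<open>\<rho> x\<close>; dividing it out
    leaves the maximum of |form|^2 / |V|^(2k) there.\<close>
  define m where "m = Q (U, \<phi>) (\<phi> x) X / \<rho> x"
  have "Re (ricci_perp (g (U', \<phi>')) (\<phi>' x) X') \<le> 0"
  proof (rule ricci_perp_nonpos_at_maximum[where \<Omega> = "\<phi>' ` U'" and S = "\<phi>' ` W" and k = k and m = m
        and u = "u \<circ> inv_into U' \<phi>'" and \<eta> = \<eta>, OF metric[OF l(1)]])
    have W: "W = U' \<inter> W" using l(4) by blast
    show "open (\<phi>' ` W)" using chart_image_Int_open[OF A l(1,2)] W by simp
    show "\<phi>' ` W \<subseteq> \<phi>' ` U'" "\<phi>' x \<in> \<phi>' ` W" using l(3,4) by auto
    have "holomorphic_fun_on (u \<circ> inv_into U' \<phi>') (\<phi>' ` (U' \<inter> T))"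
      using u l(1) unfolding holomorphic_near_def by blast
    then show "holomorphic_fun_on (u \<circ> inv_into U' \<phi>') (\<phi>' ` W)"
      by (rule holomorphic_fun_on_subset) (use l(4) in blast)
    show "holomorphic_fun_on \<eta> (\<phi>' ` W)" "0 < k" "X' \<noteq> 0" by fact+
    show "0 < m" using Qpos \<rho>x by (simp add: m_def)
    show "(norm (line_coeff k (u \<circ> inv_into U' \<phi>') z V))\<^sup>2 \<le> m * Re (herm (g (U', \<phi>') z) V V) ^ k"
      if z: "z \<in> \<phi>' ` W" "\<eta> z = \<eta> (\<phi>' x)" for z V
    proof -
      obtain y where y: "z = \<phi>' y" "y \<in> W" using z(1) by blast
      have yD: "y \<in> D" "\<rho> y = \<rho> x" using l(6)[OF y(2)] z(2) y(1) by auto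
      have yU': "y \<in> U'" using y(2) l(4) by blast
      have "(norm (taylor_form k u (U', \<phi>') z V))\<^sup>2 \<le> m * Re (herm (g (U', \<phi>') z) V V) ^ k"
      proof (cases "V = 0")
        case True
        then show ?thesis using k by (simp add: form0 zero_power)
      next
        case False
        from max(4)[OF l(1) _ False, of y] yD yU'
        have "\<rho> x * (norm (taylor_form k u (U', \<phi>') z V))\<^sup>2 / Re (herm (g (U', \<phi>') z) V V) ^ k \<le> m * \<rho> x"
          using \<rho>x by (simp add: Q[OF l(1) yU'] m_def y(1))
        moreover have "0 < Re (herm (g (U', \<phi>') z) V V) ^ k"
          using pos[OF l(1) yU' False] y(1) by simp
        ultimately have "\<rho> x * (norm (taylor_form k u (U', \<phi>') z V))\<^sup>2 \<le> \<rho> x * (m * Re (herm (g (U', \<phi>') z) V V) ^ k)"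
          by (simp add: pos_divide_le_eq mult_ac)
        then show ?thesis using \<rho>x by simp
      qed
      then show ?thesis by (simp add: taylor_form_def)
    qed
    show "(norm (line_coeff k (u \<circ> inv_into U' \<phi>') (\<phi>' x) X'))\<^sup>2 = m * Re (herm (g (U', \<phi>') (\<phi>' x)) X' X') ^ k"
    proof -
      have "0 < Re (herm (g (U', \<phi>') (\<phi>' x)) X' X')" by (rule pos[OF l(1) xU' X'])
      then show ?thesis
        using \<rho>x by (simp add: m_def QX' Q[OF l(1) xU'] taylor_form_def)
    qed
    show "line_coeff k (u \<circ> inv_into U' \<phi>') (\<phi>' x) (X' + e) =
          line_coeff k (u \<circ> inv_into U' \<phi>') (\<phi>' x) X'"
      if "fderiv \<eta> (\<phi>' x) e = 0" for e
      using l(7)[OF that] by (simp add: taylor_form_def)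
  qed
  moreover have "0 < Re (ricci_perp (g (U', \<phi>')) (\<phi>' x) X')"
  proof -
    have "\<forall>z\<in>\<phi>' ` U'. \<forall>X. X \<noteq> 0 \<longrightarrow> 0 < Re (ricci_perp (g (U', \<phi>')) z X)"
      using ric l(1) unfolding ricci_perp_positive_def by blast
    then show ?thesis using X' xU' by blast
  qed
  ultimately show False by simp
qed


section \<open>Maps onto curves\<close>


lemma taylor_form_Suc_0:
  assumes "(U, \<phi>) \<in> A" "holomorphic_near A T u" "z \<in> \<phi> ` (U \<inter> T)"
  shows "taylor_form (Suc 0) u (U, \<phi>) z V = fderiv (u \<circ> inv_into U \<phi>) z V"
  using frechet_derivative_eq_taylor_coeff[of "u \<circ> inv_into U \<phi>" "\<phi> ` (U \<inter> T)" z V] assms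
  unfolding holomorphic_near_def taylor_form_def by auto

lemma holomorphic_near_shift:
  assumes "holomorphic_near A T u"
  shows "holomorphic_near A T (\<lambda>y. u y - c)"
  using assms unfolding holomorphic_near_def o_def
  by (auto dest!: bspec intro: holomorphic_fun_on_add[OF _ holomorphic_fun_on_const[of "- c"], simplified])

lemma taylor_form_Suc_0_shift:
  "taylor_form (Suc 0) (\<lambda>y. u y - c) ch z V = taylor_form (Suc 0) u ch z V"
proof -
  have "((\<lambda>s. F s - c) has_field_derivative D) (at 0) \<longleftrightarrow> (F has_field_derivative D) (at 0)"
    for F :: "complex \<Rightarrow> complex" and D
    using DERIV_add[of "\<lambda>s. F s - c" D 0 UNIV "\<lambda>_. c" 0] DERIV_diff[of F D 0 UNIV "\<lambda>_. c" 0] by auto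
  then show ?thesis by (simp add: taylor_form_def taylor_coeff_1 deriv_def)
qed

text \<open>Subtracting the constant u x leaves the first-order form unchanged and makes the zeroth
  coefficient vanish, which is the hypothesis of the general transition law.\<close>

lemma taylor_form_Suc_0_transition:
  assumes A: "complex_manifold A" and U: "(U, \<phi>) \<in> A" and W: "(W, \<psi>) \<in> A"
    and u: "holomorphic_near A T u" and x: "x \<in> U" "x \<in> W" "x \<in> T"
  shows "taylor_form (Suc 0) u (U, \<phi>) (\<phi> x) V =
         taylor_form (Suc 0) u (W, \<psi>) (\<psi> x) (dtransition U \<phi> \<psi> x V)"
proof -
  let ?u = "\<lambda>y. u y - u x"
  have u': "holomorphic_near A T ?u" by (rule holomorphic_near_shift[OF u])
  have "taylor_form (Suc 0) ?u (U, \<phi>) (\<phi> x) V =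
         taylor_form (Suc 0) ?u (W, \<psi>) (\<psi> x) (dtransition U \<phi> \<psi> x V)"
    by (rule taylor_form_transition[OF A U W u' x])
       (use x chart_inv[OF A U] chart_inv[OF A W] in \<open>simp_all add: taylor_form_def\<close>)
  then show ?thesis by (simp only: taylor_form_Suc_0_shift)
qed

text \<open>The coordinate h exists only over one chart of the target, which is why a disc and a
  weight vanishing on its rim are needed. Surjectivity serves to find a point over the open disc at
  which dh is not zero.\<close>

lemma no_surjection_onto_curve:
  fixes A :: "('a::{t2_space,second_countable_topology} set \<times> ('a \<Rightarrow> complex^'n)) set"
    and B :: "('c::{t2_space,second_countable_topology} set \<times> ('c \<Rightarrow> complex^1)) set"
  assumes A: "complex_manifold A" and comp: "compact (UNIV :: 'a set)"
    and g: "kaehler_metric A g" and ric: "ricci_perp_positive A g"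
    and B: "complex_manifold B" and f: "holomorphic_map A B f" and surj: "surj f"
  shows False
proof -
  fix c0 :: 'c
  obtain Y \<psi> where Y: "(Y, \<psi>) \<in> B" "c0 \<in> Y" using chart_cover[OF B] by blast
  define h where "h x = \<psi> (f x) $ 1" for x
  define T where "T = f -` Y"
  have cf: "continuous_on UNIV f" using f by (simp add: holomorphic_map_def)
  have T: "open T" unfolding T_def by (rule open_vimage[OF chart_open[OF B Y(1)] cf])
  have h: "holomorphic_near A T h"
    unfolding holomorphic_near_def
  proof (intro conjI T, clarify)
    fix U \<phi> assume "(U, \<phi>) \<in> A"
    then have "holomorphic_vec_on (\<psi> \<circ> f \<circ> inv_into U \<phi>) (\<phi> ` (U \<inter> f -` Y))"
      using f Y(1) unfolding holomorphic_map_def by blast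
    then show "holomorphic_fun_on (h \<circ> inv_into U \<phi>) (\<phi> ` (U \<inter> T))"
      unfolding holomorphic_vec_on_def T_def by (simp add: o_def h_def)
  qed
  define a0 where "a0 = \<psi> c0 $ 1"
  obtain r where r: "0 < r" "cball (\<psi> c0) r \<subseteq> \<psi> ` Y"
    using chart_image_open[OF B Y(1)] Y(2) open_contains_cball by blast
  have norm1: "dist (\<psi> c0) v = norm (v $ 1 - a0)" for v
    by (simp add: dist_norm norm_vec_def L2_set_def a0_def norm_minus_commute)
  define D where "D s = f -` (inv_into Y \<psi> ` cball (\<psi> c0) s)" for s
  have D_iff: "x \<in> D s \<longleftrightarrow> x \<in> T \<and> norm (h x - a0) \<le> s" if "s \<le> r" for x s
  proof -
    have sub: "cball (\<psi> c0) s \<subseteq> \<psi> ` Y" using r(2) that by (meson order_trans subset_cball)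
    show ?thesis
    proof
      assume "x \<in> D s"
      then obtain v where v: "v \<in> cball (\<psi> c0) s" "f x = inv_into Y \<psi> v" by (auto simp: D_def)
      have "v \<in> \<psi> ` Y" using v(1) sub by blast
      then have "f x \<in> Y" "\<psi> (f x) = v"
        using v(2) by (auto simp: inv_into_into f_inv_into_f)
      then show "x \<in> T \<and> norm (h x - a0) \<le> s" using v(1) by (simp add: T_def h_def norm1)
    next
      assume *: "x \<in> T \<and> norm (h x - a0) \<le> s"
      then have "f x \<in> Y" by (simp add: T_def)
      then have "f x = inv_into Y \<psi> (\<psi> (f x))" using chart_inv[OF B Y(1)] by simp
      moreover have "\<psi> (f x) \<in> cball (\<psi> c0) s" using * by (simp add: norm1 h_def)
      ultimately show "x \<in> D s" unfolding D_def by blast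
    qed
  qed
  have Dcomp: "compact (D s)" if "s \<le> r" for s
  proof -
    have "cball (\<psi> c0) s \<subseteq> \<psi> ` Y" using r(2) that by (meson order_trans subset_cball)
    then have "compact (inv_into Y \<psi> ` cball (\<psi> c0) s)"
      by (intro compact_continuous_image compact_cball continuous_on_subset[OF chart_inv_continuous[OF B Y(1)]])
    then have "closed (inv_into Y \<psi> ` cball (\<psi> c0) s)" by (rule compact_imp_closed)
    then have "closed (D s)" unfolding D_def by (rule closed_vimage[OF _ cf])
    then show ?thesis using compact_Int_closed[OF comp] by simp
  qed
  have ch: "continuous_on T h"
    unfolding h_def
    by (intro continuous_on_component continuous_on_compose2[OF chart_continuous[OF B Y(1)] continuous_on_subset[OF cf]])
       (auto simp: T_def)
  define E where "E = T \<inter> h -` ball a0 r"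
  have E: "open E" unfolding E_def by (rule continuous_open_preimage[OF ch T open_ball])
  have ED: "E \<subseteq> D r" by (auto simp: E_def D_iff dist_norm norm_minus_commute)
  have hU: "holomorphic_fun_on (h \<circ> inv_into U \<phi>) (\<phi> ` (U \<inter> T))" if "(U, \<phi>) \<in> A" for U \<phi>
    using h that unfolding holomorphic_near_def by blast
  \<comment> \<open>Otherwise h is locally constant over the open disc and takes finitely many
    values on the compact preimage of a smaller closed disc; surjectivity forces it to take
    uncountably many.\<close>
  have "\<exists>U \<phi> x V. (U, \<phi>) \<in> A \<and> x \<in> U \<inter> E \<and> fderiv (h \<circ> inv_into U \<phi>) (\<phi> x) V \<noteq> 0"
  proof (rule ccontr)
    assume "\<not> ?thesis"
    then have zero: "fderiv (h \<circ> inv_into U \<phi>) (\<phi> x) V = 0"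
      if "(U, \<phi>) \<in> A" "x \<in> U \<inter> E" for U \<phi> x V using that by blast
    have "\<exists>N. open N \<and> x \<in> N \<and> h ` N \<subseteq> {h x}" if x: "x \<in> E" for x
    proof -
      obtain U \<phi> where U: "(U, \<phi>) \<in> A" "x \<in> U" using chart_cover[OF A] by blast
      have oUE: "open (\<phi> ` (U \<inter> E))" by (rule chart_image_Int_open[OF A U(1) E])
      obtain d where d: "0 < d" "ball (\<phi> x) d \<subseteq> \<phi> ` (U \<inter> E)"
        using oUE x U(2) open_contains_ball by blast
      have "\<exists>c. \<forall>z\<in>ball (\<phi> x) d. (h \<circ> inv_into U \<phi>) z = c"
      proof (rule has_derivative_zero_constant[OF convex_ball])
        fix z assume z: "z \<in> ball (\<phi> x) d"
        then obtain y where y: "z = \<phi> y" "y \<in> U \<inter> E" using d(2) by blast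
        have "z \<in> \<phi> ` (U \<inter> T)" using y by (auto simp: E_def)
        from holomorphic_fun_on_derivative(1)[OF hU[OF U(1)] this]
        have "((h \<circ> inv_into U \<phi>) has_derivative (\<lambda>h. 0)) (at z)"
          by (rule has_derivative_eq_rhs) (use zero[OF U(1) y(2)] y(1) in auto)
        then show "((h \<circ> inv_into U \<phi>) has_derivative (\<lambda>h. 0)) (at z within ball (\<phi> x) d)"
          by (rule has_derivative_at_withinI)
      qed
      then obtain c where c: "\<And>z. z \<in> ball (\<phi> x) d \<Longrightarrow> h (inv_into U \<phi> z) = c" by auto
      define N where "N = U \<inter> \<phi> -` ball (\<phi> x) d"
      have "open N"
        unfolding N_def by (rule chart_preimage_open[OF A U(1) open_ball])
      moreover have "x \<in> N" using U(2) d(1) by (simp add: N_def)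
      moreover have "h y = c" if "y \<in> N" for y
        using c[of "\<phi> y"] chart_inv[OF A U(1), of y] that by (simp add: N_def)
      ultimately show ?thesis by (intro exI[of _ N]) auto
    qed
    then obtain N where N: "\<And>x. x \<in> E \<Longrightarrow> open (N x)" "\<And>x. x \<in> E \<Longrightarrow> x \<in> N x" "\<And>x. x \<in> E \<Longrightarrow> h ` N x \<subseteq> {h x}"
      by metis
    \<comment> \<open>Halving the radius yields a compact set inside the open set E, where the
      neighbourhoods of constancy are available.\<close>
    have D2E: "D (r/2) \<subseteq> E" using r(1) by (auto simp: E_def D_iff dist_norm norm_minus_commute)
    have "D (r/2) \<subseteq> (\<Union>x\<in>D (r/2). N x)" using N(2) D2E by blast
    moreover have "compact (D (r/2))" using r(1) by (intro Dcomp) simp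
    ultimately obtain F where F: "F \<subseteq> D (r/2)" "finite F" "D (r/2) \<subseteq> (\<Union>x\<in>F. N x)"
      using compactE_image[of "D (r/2)" "D (r/2)" N] N(1) D2E by blast
    have "h ` D (r/2) \<subseteq> h ` F"
    proof
      fix w assume "w \<in> h ` D (r/2)"
      then obtain y where y: "y \<in> D (r/2)" "w = h y" by blast
      then obtain x where "x \<in> F" "y \<in> N x" using F(3) by blast
      then show "w \<in> h ` F" using N(3)[of x] F(1) D2E y(2) by blast
    qed
    then have "finite (h ` D (r/2))" using F(2) finite_subset by blast
    moreover have "cball a0 (r/2) \<subseteq> h ` D (r/2)"
    proof
      fix w assume w: "w \<in> cball a0 (r/2)"
      define v where "v = (\<chi> i::1. w)"
      have v: "v \<in> cball (\<psi> c0) (r/2)"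
        using w unfolding mem_cball norm1 by (simp add: v_def dist_norm norm_minus_commute)
      then have "v \<in> \<psi> ` Y" using r by auto
      obtain x where "f x = inv_into Y \<psi> v" using surj by (metis surjD)
      then have "x \<in> D (r/2)" "h x = w"
        using v \<open>v \<in> \<psi> ` Y\<close> by (auto simp: D_def h_def f_inv_into_f v_def)
      then show "w \<in> h ` D (r/2)" by blast
    qed
    moreover have "uncountable (cball a0 (r/2))" using r(1) by (intro uncountable_cball) simp
    ultimately show False by (meson countable_finite finite_subset)
  qed
  then obtain U1 \<phi>1 x1 V1 where U1: "(U1, \<phi>1) \<in> A" "x1 \<in> U1 \<inter> E"
    "fderiv (h \<circ> inv_into U1 \<phi>1) (\<phi>1 x1) V1 \<noteq> 0" by blast
  show False
  proof (rule no_normalized_taylor_form[OF A g ric Dcomp[OF order_refl] _ h, of "Suc 0" "\<lambda>x. r - norm (h x - a0)" U1 \<phi>1 x1 V1])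
    show DT: "D r \<subseteq> T" by (auto simp: D_iff)
    show "taylor_form (Suc 0) h (U, \<phi>) (\<phi> x) V =
         taylor_form (Suc 0) h (W, \<psi>) (\<psi> x) (dtransition U \<phi> \<psi> x V)"
      if "(U, \<phi>) \<in> A" "(W, \<psi>) \<in> A" "x \<in> U \<inter> W \<inter> D r" for U \<phi> W \<psi> x V
      by (rule taylor_form_Suc_0_transition[OF A that(1,2) h]) (use that(3) DT in auto)
    show "continuous_on (D r) (\<lambda>x. r - norm (h x - a0))"
      by (intro continuous_intros continuous_on_subset[OF ch DT])
    show "0 \<le> r - norm (h x - a0)" if "x \<in> D r" for x using that by (simp add: D_iff)
    show "x1 \<in> U1 \<inter> D r" using U1(2) ED by blast
    show "0 < r - norm (h x1 - a0)" using U1(2) by (auto simp: E_def dist_norm norm_minus_commute)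
    have "\<phi>1 x1 \<in> \<phi>1 ` (U1 \<inter> T)" using U1(2) by (auto simp: E_def)
    then show "taylor_form (Suc 0) h (U1, \<phi>1) (\<phi>1 x1) V1 \<noteq> 0"
      using U1(3) taylor_form_Suc_0[OF U1(1) h] by metis
    fix x assume x: "x \<in> D r" "0 < r - norm (h x - a0)"
    have xE: "x \<in> E" using x DT by (auto simp: E_def dist_norm norm_minus_commute)
    obtain U \<phi> where U: "(U, \<phi>) \<in> A" "x \<in> U" using chart_cover[OF A] by blast
    \<comment> \<open>Here \<eta> is h itself in the chart: its level sets are pieces of fibres, the
      weight is a function of h, and the first-order form is d\<eta>.\<close>
    have "taylor_level_chart T (D r) (\<lambda>x. r - norm (h x - a0)) (Suc 0) h x U \<phi> (U \<inter> E) (h \<circ> inv_into U \<phi>)"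
      unfolding taylor_level_chart_def
    proof (intro conjI ballI allI impI)
      show "open (U \<inter> E)" using chart_open[OF A U(1)] E by blast
      show "x \<in> U \<inter> E" using U(2) xE by blast
      show "U \<inter> E \<subseteq> U \<inter> T" by (auto simp: E_def)
      show "holomorphic_fun_on (h \<circ> inv_into U \<phi>) (\<phi> ` (U \<inter> E))"
        by (rule holomorphic_fun_on_subset[OF hU[OF U(1)]]) (auto simp: E_def)
      fix y assume y: "y \<in> U \<inter> E" "(h \<circ> inv_into U \<phi>) (\<phi> y) = (h \<circ> inv_into U \<phi>) (\<phi> x)"
      show "y \<in> D r" using y(1) ED by blast
      show "r - norm (h y - a0) = r - norm (h x - a0)"
        using y U(2) chart_inv[OF A U(1)] by simp
    next
      fix X e assume e: "fderiv (h \<circ> inv_into U \<phi>) (\<phi> x) e = 0"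
      have z: "\<phi> x \<in> \<phi> ` (U \<inter> T)" using U(2) xE by (auto simp: E_def)
      show "taylor_form (Suc 0) h (U, \<phi>) (\<phi> x) (X + e) = taylor_form (Suc 0) h (U, \<phi>) (\<phi> x) X"
        using holomorphic_fun_on_add_derivative[OF hU[OF U(1)] z, of X e] e
        by (simp add: taylor_form_Suc_0[OF U(1) h z])
    qed
    with U(1) show "\<exists>U \<phi> W \<eta>. (U, \<phi>) \<in> A \<and>
        taylor_level_chart T (D r) (\<lambda>x. r - norm (h x - a0)) (Suc 0) h x U \<phi> W \<eta>" by blast
  qed (use U1(1) in simp_all)
qed


section \<open>Contracted hypersurfaces\<close>


lemma holomorphic_fun_on_local:
  assumes "\<And>z. z \<in> S \<Longrightarrow> \<exists>N. z \<in> N \<and> holomorphic_fun_on u N"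
  shows "holomorphic_fun_on u S"
  using assms unfolding holomorphic_fun_on_def by blast

lemma holomorphic_fun_on_poly_funs:
  assumes "P \<in> poly_funs N" "\<And>i. i < N \<Longrightarrow> holomorphic_fun_on (\<lambda>z. F z i) S"
  shows "holomorphic_fun_on (\<lambda>z. P (F z)) S"
  using assms(1)
  by induction (simp_all add: holomorphic_fun_on_const holomorphic_fun_on_add holomorphic_fun_on_mult assms(2))

text \<open>The identity theorem follows from its one-dimensional case on complex lines through \<open>N\<close>.\<close>

lemma holomorphic_fun_on_ball_eq_0:
  fixes F :: "complex^'n \<Rightarrow> complex"
  assumes F: "holomorphic_fun_on F (ball w d)" and N: "open N" "N \<noteq> {}" "N \<subseteq> ball w d"
    and zero: "\<And>z. z \<in> N \<Longrightarrow> F z = 0" and z: "z \<in> ball w d"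
  shows "F z = 0"
proof -
  obtain z1 where z1: "z1 \<in> N" using N(2) by blast
  define l where "l s = z1 + s *s (z - z1)" for s
  have cl: "continuous_on X l" for X unfolding l_def by (intro continuous_intros)
  define T where "T = l -` ball w d"
  have T: "open T" unfolding T_def by (rule open_vimage[OF open_ball cl])
  have "convex T"
    unfolding convex_def
  proof (intro ballI allI impI)
    fix s s' and a b :: real
    assume *: "s \<in> T" "s' \<in> T" "0 \<le> a" "0 \<le> b" "a + b = 1"
    have "l (a *\<^sub>R s + b *\<^sub>R s') = a *\<^sub>R l s + b *\<^sub>R l s'"
    proof -
      have "z1 = a *\<^sub>R z1 + b *\<^sub>R z1" using *(5) by (simp flip: scaleR_add_left)
      then have "l (a *\<^sub>R s + b *\<^sub>R s') = a *\<^sub>R z1 + b *\<^sub>R z1 + (a *\<^sub>R s + b *\<^sub>R s') *s (z - z1)"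
        by (simp add: l_def)
      also have "\<dots> = a *\<^sub>R l s + b *\<^sub>R l s'"
        by (simp add: l_def vec_eq_iff complex_eq_iff algebra_simps)
      finally show ?thesis .
    qed
    then show "a *\<^sub>R s + b *\<^sub>R s' \<in> T"
      using convexD[OF convex_ball, of "l s" w d "l s'" a b] * by (simp add: T_def)
  qed
  then have "connected T" by (rule convex_connected)
  have hol: "(\<lambda>s. F (l s)) holomorphic_on T"
    unfolding l_def by (rule holomorphic_on_line[OF F T]) (simp add: T_def l_def)
  have l01: "l 0 = z1" "l 1 = z" by (simp_all add: l_def)
  define N' where "N' = l -` N"
  have "open N'" unfolding N'_def by (rule open_vimage[OF N(1) cl])
  have "0 \<in> N'" using z1 l01 by (simp add: N'_def)
  have "N' \<subseteq> T" using N(3) by (auto simp: N'_def T_def)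
  have "1 \<in> T" using z l01 by (simp add: T_def)
  have "F (l 1) = 0"
    by (rule analytic_continuation_open[OF \<open>open N'\<close> T _ \<open>connected T\<close> \<open>N' \<subseteq> T\<close> hol
          holomorphic_on_const[of 0] _ \<open>1 \<in> T\<close>])
       (use \<open>0 \<in> N'\<close> zero in \<open>auto simp: N'_def\<close>)
  then show ?thesis using l01 by simp
qed

section \<open>Zariski open sets and regular functions in the classical topology\<close>

lemma continuous_on_poly_funs:
  assumes "P \<in> poly_funs N"
  shows "continuous_on UNIV P"
  using assms
  by induction (auto intro!: continuous_intros continuous_on_product_coordinates)

lemma varietyD:
  assumes Z: "variety Z" and U: "(U, N, \<phi>) \<in> Z"
  shows "inj_on \<phi> U" "algebraic_set N (\<phi> ` U)"
    and "(V, K, \<psi>) \<in> Z \<Longrightarrow> zariski_open_in N (\<phi> ` U) (\<phi> ` (U \<inter> V))"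
    and "(V, K, \<psi>) \<in> Z \<Longrightarrow> i < K \<Longrightarrow>
      affine_regular_on N (\<phi> ` U) (\<phi> ` (U \<inter> V)) (\<lambda>v. \<psi> (inv_into U \<phi> v) i)"
proof -
  note Z' = Z[unfolded variety_def, THEN conjunct2, THEN conjunct2]
  from Z'[THEN conjunct1, THEN bspec, OF U] show "inj_on \<phi> U" "algebraic_set N (\<phi> ` U)"
    by simp_all
  note * = Z'[THEN conjunct2, THEN conjunct1, THEN bspec, OF U, unfolded prod.case, THEN bspec]
  show "(V, K, \<psi>) \<in> Z \<Longrightarrow> zariski_open_in N (\<phi> ` U) (\<phi> ` (U \<inter> V))"
    "(V, K, \<psi>) \<in> Z \<Longrightarrow> i < K \<Longrightarrow>
      affine_regular_on N (\<phi> ` U) (\<phi> ` (U \<inter> V)) (\<lambda>v. \<psi> (inv_into U \<phi> v) i)"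
    using *[of "(V, K, \<psi>)"] by simp_all
qed

lemma algebraic_chartD:
  assumes X: "algebraic_structure_on A X" and U: "(U, N, \<phi>) \<in> X"
  shows "open U" "continuous_on U \<phi>" "inj_on \<phi> U" "\<phi> ` U \<subseteq> affine_space N"
    and "(V, \<kappa>) \<in> A \<Longrightarrow> i < N \<Longrightarrow> holomorphic_fun_on (\<lambda>z. \<phi> (inv_into V \<kappa> z) i) (\<kappa> ` (V \<inter> U))"
proof -
  note * = X[unfolded algebraic_structure_on_def, THEN conjunct2, THEN conjunct2, THEN bspec, OF U, unfolded prod.case]
  then show "open U" "continuous_on U \<phi>" by (simp_all add: homeomorphism_def)
  show "(V, \<kappa>) \<in> A \<Longrightarrow> i < N \<Longrightarrow> holomorphic_fun_on (\<lambda>z. \<phi> (inv_into V \<kappa> z) i) (\<kappa> ` (V \<inter> U))"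
    using * by blast
  have "variety X" using X unfolding algebraic_structure_on_def by blast
  from varietyD(1,2)[OF this U] show "inj_on \<phi> U" "\<phi> ` U \<subseteq> affine_space N"
    by (auto simp: algebraic_set_def)
qed

lemma zariski_open_in_nonvanishing:
  assumes "zariski_open_in N V W" "V \<subseteq> affine_space N"
  obtains S where "S \<subseteq> poly_funs N" "W = {v \<in> V. \<exists>P\<in>S. P v \<noteq> 0}"
proof -
  obtain C where "algebraic_set N C" "W = V - C"
    using assms(1) unfolding zariski_open_in_def by blast
  then obtain S where "S \<subseteq> poly_funs N" "W = V - {v \<in> affine_space N. \<forall>P\<in>S. P v = 0}"
    unfolding algebraic_set_def by blast
  then show ?thesis using that[of S] assms(2) by blast
qed

text \<open>A Zariski open subset of an affine chart is a union of nonvanishing loci of polynomials,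
  which are continuous in the chart coordinates.\<close>

lemma open_preimage_zariski_open_in:
  assumes X: "algebraic_structure_on A X" and U: "(U, N, \<phi>) \<in> X"
    and W: "zariski_open_in N (\<phi> ` U) W"
  shows "open {x \<in> U. \<phi> x \<in> W}"
proof -
  obtain S where S: "S \<subseteq> poly_funs N" "W = {v \<in> \<phi> ` U. \<exists>P\<in>S. P v \<noteq> 0}"
    using zariski_open_in_nonvanishing[OF W algebraic_chartD(4)[OF X U]] by blast
  have eq: "{x \<in> U. \<phi> x \<in> W} = (\<Union>P\<in>S. U \<inter> (\<lambda>x. P (\<phi> x)) -` (- {0}))"
    using S(2) by auto
  have "open (U \<inter> (\<lambda>x. P (\<phi> x)) -` (- {0}))" if "P \<in> S" for P
  proof (rule continuous_open_preimage[OF _ algebraic_chartD(1)[OF X U]])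
    have "P \<in> poly_funs N" using that S(1) by blast
    then show "continuous_on U (\<lambda>x. P (\<phi> x))"
      by (rule continuous_on_compose2[OF continuous_on_poly_funs algebraic_chartD(2)[OF X U]]) simp
  qed (rule open_Compl, rule closed_singleton)
  then show ?thesis unfolding eq by (intro open_UN ballI)
qed

lemma algebraic_chart_cover:
  assumes "algebraic_structure_on A X"
  obtains U N \<phi> where "(U, N, \<phi>) \<in> X" "x \<in> U"
proof -
  have "x \<in> carrier_of X" using assms by (simp add: algebraic_structure_on_def)
  then show ?thesis using that unfolding carrier_of_def by auto
qed

lemma open_zariski_open:
  assumes X: "algebraic_structure_on A X" and W: "zariski_open X W"
  shows "open W"
proof (subst open_subopen, intro ballI)
  fix x assume x: "x \<in> W"
  obtain U N \<phi> where U: "(U, N, \<phi>) \<in> X" "x \<in> U" using algebraic_chart_cover[OF X] by blast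
  have "zariski_open_in N (\<phi> ` U) (\<phi> ` (W \<inter> U))"
    using W U(1) unfolding zariski_open_def by blast
  from open_preimage_zariski_open_in[OF X U(1) this]
  have "open {y \<in> U. \<phi> y \<in> \<phi> ` (W \<inter> U)}" .
  moreover have "{y \<in> U. \<phi> y \<in> \<phi> ` (W \<inter> U)} = W \<inter> U"
    using algebraic_chartD(3)[OF X U(1)] by (auto dest: inj_onD)
  ultimately show "\<exists>T. open T \<and> x \<in> T \<and> T \<subseteq> W" using x U(2) by (intro exI[of _ "W \<inter> U"]) auto
qed

text \<open>Locally a regular function is a quotient of polynomials in the affine coordinates, and
  these coordinates are holomorphic by the choice of the algebraic structure. This is the passage
  from morphisms of varieties to complex analysis.\<close>

lemma holomorphic_near_regular:
  assumes A: "complex_manifold A" and X: "algebraic_structure_on A X"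
    and W: "zariski_open X W" and u: "regular_on X W u"
  shows "holomorphic_near A W u"
  unfolding holomorphic_near_def
proof (intro conjI open_zariski_open[OF X W], clarify)
  fix V \<kappa> assume V: "(V, \<kappa>) \<in> A"
  show "holomorphic_fun_on (u \<circ> inv_into V \<kappa>) (\<kappa> ` (V \<inter> W))"
  proof (rule holomorphic_fun_on_local)
    fix z assume "z \<in> \<kappa> ` (V \<inter> W)"
    then obtain x where x: "z = \<kappa> x" "x \<in> V" "x \<in> W" by blast
    obtain U N \<phi> where U: "(U, N, \<phi>) \<in> X" "x \<in> U" using algebraic_chart_cover[OF X] by blast
    have "affine_regular_on N (\<phi> ` U) (\<phi> ` (W \<inter> U)) (u \<circ> inv_into U \<phi>)"
      using u U(1) unfolding regular_on_def by blast
    moreover have "\<phi> x \<in> \<phi> ` (W \<inter> U)" using x U by blast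
    ultimately have "\<exists>W'. \<exists>P\<in>poly_funs N. \<exists>Q\<in>poly_funs N. zariski_open_in N (\<phi> ` U) W' \<and> \<phi> x \<in> W' \<and>
        W' \<subseteq> \<phi> ` (W \<inter> U) \<and> (\<forall>y\<in>W'. Q y \<noteq> 0 \<and> (u \<circ> inv_into U \<phi>) y = P y / Q y)"
      unfolding affine_regular_on_def by (rule bspec)
    then obtain W' P Q where PQ': "P \<in> poly_funs N" "Q \<in> poly_funs N"
      "zariski_open_in N (\<phi> ` U) W' \<and> \<phi> x \<in> W' \<and>
        W' \<subseteq> \<phi> ` (W \<inter> U) \<and> (\<forall>y\<in>W'. Q y \<noteq> 0 \<and> (u \<circ> inv_into U \<phi>) y = P y / Q y)"
      by (elim exE bexE)
    note PQ = PQ'(1,2) PQ'(3)[THEN conjunct1] PQ'(3)[THEN conjunct2, THEN conjunct1]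
      PQ'(3)[THEN conjunct2, THEN conjunct2, THEN conjunct2, THEN bspec]
    define O' where "O' = {y \<in> U. \<phi> y \<in> W'}"
    have "open O'" unfolding O'_def by (rule open_preimage_zariski_open_in[OF X U(1) PQ(3)])
    have oS: "open (\<kappa> ` (V \<inter> O'))" by (rule chart_image_Int_open[OF A V \<open>open O'\<close>])
    have pol: "holomorphic_fun_on (\<lambda>z. R (\<phi> (inv_into V \<kappa> z))) (\<kappa> ` (V \<inter> O'))" if "R \<in> poly_funs N" for R
      by (rule holomorphic_fun_on_poly_funs[OF that],
          rule holomorphic_fun_on_subset[OF algebraic_chartD(5)[OF X U(1) V]]) (auto simp: O'_def)
    have in_O': "inv_into V \<kappa> z' \<in> O'" if "z' \<in> \<kappa> ` (V \<inter> O')" for z'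
      using that chart_inv[OF A V] by auto
    have "holomorphic_fun_on (\<lambda>z. P (\<phi> (inv_into V \<kappa> z)) / Q (\<phi> (inv_into V \<kappa> z))) (\<kappa> ` (V \<inter> O'))"
      using in_O' PQ(5) by (intro holomorphic_fun_on_divide pol PQ(1,2)) (auto simp: O'_def)
    then have "holomorphic_fun_on (u \<circ> inv_into V \<kappa>) (\<kappa> ` (V \<inter> O'))"
    proof (rule holomorphic_fun_on_cong[OF oS])
      fix z' assume "z' \<in> \<kappa> ` (V \<inter> O')"
      from in_O'[OF this] have y: "inv_into V \<kappa> z' \<in> U" "\<phi> (inv_into V \<kappa> z') \<in> W'" by (auto simp: O'_def)
      have "inv_into U \<phi> (\<phi> (inv_into V \<kappa> z')) = inv_into V \<kappa> z'"
        by (rule inv_into_f_f[OF algebraic_chartD(3)[OF X U(1)] y(1)])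
      then show "P (\<phi> (inv_into V \<kappa> z')) / Q (\<phi> (inv_into V \<kappa> z')) = (u \<circ> inv_into V \<kappa>) z'"
        using PQ(5)[OF y(2)] by simp
    qed
    moreover have "z \<in> \<kappa> ` (V \<inter> O')" using x U(2) PQ(4) by (auto simp: O'_def)
    ultimately show "\<exists>N. z \<in> N \<and> holomorphic_fun_on (u \<circ> inv_into V \<kappa>) N"
      by (intro exI[of _ "\<kappa> ` (V \<inter> O')"] conjI)
  qed
qed

text \<open>The interior of the complement of W is closed: near a point of its closure the
  polynomials cutting out the complement vanish on an open set, hence on a whole coordinate ball by
  the identity theorem. Connectedness in the classical topology leaves only the empty set.\<close>

lemma zariski_open_dense:
  fixes A :: "('a::{t2_space,second_countable_topology} set \<times> ('a \<Rightarrow> complex^'n)) set"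
  assumes A: "complex_manifold A" and X: "algebraic_structure_on A X"
    and conn: "connected (UNIV :: 'a set)" and W: "zariski_open X W" "W \<noteq> {}" and O': "open O'" "O' \<noteq> {}"
  shows "W \<inter> O' \<noteq> {}"
proof
  assume disj: "W \<inter> O' = {}"
  define I where "I = interior (- W)"
  have "closure I \<subseteq> I"
  proof
    fix x assume x: "x \<in> closure I"
    obtain U N \<phi> where U: "(U, N, \<phi>) \<in> X" "x \<in> U" using algebraic_chart_cover[OF X] by blast
    obtain V \<kappa> where V: "(V, \<kappa>) \<in> A" "x \<in> V" using chart_cover[OF A] by blast
    have "zariski_open_in N (\<phi> ` U) (\<phi> ` (W \<inter> U))"
      using W(1) U(1) unfolding zariski_open_def by blast
    then obtain S where S: "S \<subseteq> poly_funs N" "\<phi> ` (W \<inter> U) = {v \<in> \<phi> ` U. \<exists>P\<in>S. P v \<noteq> 0}"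
      using zariski_open_in_nonvanishing[OF _ algebraic_chartD(4)[OF X U(1)]] by blast
    have W_iff: "y \<in> W \<longleftrightarrow> (\<exists>P\<in>S. P (\<phi> y) \<noteq> 0)" if y: "y \<in> U" for y
    proof -
      have "y \<in> W \<longleftrightarrow> \<phi> y \<in> \<phi> ` (W \<inter> U)"
        using algebraic_chartD(3)[OF X U(1)] y by (auto dest: inj_onD)
      then show ?thesis unfolding S(2) using y by blast
    qed
    have "open (\<kappa> ` (V \<inter> U))" by (rule chart_image_Int_open[OF A V(1) algebraic_chartD(1)[OF X U(1)]])
    then obtain d where d: "0 < d" "ball (\<kappa> x) d \<subseteq> \<kappa> ` (V \<inter> U)"
      using U(2) V(2) open_contains_ball by blast
    define b where "b = V \<inter> \<kappa> -` ball (\<kappa> x) d"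
    have ob: "open b"
      unfolding b_def by (rule chart_preimage_open[OF A V(1) open_ball])
    have xb: "x \<in> b" using V(2) d(1) by (simp add: b_def)
    have bU: "b \<subseteq> U"
    proof
      fix y assume y: "y \<in> b"
      then obtain y' where y': "\<kappa> y = \<kappa> y'" "y' \<in> V \<inter> U" using d(2) unfolding b_def by blast
      moreover have "y \<in> V" using y by (simp add: b_def)
      ultimately have "y = y'" using chart_inv[OF A V(1)] by (metis IntD1)
      then show "y \<in> U" using y'(2) by blast
    qed
    have "I \<inter> b \<noteq> {}" using x xb open_Int_closure_eq_empty[OF ob, of I] by blast
    define M where "M = \<kappa> ` (V \<inter> (I \<inter> b))"
    have oM: "open M" unfolding M_def
      by (rule chart_image_Int_open[OF A V(1)]) (simp add: I_def ob open_Int)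
    have "M \<noteq> {}" using \<open>I \<inter> b \<noteq> {}\<close> by (auto simp: M_def b_def)
    have Mb: "M \<subseteq> ball (\<kappa> x) d" by (auto simp: M_def b_def)
    have zero: "P (\<phi> y) = 0" if P: "P \<in> S" and y: "y \<in> b" for P y
    proof -
      have "P (\<phi> (inv_into V \<kappa> (\<kappa> y))) = 0"
      proof (rule holomorphic_fun_on_ball_eq_0[OF _ oM \<open>M \<noteq> {}\<close> Mb])
        have "P \<in> poly_funs N" using P S(1) by blast
        then show "holomorphic_fun_on (\<lambda>z. P (\<phi> (inv_into V \<kappa> z))) (ball (\<kappa> x) d)"
          by (rule holomorphic_fun_on_poly_funs)
             (rule holomorphic_fun_on_subset[OF algebraic_chartD(5)[OF X U(1) V(1)] d(2)])
        show "\<kappa> y \<in> ball (\<kappa> x) d" using y by (simp add: b_def)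
        fix z assume "z \<in> M"
        then obtain y' where y': "z = \<kappa> y'" "y' \<in> V" "y' \<in> I" "y' \<in> b" by (auto simp: M_def)
        have "y' \<notin> W" using y'(3) interior_subset unfolding I_def by blast
        then show "P (\<phi> (inv_into V \<kappa> z)) = 0"
          using W_iff[of y'] P y' bU chart_inv[OF A V(1)] by auto
      qed
      then show ?thesis using chart_inv[OF A V(1), of y] y by (simp add: b_def)
    qed
    then have "b \<subseteq> - W" using W_iff bU by blast
    then have "b \<subseteq> I" unfolding I_def by (rule interior_maximal[OF _ ob])
    then show "x \<in> I" using xb by blast
  qed
  then have "closed I" using closure_subset by (metis closure_eq subset_antisym)
  moreover have "open I" by (simp add: I_def)
  ultimately have "I = {} \<or> I = UNIV"
    using conn by (auto simp: connected_clopen)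
  moreover have "O' \<subseteq> I" unfolding I_def by (rule interior_maximal[OF _ O'(1)]) (use disj in blast)
  then have "I \<noteq> {}" using O'(2) by blast
  moreover have "I \<noteq> UNIV" using W(2) interior_subset[of "- W"] unfolding I_def by blast
  ultimately show False by blast
qed


text \<open>A \<open>k\<close>-form built from a function vanishing to order \<open>k\<close> along the hypersurface \<open>\<eta> = 0\<close> is a
  multiple of \<open>(d\<eta>)\<^sup>k\<close> there.\<close>

lemma taylor_coeff_tangent_invariant:
  fixes u \<eta> :: "complex^'n \<Rightarrow> complex"
  assumes u: "holomorphic_fun_on u S" and \<eta>: "holomorphic_fun_on \<eta> S" and S: "open S" and z0: "z0 \<in> S"
    and van: "\<And>j z V. j < k \<Longrightarrow> z \<in> S \<Longrightarrow> \<eta> z = \<eta> z0 \<Longrightarrow> line_coeff j u z V = 0"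
    and v: "fderiv \<eta> z0 v \<noteq> 0" and e: "fderiv \<eta> z0 e = 0"
  shows "line_coeff k u z0 (X + e) = line_coeff k u z0 X"
proof -
  obtain r \<sigma> where \<sigma>: "0 < r" "\<sigma> holomorphic_on ball 0 r" "\<sigma> 0 = 0" "deriv \<sigma> 0 = 0"
    "\<And>t. t \<in> ball 0 r \<Longrightarrow> z0 + t *s e + \<sigma> t *s v \<in> S"
    "\<And>t. t \<in> ball 0 r \<Longrightarrow> \<eta> (z0 + t *s e + \<sigma> t *s v) = \<eta> z0"
    using implicit_curve[OF \<eta> S z0 v e] by blast
  \<comment> \<open>The summand 2 in the denominator keeps even the term n = 0 strictly inside the
    ball of radius r.\<close>
  define sn where "sn n = complex_of_real (r / (real n + 2))" for n
  have sn0: "sn n \<noteq> 0" for n unfolding sn_def of_real_eq_0_iff using \<sigma>(1) by simp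
  have snr: "sn n \<in> ball 0 r" for n
  proof -
    have "norm (sn n) = r / (real n + 2)" unfolding sn_def norm_of_real using \<sigma>(1) by simp
    also have "\<dots> < r" using \<sigma>(1) by (simp add: divide_less_eq)
    finally show ?thesis by simp
  qed
  have sn: "sn \<longlonglongrightarrow> 0"
  proof -
    have "(\<lambda>n. r * (1 / real (n + 2))) \<longlonglongrightarrow> r * 0"
      by (intro tendsto_intros LIMSEQ_ignore_initial_segment lim_1_over_n)
    then have "(\<lambda>n. r / (real n + 2)) \<longlonglongrightarrow> 0" by (simp add: add.commute)
    from tendsto_of_real[OF this, where 'a=complex] show ?thesis by (simp add: sn_def[abs_def])
  qed
  have d\<sigma>: "(\<sigma> has_field_derivative 0) (at 0)"
    using holomorphic_derivI[OF \<sigma>(2) open_ball, of 0] \<sigma>(1,4) by simp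
  have "((\<lambda>h. (\<sigma> (0 + h) - \<sigma> 0) / h) \<longlongrightarrow> 0) (at 0)" using d\<sigma> by (simp add: DERIV_def)
  moreover have "filterlim sn (at 0) sequentially" by (rule filterlim_atI[OF sn]) (simp add: sn0)
  ultimately have q: "(\<lambda>n. (\<sigma> (0 + sn n) - \<sigma> 0) / sn n) \<longlonglongrightarrow> 0" by (rule filterlim_compose)
  have "(\<lambda>n. \<sigma> (sn n)) \<longlonglongrightarrow> \<sigma> 0"
    by (rule isCont_tendsto_compose[OF DERIV_isCont[OF d\<sigma>] sn])
  then have \<sigma>n: "(\<lambda>n. \<sigma> (sn n)) \<longlonglongrightarrow> 0" using \<sigma>(3) by simp
  \<comment> \<open>The same points z0 + s (X + e) are read in two ways: from \<open>z0\<close> in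
    direction X + e, and from \<open>zn n\<close>, which moves inside the level set tangentially to
    e, in directions \<open>wn n\<close> tending to X. Comparing the two limits gives the
    claim.\<close>
  define zn where "zn n = z0 + sn n *s e + \<sigma> (sn n) *s v" for n
  define wn where "wn n = X - (\<sigma> (sn n) / sn n) *s v" for n
  have zn: "zn \<longlonglongrightarrow> z0"
  proof -
    have "(\<lambda>n. z0 + sn n *s e + \<sigma> (sn n) *s v) \<longlonglongrightarrow> z0 + 0 *s e + 0 *s v"
      by (intro tendsto_intros sn \<sigma>n)
    then show ?thesis by (simp add: zn_def[abs_def])
  qed
  have wn: "wn \<longlonglongrightarrow> X"
  proof -
    have "(\<lambda>n. X - (\<sigma> (sn n) / sn n) *s v) \<longlonglongrightarrow> X - 0 *s v"
      using q \<sigma>(3) by (intro tendsto_intros) simp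
    then show ?thesis by (simp add: wn_def[abs_def])
  qed
  have l1: "(\<lambda>n. u (zn n + sn n *s wn n) / sn n ^ k) \<longlonglongrightarrow> line_coeff k u z0 X"
  proof (rule taylor_coeff_line_limit[OF u S z0 zn wn sn sn0])
    fix n j assume "j < k"
    then show "line_coeff j u (zn n) (wn n) = 0"
      using \<sigma>(5,6)[OF snr[of n]] by (intro van) (auto simp: zn_def)
  qed
  have "zn n + sn n *s wn n = z0 + sn n *s (X + e)" for n
    using sn0[of n] by (simp add: zn_def wn_def vec_eq_iff algebra_simps)
  with l1 have l1': "(\<lambda>n. u (z0 + sn n *s (X + e)) / sn n ^ k) \<longlonglongrightarrow> line_coeff k u z0 X"
    by simp
  have l2: "(\<lambda>n. u (z0 + sn n *s (X + e)) / sn n ^ k) \<longlonglongrightarrow> line_coeff k u z0 (X + e)"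
    by (rule taylor_coeff_line_limit[OF u S z0 tendsto_const tendsto_const sn sn0]) (rule van[OF _ z0 refl])
  show ?thesis by (rule LIMSEQ_unique[OF l2 l1'])
qed

text \<open>If all Taylor coefficients along the line from x to a nearby point y were zero, the
  power series would give u y = 0.\<close>

lemma exists_nonzero_taylor_form:
  assumes A: "complex_manifold A" and u: "holomorphic_near A T u" and x: "x \<in> T"
    and nz: "\<And>N. open N \<Longrightarrow> x \<in> N \<Longrightarrow> \<exists>y\<in>N \<inter> T. u y \<noteq> 0"
  shows "\<exists>k U \<phi> V. (U, \<phi>) \<in> A \<and> x \<in> U \<and> taylor_form k u (U, \<phi>) (\<phi> x) V \<noteq> 0"
proof -
  obtain U \<phi> where U: "(U, \<phi>) \<in> A" "x \<in> U" using chart_cover[OF A] by blast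
  have T: "open T" and hol: "holomorphic_fun_on (u \<circ> inv_into U \<phi>) (\<phi> ` (U \<inter> T))"
    using u U(1) unfolding holomorphic_near_def by blast+
  obtain d where d: "0 < d" "ball (\<phi> x) d \<subseteq> \<phi> ` (U \<inter> T)"
    using chart_image_Int_open[OF A U(1) T] U(2) x open_contains_ball by blast
  \<comment> \<open>Taking y in the ball of half the radius makes the restriction to the line
    holomorphic on the disc of radius 2, so the series converges at s = 1, the parameter of
    y.\<close>
  have "x \<in> U \<inter> \<phi> -` ball (\<phi> x) (d / 2)" using U(2) d(1) by simp
  with nz[OF chart_preimage_open[OF A U(1) open_ball]]
  obtain y where y: "y \<in> U" "\<phi> y \<in> ball (\<phi> x) (d / 2)" "u y \<noteq> 0" by blast
  define V where "V = \<phi> y - \<phi> x"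
  have nV: "norm V < d / 2" using y(2) by (simp add: V_def dist_norm norm_minus_commute)
  define F where "F s = (u \<circ> inv_into U \<phi>) (\<phi> x + s *s V)" for s
  have "F holomorphic_on ball 0 2"
    unfolding F_def
  proof (rule holomorphic_on_line[OF hol open_ball])
    fix s :: complex assume "s \<in> ball 0 2"
    then have "norm s * norm V \<le> 2 * norm V" by (intro mult_right_mono) auto
    then have "\<phi> x + s *s V \<in> ball (\<phi> x) d"
      using nV by (simp add: dist_norm norm_vector_scalar_mult)
    then show "\<phi> x + s *s V \<in> \<phi> ` (U \<inter> T)" using d(2) by blast
  qed
  from taylor_coeff_sums[OF this, of 1]
  have S: "(\<lambda>n. taylor_coeff n F * 1 ^ n) sums F 1" by simp
  have "F 1 = u y" using chart_inv[OF A U(1) y(1)] by (simp add: F_def V_def)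
  have "\<exists>k. taylor_coeff k F \<noteq> 0"
  proof (rule ccontr)
    assume "\<nexists>k. taylor_coeff k F \<noteq> 0"
    then have "(\<lambda>n. 0) sums F 1" using S by simp
    then have "F 1 = 0" using sums_unique2 sums_zero by blast
    then show False using y(3) \<open>F 1 = u y\<close> by simp
  qed
  then obtain k where "taylor_form k u (U, \<phi>) (\<phi> x) V \<noteq> 0"
    by (auto simp: taylor_form_def F_def[abs_def])
  then show ?thesis using U by blast
qed

text \<open>The order k is the minimum over all points of D at once. Hence the lower forms vanish
  everywhere on D, which is needed both for independence of the chart and for invariance under
  tangent vectors; a single point with nonzero form suffices for k to exist.\<close>

lemma vanishing_function_locally_zero:
  fixes A :: "('a::{t2_space,second_countable_topology} set \<times> ('a \<Rightarrow> complex^'n)) set"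
  assumes A: "complex_manifold A" and comp: "compact (UNIV :: 'a set)"
    and g: "kaehler_metric A g" and ric: "ricci_perp_positive A g"
    and D: "smooth_hypersurface A D" "D \<subseteq> T" and u: "holomorphic_near A T u"
    and uD: "\<And>x. x \<in> D \<Longrightarrow> u x = 0" and x: "x \<in> D"
  shows "\<exists>N. open N \<and> x \<in> N \<and> (\<forall>y\<in>N \<inter> T. u y = 0)"
proof (rule ccontr)
  assume "\<not> ?thesis"
  then have ex0: "\<exists>k U \<phi> V. (U, \<phi>) \<in> A \<and> x \<in> U \<and> taylor_form k u (U, \<phi>) (\<phi> x) V \<noteq> 0"
    using x D(2) by (intro exists_nonzero_taylor_form[OF A u]) blast+
  define E where "E k \<longleftrightarrow> (\<exists>U \<phi> x V. (U, \<phi>) \<in> A \<and> x \<in> U \<inter> D \<and> taylor_form k u (U, \<phi>) (\<phi> x) V \<noteq> 0)" for k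
  have ex: "\<exists>k. E k" using ex0 x unfolding E_def by blast
  define k where "k = (LEAST k. E k)"
  have Ek: "E k" unfolding k_def by (rule LeastI_ex[OF ex])
  have van: "taylor_form j u (U, \<phi>) (\<phi> y) V = 0" if "j < k" "(U, \<phi>) \<in> A" "y \<in> U" "y \<in> D" for j U \<phi> y V
    using not_less_Least[of j E] that unfolding k_def E_def by blast
  have "\<not> E 0"
    using uD chart_inv[OF A] unfolding E_def by (auto simp: taylor_form_def)
  then have k: "0 < k" using Ek by (cases k) auto
  have T: "open T" using u by (simp add: holomorphic_near_def)
  have "closed D" using D(1) by (simp add: smooth_hypersurface_def)
  then have cD: "compact D" using compact_Int_closed[OF comp] by simp
  obtain U1 \<phi>1 x1 V1 where U1: "(U1, \<phi>1) \<in> A" "x1 \<in> U1 \<inter> D" "taylor_form k u (U1, \<phi>1) (\<phi>1 x1) V1 \<noteq> 0"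
    using Ek unfolding E_def by blast
  show False
  proof (rule no_normalized_taylor_form[OF A g ric cD D(2) u k, of "\<lambda>_. 1" U1 \<phi>1 x1 V1])
    show "taylor_form k u (U, \<phi>) (\<phi> x) V =
         taylor_form k u (W, \<psi>) (\<psi> x) (dtransition U \<phi> \<psi> x V)"
      if "(U, \<phi>) \<in> A" "(W, \<psi>) \<in> A" "x \<in> U \<inter> W \<inter> D" for U \<phi> W \<psi> x V
      by (rule taylor_form_transition[OF A that(1,2) u]) (use that D(2) van in auto)
    fix x assume x: "x \<in> D"
    note D(1)[unfolded smooth_hypersurface_def, THEN conjunct2, THEN conjunct2, THEN bspec, OF x]
    then obtain U \<phi> W \<eta> v where W: "(U, \<phi>) \<in> A" "open W" "x \<in> W" "W \<subseteq> U"
      "holomorphic_fun_on \<eta> (\<phi> ` W)" "\<And>y. y \<in> W \<Longrightarrow> y \<in> D \<longleftrightarrow> \<eta> (\<phi> y) = 0"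
      "fderiv \<eta> (\<phi> x) v \<noteq> 0"
      by blast
    have \<eta>x: "\<eta> (\<phi> x) = 0" using W(3,6) x by blast
    have sub: "\<phi> ` (W \<inter> T) \<subseteq> \<phi> ` W" "\<phi> ` (W \<inter> T) \<subseteq> \<phi> ` (U \<inter> T)" using W(4) by auto
    have hu: "holomorphic_fun_on (u \<circ> inv_into U \<phi>) (\<phi> ` (W \<inter> T))"
      using u W(1) holomorphic_fun_on_subset[OF _ sub(2)] unfolding holomorphic_near_def by blast
    have "U \<inter> (W \<inter> T) = W \<inter> T" using W(4) by blast
    then have oS: "open (\<phi> ` (W \<inter> T))"
      using chart_image_Int_open[OF A W(1), of "W \<inter> T"] W(2) T by (simp add: open_Int)
    have "taylor_level_chart T D (\<lambda>_. 1) k u x U \<phi> (W \<inter> T) \<eta>"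
      unfolding taylor_level_chart_def
    proof (intro conjI ballI allI impI refl)
      show "open (W \<inter> T)" using W(2) T by blast
      show "x \<in> W \<inter> T" using W(3) x D(2) by blast
      show "W \<inter> T \<subseteq> U \<inter> T" using W(4) by blast
      show "holomorphic_fun_on \<eta> (\<phi> ` (W \<inter> T))" by (rule holomorphic_fun_on_subset[OF W(5) sub(1)])
      show "y \<in> D" if "y \<in> W \<inter> T" "\<eta> (\<phi> y) = \<eta> (\<phi> x)" for y using that W(6) \<eta>x by auto
      fix X e assume e: "fderiv \<eta> (\<phi> x) e = 0"
      show "taylor_form k u (U, \<phi>) (\<phi> x) (X + e) = taylor_form k u (U, \<phi>) (\<phi> x) X"
        unfolding taylor_form_def fst_conv snd_conv
      proof (rule taylor_coeff_tangent_invariant[OF hu holomorphic_fun_on_subset[OF W(5) sub(1)] oS _ _ W(7) e])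
        show "\<phi> x \<in> \<phi> ` (W \<inter> T)" using W(3) x D(2) by blast
        fix j z V assume j: "j < k" "z \<in> \<phi> ` (W \<inter> T)" "\<eta> z = \<eta> (\<phi> x)"
        then obtain y where y: "z = \<phi> y" "y \<in> W" by blast
        then have "y \<in> D" using W(6) j(3) \<eta>x by auto
        from van[OF j(1) W(1) _ this, of V] y W(4)
        show "line_coeff j (u \<circ> inv_into U \<phi>) z V = 0"
          by (auto simp: taylor_form_def)
      qed
    qed
    with W(1) show "\<exists>U \<phi> W \<eta>. (U, \<phi>) \<in> A \<and> taylor_level_chart T D (\<lambda>_. 1) k u x U \<phi> W \<eta>"
      by blast
  qed (use U1 in \<open>auto intro: continuous_on_const\<close>)
qed

text \<open>The dimension \<open>CARD('n)\<close> is positive, so the image of a chart has no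
  isolated points.\<close>

lemma manifold_not_open_singleton:
  fixes A :: "('a::{t2_space,second_countable_topology} set \<times> ('a \<Rightarrow> complex^'n)) set"
  assumes A: "complex_manifold A"
  shows "\<not> open {x :: 'a}"
proof
  assume o: "open {x}"
  obtain U \<phi> where U: "(U, \<phi>) \<in> A" "x \<in> U" using chart_cover[OF A] by blast
  have "open (\<phi> ` (U \<inter> {x}))" by (rule chart_image_Int_open[OF A U(1) o])
  moreover have "\<phi> ` (U \<inter> {x}) = {\<phi> x}" using U(2) by blast
  ultimately show False using not_open_singleton[of "\<phi> x"] by simp
qed

text \<open>An affine chart around p has finitely many coordinates, so the neighbourhoods on which
  their pullbacks are constant intersect in an open set mapped to p. By density this set meets the
  locus over W, where f has a left inverse.\<close>

lemma no_contracted_hypersurface: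
  fixes A :: "('a::{t2_space,second_countable_topology} set \<times> ('a \<Rightarrow> complex^'n)) set"
    and Z :: "('z set \<times> nat \<times> ('z \<Rightarrow> nat \<Rightarrow> complex)) set"
  assumes A: "complex_manifold A" and comp: "compact (UNIV :: 'a set)" and conn: "connected (UNIV :: 'a set)"
    and g: "kaehler_metric A g" and ric: "ricci_perp_positive A g"
    and X: "algebraic_structure_on A X" and Z: "variety Z" and f: "birational_morphism X Z f"
    and D: "smooth_hypersurface A D" and p: "p \<in> carrier_of Z" "f ` D = {p}"
  shows False
proof -
  have cX: "carrier_of X = UNIV" using X by (simp add: algebraic_structure_on_def)
  obtain V K \<psi> where V: "(V, K, \<psi>) \<in> Z" "p \<in> V" using p(1) unfolding carrier_of_def by auto
  have zV: "zariski_open Z V"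
    unfolding zariski_open_def
  proof (intro conjI)
    show "V \<subseteq> carrier_of Z" using V(1) unfolding carrier_of_def by auto
    show "\<forall>(U,N,\<phi>)\<in>Z. zariski_open_in N (\<phi> ` U) (\<phi> ` (V \<inter> U))"
      using varietyD(3)[OF Z _ V(1)] by (auto simp: Int_commute)
  qed
  have reg: "regular_on Z V (\<lambda>z. \<psi> z i)" if "i < K" for i
    unfolding regular_on_def using varietyD(4)[OF Z _ V(1) that] by (auto simp: Int_commute o_def)
  obtain W h where mor: "morphism_on X (carrier_of X) Z f" and W: "zariski_open Z W" "W \<noteq> {}"
    and hom: "morphism_on Z W X h" "\<And>z. z \<in> W \<Longrightarrow> f (h z) = z" "\<And>x. x \<in> carrier_of X \<Longrightarrow> f x \<in> W \<Longrightarrow> h (f x) = x"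
    using f unfolding birational_morphism_def by blast
  define T where "T = {x. f x \<in> V}"
  have zT: "zariski_open X T" and zW: "zariski_open X {x. f x \<in> W}"
    using mor zV W(1) unfolding morphism_on_def cX T_def by simp_all
  have regT: "regular_on X T ((\<lambda>z. \<psi> z i) \<circ> f)" if "i < K" for i
    using mor zV reg[OF that] unfolding morphism_on_def cX T_def by simp
  have T: "open T" by (rule open_zariski_open[OF X zT])
  have DT: "D \<subseteq> T" using p(2) V(2) by (auto simp: T_def)
  obtain x where x: "x \<in> D" using D unfolding smooth_hypersurface_def by blast
  define u where "u i y = \<psi> (f y) i - \<psi> p i" for i y
  have "\<exists>N. open N \<and> x \<in> N \<and> (\<forall>y\<in>N \<inter> T. u i y = 0)" if i: "i < K" for i
  proof (rule vanishing_function_locally_zero[OF A comp g ric D DT _ _ x])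
    show "holomorphic_near A T (u i)"
      using holomorphic_near_shift[OF holomorphic_near_regular[OF A X zT regT[OF i]], of "\<psi> p i"]
      by (simp add: u_def[abs_def])
    show "u i y = 0" if "y \<in> D" for y using p(2) that by (auto simp: u_def)
  qed
  then obtain N where N: "\<And>i. i < K \<Longrightarrow> open (N i) \<and> x \<in> N i \<and> (\<forall>y\<in>N i \<inter> T. u i y = 0)"
    by metis
  define O' where "O' = T \<inter> (\<Inter>i\<in>{..<K}. N i)"
  have O': "open O'" unfolding O'_def using T N by (intro open_Int open_INT) auto
  have "x \<in> O'" using N x DT by (auto simp: O'_def)
  have fO: "f y = p" if y: "y \<in> O'" for y
  proof (rule inj_onD[OF varietyD(1)[OF Z V(1)]])
    show yV: "f y \<in> V" "p \<in> V" using y V(2) by (auto simp: O'_def T_def)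
    have aff: "\<psi> ` V \<subseteq> affine_space K" using varietyD(2)[OF Z V(1)] by (auto simp: algebraic_set_def)
    show "\<psi> (f y) = \<psi> p"
    proof
      fix i show "\<psi> (f y) i = \<psi> p i"
      proof (cases "i < K")
        case True
        then have "u i y = 0" using N[of i] y by (auto simp: O'_def)
        then show ?thesis by (simp add: u_def)
      next
        case False
        then have "\<psi> z i = 0" if "z \<in> V" for z
          using aff that by (auto simp: affine_space_def)
        then show ?thesis using yV by simp
      qed
    qed
  qed
  obtain z where "z \<in> W" using W(2) by blast
  then have "h z \<in> {x. f x \<in> W}" using hom(2)[of z] by simp
  then have ne: "{x. f x \<in> W} \<noteq> {}" by (metis empty_iff)
  have "O' \<noteq> {}" using \<open>x \<in> O'\<close> by (metis empty_iff)
  then have "{x. f x \<in> W} \<inter> O' \<noteq> {}" by (rule zariski_open_dense[OF A X conn zW ne O'])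
  then obtain y where y: "f y \<in> W" "y \<in> O'" by blast
  \<comment> \<open>Every point of the intersection is mapped to p and recovered from it by h, so it
    equals \<open>h p\<close>; an open set would thus consist of one point.\<close>
  have "{x. f x \<in> W} \<inter> O' = {y}"
  proof -
    have "y' = y" if "f y' \<in> W" "y' \<in> O'" for y'
    proof -
      have "h p = y'" "h p = y"
        using hom(3)[of y'] hom(3)[of y] that(1) y(1) fO[OF that(2)] fO[OF y(2)] by (simp_all add: cX)
      then show ?thesis by metis
    qed
    then show ?thesis using y by blast
  qed
  moreover have "open ({x. f x \<in> W} \<inter> O')" using open_zariski_open[OF X zW] O' by blast
  ultimately show False using manifold_not_open_singleton[OF A, of y] by simp
qed

theorem corollary1p7:
  fixes A :: "('a::{t2_space,second_countable_topology} set \<times> ('a \<Rightarrow> complex^'n)) set"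
    and g :: "'a set \<times> ('a \<Rightarrow> complex^'n) \<Rightarrow> complex^'n \<Rightarrow> complex^'n^'n"
  assumes "complex_manifold A"
    and "compact (UNIV :: 'a set)"
    and "connected (UNIV :: 'a set)"
    and "kaehler_metric A g"
    and "ricci_perp_positive A g"
  shows "\<not> (\<exists>(B :: ('c::{t2_space,second_countable_topology} set \<times> ('c \<Rightarrow> complex^1)) set) f.
              complex_manifold B \<and> connected (UNIV :: 'c set) \<and>
              holomorphic_map A B f \<and> surj f)
       \<and> \<not> (\<exists>X (Z :: ('z set \<times> nat \<times> ('z \<Rightarrow> nat \<Rightarrow> complex)) set) f.
              algebraic_structure_on A X \<and> normal_variety Z \<and>
              birational_morphism X Z f \<and> f ` UNIV = carrier_of Z \<and>
              (\<exists>D p. smooth_hypersurface A D \<and> p \<in> carrier_of Z \<and> f ` D = {p}))"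
proof (intro conjI notI; elim exE conjE)
  fix B :: "('c set \<times> ('c \<Rightarrow> complex^1)) set" and f
  assume "complex_manifold B" "holomorphic_map A B f" "surj f"
  then show False
    by (rule no_surjection_onto_curve[OF assms(1,2,4,5)])
next
  fix X and Z :: "('z set \<times> nat \<times> ('z \<Rightarrow> nat \<Rightarrow> complex)) set" and f D p
  assume X: "algebraic_structure_on A X" and Z: "normal_variety Z" and f: "birational_morphism X Z f"
    and D: "smooth_hypersurface A D" "p \<in> carrier_of Z" "f ` D = {p}"
  have "variety Z" using Z by (simp add: normal_variety_def)
  from no_contracted_hypersurface[OF assms X this f D] show False .
qed

end
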